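(* Let $d\ge2$, $a>0$, $k\ge2$. Let $E\subset\mathbb R^d$ be closed and let $x^{(1)},\ldots,x^{(k)},y^{(1)},\ldots,y^{(k)}\in E$ be such that $$\mathrm{diam}(E)=|x^{(1)}-y^{(1)}|=\ldots=|x^{(k)}-y^{(k)}|=2a,$$ $(x^{(i)},y^{(i)})\ne(x^{(j)},y^{(j)})\ne(y^{(i)},x^{(i)})$ for $i\ne j$, and $|x-y|<2a$ for each $(x,y)\in(E\setminus\{x^{(1)},\ldots,x^{(k)},y^{(1)},\ldots,y^{(k)}\})\times E$. For $m\in\{1,\ldots,k\}$ let $\phi^{(m)}$ be a rigid motion of $\mathbb R^d$ with $\phi^{(m)}(x^{(m)})=(-a,\mathbf 0)$ and $\phi^{(m)}(y^{(m)})=(a,\mathbf 0)$. Let $f$ be a probability density on $E$ and $f^{(m)}:=f\circ(\phi^{(m)})^{-1}$. Assume that, for each $m\in\{1,\ldots,k\}$, the set $\phi^{(m)}(E)$ has smooth pole caps and satisfies the curvature condition for some constant in $(0,1)$ (both as defined in the context), with Hessians denoted by $H_\ell^{(m)},H_r^{(m)}$, and that $f^{(m)}$ is continuous at $(-a,\mathbf 0)$ and $(a,\mathbf 0)$ with $p_\ell^{(m)}:=f^{(m)}(-a,\mathbf 0)>0$ and $p_r^{(m)}:=f^{(m)}(a,\mathbf 0)>0$. Let $Z_1,Z_2,\ldots$ be i.i.d. with density $f$, for each $n\in\mathbb N$ let $N_n$ be Poisson with mean $n$ and independent of $(Z_i)_{i\ge 1}$, and put $\mathrm{diam}(\mathbf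 Z_n):=\max_{1\le i,j\le N_n}|Z_i-Z_j|$, $M_n:=\max_{1\le i,j\le n}|Z_i-Z_j|$. Then, as $n\to\infty$, $$n^{\frac2{d+1}}\big(2a-\mathrm{diam}(\mathbf Z_n)\big)\overset{\mathcal D}{\longrightarrow}\min_{1\le m\le k}Z^{(m)},$$ with independent random variables $Z^{(1)},\ldots,Z^{(k)}$ satisfying $$Z^{(m)}\overset{\mathcal D}{=}\min_{i,j\ge1}\Big\{\mathcal X_{i,1}^{(m)}+\mathcal Y_{j,1}^{(m)}-\frac1{4a}\big|\widetilde{\mathcal X}_i^{(m)}-\widetilde{\mathcal Y}_j^{(m)}\big|^2\Big\},$$ where all the Poisson processes $\{\mathcal X_i^{(m)},i\ge1\}$ with intensity measure $p_\ell^{(m)}\cdot m_d|_{P(H_\ell^{(m)})}$ and $\{\mathcal Y_j^{(m)},j\ge1\}$ with intensity measure $p_r^{(m)}\cdot m_d|_{P(H_r^{(m)})}$, $m\in\{1,\ldots,k\}$, are independent. The same result holds true if $\mathrm{diam}(\mathbf Z_n)$ is replaced with $M_n$.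
   Context: Notation: $|\cdot|$ is the Euclidean norm, $m_d$ Lebesgue measure on $\mathbb R^d$, $\mu|_A(B):=\mu(A\cap B)$, $\widetilde z:=(z_2,\ldots,z_d)$ for $z\in\mathbb R^d$. A maximum over an empty set is $0$ (immaterial). Below, $F$ denotes a closed set containing $(-a,\mathbf 0)$ and $(a,\mathbf 0)$ (to be taken as $F=\phi^{(m)}(E)$). Smooth pole caps of $F$: there are constants $\delta_\ell,\delta_r\in(0,a]$, open neighborhoods $O_\ell,O_r\subset\mathbb R^{d-1}$ of $\mathbf 0$ and twice continuously differentiable functions $s^\ell:O_\ell\to[0,\infty)$, $s^r:O_r\to[0,\infty)$ with $F\cap\{z_1<-a+\delta_\ell\}=\{(z_1,\widetilde z):-a+s^\ell(\widetilde z)\le z_1<-a+\delta_\ell,\ \widetilde z\in O_\ell\}$ and $F\cap\{a-\delta_r<z_1\}=\{(z_1,\widetilde z):a-\delta_r<z_1\le a-s^r(\widetilde z),\ \widetilde z\in O_r\}$. For $i\in\{\ell,r\}$, $H_i$ is the Hessian of $s^i$ at $\mathbf 0$, $\kappa_2^i\le\ldots\le\kappa_d^i$ its eigenvalues, $D_i:=\mathrm{diag}(\kappa_2^i,\ldots,\kappa_d^i)$, and $U_i$ an orthogonal matrix whose columns are corresponding orthonormal eigenvectors, so $U_i^\top H_iU_i=D_i$. For $F=\phi^{(m)}(E)$ these Hessians are denoted $H_\ell^{(m)},H_r^{(m)}$. Curvature condition for $\eta\in(0,1)$: the matrix $$A(\eta):=\begin{pmatrix} 2a\eta D_\ell-\mathrm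 I_{d-1} & U_\ell^\top U_r \\ U_r^\top U_\ell & 2a\eta D_r-\mathrm I_{d-1} \end{pmatrix}$$ is positive semi-definite. For a $(d-1)\times(d-1)$ matrix $H$: $P(H):=\{(z_1,\widetilde z)\in\mathbb R^d:\frac12\widetilde z^\top H\widetilde z\le z_1\}$. *)

theory Defs
  imports "HOL-Probability.Probability"
begin

text \<open>
  A point of \<open>d\<close>-dimensional space is a pair \<open>(z\<^sub>1, w)\<close> of type \<open>real \<times> (real^'n)\<close>: the first
  coordinate and the vector of the other \<open>d - 1 = CARD('n)\<close> coordinates. The norm of this type is
  the Euclidean one, \<open>lborel\<close> is \<open>d\<close>-dimensional Lebesgue measure, and \<open>d \<ge> 2\<close> holds because
  types are nonempty.
\<close>

type_synonym 'n point = "real \<times> (real, 'n) vec"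
type_synonym 'n sqmat = "((real, 'n) vec, 'n) vec"

text \<open>Orientation-reversing isometries are allowed.\<close>

definition rigid_motion :: "('a::euclidean_space \<Rightarrow> 'a) \<Rightarrow> bool" where
  "rigid_motion \<phi> \<longleftrightarrow> (\<exists>T c. orthogonal_transformation T \<and> \<phi> = (\<lambda>z. T z + c))"

definition C2_on ::
    "(real^'n) set \<Rightarrow> (real^'n \<Rightarrow> real) \<Rightarrow> (real^'n \<Rightarrow> real^'n^'n) \<Rightarrow> bool" where
  "C2_on W s Hess \<longleftrightarrow>
     (\<exists>grad. \<forall>w\<in>W. GDERIV s w :> grad w \<and> (grad has_derivative (\<lambda>h. Hess w *v h)) (at w)) \<and>
     continuous_on W Hess"

definition smooth_left_cap :: "real \<Rightarrow> ('n::finite) point set \<Rightarrow> 'n sqmat \<Rightarrow> bool" where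
  "smooth_left_cap a F H \<longleftrightarrow>
     (\<exists>\<delta> W s Hess. 0 < \<delta> \<and> \<delta> \<le> a \<and> open W \<and> 0 \<in> W \<and> (\<forall>w\<in>W. 0 \<le> s w) \<and>
        C2_on W s Hess \<and> Hess 0 = H \<and>
        F \<inter> {z. fst z < - a + \<delta>} =
          {(z1, w). - a + s w \<le> z1 \<and> z1 < - a + \<delta> \<and> w \<in> W})"

definition smooth_right_cap :: "real \<Rightarrow> ('n::finite) point set \<Rightarrow> 'n sqmat \<Rightarrow> bool" where
  "smooth_right_cap a F H \<longleftrightarrow>
     (\<exists>\<delta> W s Hess. 0 < \<delta> \<and> \<delta> \<le> a \<and> open W \<and> 0 \<in> W \<and> (\<forall>w\<in>W. 0 \<le> s w) \<and>
        C2_on W s Hess \<and> Hess 0 = H \<and>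
        F \<inter> {z. a - \<delta> < fst z} =
          {(z1, w). a - \<delta> < z1 \<and> z1 \<le> a - s w \<and> w \<in> W})"

text \<open>
  Since \<open>F\<close> contains both poles, \<open>F\<close> determines the cap functions near \<open>0\<close> and hence the two
  Hessians.
\<close>

definition smooth_pole_caps ::
    "real \<Rightarrow> ('n::finite) point set \<Rightarrow> 'n sqmat \<Rightarrow> 'n sqmat \<Rightarrow> bool" where
  "smooth_pole_caps a F Hl Hr \<longleftrightarrow> smooth_left_cap a F Hl \<and> smooth_right_cap a F Hr"

text \<open>The linear order on the index type is only used to list the eigenvalues increasingly.\<close>

definition ordered_eigensystem ::
    "('n::{finite,linorder}) sqmat \<Rightarrow> ('n \<Rightarrow> real) \<Rightarrow> 'n sqmat \<Rightarrow> bool" where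
  "ordered_eigensystem H \<kappa> U \<longleftrightarrow>
     mono \<kappa> \<and> orthogonal_matrix U \<and> (\<forall>i. H *v column i U = \<kappa> i *\<^sub>R column i U)"

definition diag_matrix :: "('n::finite \<Rightarrow> real) \<Rightarrow> 'n sqmat" where
  "diag_matrix \<kappa> = (\<chi> i j. if i = j then \<kappa> i else 0)"

definition block_matrix ::
    "('n::finite) sqmat \<Rightarrow> 'n sqmat \<Rightarrow> 'n sqmat \<Rightarrow> 'n sqmat \<Rightarrow> ('n + 'n) sqmat" where
  "block_matrix A B C D =
     (\<chi> p q. case p of
         Inl i \<Rightarrow> (case q of Inl j \<Rightarrow> A $ i $ j | Inr j \<Rightarrow> B $ i $ j)
       | Inr i \<Rightarrow> (case q of Inl j \<Rightarrow> C $ i $ j | Inr j \<Rightarrow> D $ i $ j))"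

definition pos_semidefinite :: "('n::finite) sqmat \<Rightarrow> bool" where
  "pos_semidefinite A \<longleftrightarrow> transpose A = A \<and> (\<forall>v. 0 \<le> v \<bullet> (A *v v))"

text \<open>
  The eigenvector matrices are not unique, but two choices lead to block matrices that are
  conjugate by an orthogonal block-diagonal matrix, so the existential quantifier over them is
  equivalent to a universal one.
\<close>

definition curvature_condition ::
    "real \<Rightarrow> real \<Rightarrow> ('n::{finite,linorder}) sqmat \<Rightarrow> 'n sqmat \<Rightarrow> bool" where
  "curvature_condition a \<eta> Hl Hr \<longleftrightarrow>
     (\<exists>\<kappa>l Ul \<kappa>r Ur. ordered_eigensystem Hl \<kappa>l Ul \<and> ordered_eigensystem Hr \<kappa>r Ur \<and>
        pos_semidefinite
          (block_matrix
            ((2 * a * \<eta>) *\<^sub>R diag_matrix \<kappa>l - mat 1) (transpose Ul ** Ur)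
            (transpose Ur ** Ul) ((2 * a * \<eta>) *\<^sub>R diag_matrix \<kappa>r - mat 1)))"

definition paraboloid :: "('n::finite) sqmat \<Rightarrow> 'n point set" where
  "paraboloid H = {(z1, w). (1/2) * (w \<bullet> (H *v w)) \<le> z1}"

definition cap_intensity :: "real \<Rightarrow> ('n::finite) sqmat \<Rightarrow> 'n point measure" where
  "cap_intensity p H = density lborel (\<lambda>z. ennreal p * indicator (paraboloid H) z)"

text \<open>
  Point processes with infinitely many points are given by an enumeration \<open>X 1, X 2, \<dots>\<close> of their
  points; the value of the associated random counting measure at \<open>B\<close> is:
\<close>

definition point_count :: "(nat \<Rightarrow> 'w \<Rightarrow> 'a) \<Rightarrow> 'a set \<Rightarrow> 'w \<Rightarrow> ennreal" where
  "point_count X B \<omega> = emeasure (count_space {1..}) {i\<in>{1..}. X i \<omega> \<in> B}"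

text \<open>The Poisson weights are written out because \<open>poisson_pmf\<close> excludes the parameter \<open>0\<close>.\<close>

definition poisson_process :: "'w measure \<Rightarrow> 'a measure \<Rightarrow> (nat \<Rightarrow> 'w \<Rightarrow> 'a) \<Rightarrow> bool" where
  "poisson_process P \<Lambda> X \<longleftrightarrow>
     (\<forall>i\<ge>1. X i \<in> measurable P \<Lambda>) \<and>
     (\<forall>B\<in>sets \<Lambda>. emeasure \<Lambda> B < \<infinity> \<longrightarrow>
        (\<forall>n::nat. measure P {\<omega>\<in>space P. point_count X B \<omega> = of_nat n} =
           measure \<Lambda> B ^ n / fact n * exp (- measure \<Lambda> B))) \<and>
     (\<forall>B\<in>sets \<Lambda>. emeasure \<Lambda> B = \<infinity> \<longrightarrow> (AE \<omega> in P. point_count X B \<omega> = \<infinity>)) \<and>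
     (\<forall>(J::nat set) B. finite J \<longrightarrow> B ` J \<subseteq> sets \<Lambda> \<longrightarrow> disjoint_family_on B J \<longrightarrow>
        prob_space.indep_vars P (\<lambda>_. borel) (\<lambda>j. point_count X (B j)) J)"

text \<open>
  Independence of point processes is independence of the generated counting measures, i.e. of the
  sigma-algebras generated by all counts, and not of the particular enumerations.
\<close>

definition indep_point_processes ::
    "'w measure \<Rightarrow> ('i \<Rightarrow> nat \<Rightarrow> 'w \<Rightarrow> 'a::topological_space) \<Rightarrow> 'i set \<Rightarrow> bool" where
  "indep_point_processes P X I \<longleftrightarrow>
     prob_space.indep_vars P (\<lambda>_. PiM (sets borel) (\<lambda>_. borel))
       (\<lambda>i \<omega>. \<lambda>B\<in>sets borel. point_count (X i) B \<omega>) I"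

definition pair_value :: "real \<Rightarrow> ('n::finite) point \<Rightarrow> 'n point \<Rightarrow> real" where
  "pair_value a u v = fst u + fst v - (1 / (4 * a)) * (norm (snd u - snd v))\<^sup>2"

definition min_pair_value ::
    "real \<Rightarrow> (nat \<Rightarrow> 'w \<Rightarrow> ('n::finite) point) \<Rightarrow> (nat \<Rightarrow> 'w \<Rightarrow> 'n point) \<Rightarrow> 'w \<Rightarrow> real" where
  "min_pair_value a X Y \<omega> = (INF (i, j)\<in>{1..} \<times> {1..}. pair_value a (X i \<omega>) (Y j \<omega>))"

definition sample_diam :: "(nat \<Rightarrow> 'a::real_normed_vector) \<Rightarrow> nat \<Rightarrow> real" where
  "sample_diam z N =
     (if N = 0 then 0 else Max ((\<lambda>(i, j). norm (z i - z j)) ` ({1..N} \<times> {1..N})))"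

end

theory Submission
  imports Defs
begin

text \<open>
  By compactness and uniqueness of the partner of a pole, two sample points at distance almost \<open>2 a\<close>
  are close to the two ends of one of the \<open>k\<close> diameters. With \<open>r = n powr (- 2 / (d + 1))\<close>, zooming in at
  the poles by \<open>1 / r\<close> in the direction of the diameter and by \<open>1 / sqrt r\<close> in the tangential directions
  multiplies volumes by \<open>n\<close>, turns the caps into paraboloids, and turns the deficit \<open>(2 a - |u - v|) / r\<close>
  into \<open>pair_value\<close> up to an error of order \<open>r\<close>. The curvature condition keeps all relevant zoomed
  points in a fixed ball.

  No convergence of point processes is needed: cover that ball by finitely many small cells. Whether
  a pair with small \<open>pair_value\<close> exists is, up to the oscillation of \<open>pair_value\<close> on cells, determined
  by the set of occupied cells, whose law is determined by the probabilities that a union of cells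
  is empty. For the sample these are \<open>(1 - p)^n\<close> or \<open>exp (- n p)\<close> where \<open>n p\<close> converges to the
  intensity of the union, so that both tend to the avoidance probabilities of the Poisson processes.
\<close>

section \<open>Curvature and Taylor expansion at a pole\<close>

text \<open>The obstacle lies at infinity: the limit processes have infinitely many points, and a
  pair value subtracts a squared tangential distance, so remote pairs might compete. The strict
  inequality \<open>\<eta> < 1\<close> excludes this, because it leaves the fraction
  \<open>1 - \<eta>\<close> of the total depth \<open>fst \<xi> + fst \<zeta>\<close> as a lower
  bound of the pair value. For the sample this fraction must also survive the Taylor error of the
  caps and the square of the depths, hence an auxiliary constant \<theta> between \<eta> and 1. The
  exponent comes from the volume factor r times d - 1 factors sqrt r, which has to equal 1 / n. A
  smooth cap fixes the direction of a diameter, so no point is an end of two diameters; cells at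
  different poles then do not interfere and their masses add. Passing to cells loses a little in
  both directions, so the distribution function is only bounded by limit values at shifted
  arguments; the bounds meet at continuity points, which is what weak convergence asks for. The
  limit variables are known through their laws and independence, so they are compared by the product
  formula for tails.\<close>

lemma sum_UNIV_sum_type:
  fixes g :: "'n::finite + 'm::finite \<Rightarrow> 'b::comm_monoid_add"
  shows "(\<Sum>s\<in>UNIV. g s) = (\<Sum>i\<in>UNIV. g (Inl i)) + (\<Sum>i\<in>UNIV. g (Inr i))"
  using sum.Plus[of "UNIV :: 'n set" "UNIV :: 'm set" g] by (simp add: comp_def)

lemma inner_sum_type_vec:
  fixes u v :: "real^('n::finite + 'm::finite)"
  shows "u \<bullet> v = (\<Sum>i\<in>UNIV. u $ Inl i * v $ Inl i) + (\<Sum>i\<in>UNIV. u $ Inr i * v $ Inr i)"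
  by (simp add: inner_vec_def sum_UNIV_sum_type)

lemma inner_block_matrix:
  fixes A B C D :: "('n::finite) sqmat" and p q :: "real^'n"
  defines "v \<equiv> \<chi> s. case s of Inl i \<Rightarrow> p $ i | Inr i \<Rightarrow> q $ i"
  shows "v \<bullet> (block_matrix A B C D *v v) =
    p \<bullet> (A *v p) + p \<bullet> (B *v q) + q \<bullet> (C *v p) + q \<bullet> (D *v q)"
proof -
  have "block_matrix A B C D *v v =
      (\<chi> s. case s of Inl i \<Rightarrow> (A *v p + B *v q) $ i | Inr i \<Rightarrow> (C *v p + D *v q) $ i)"
    unfolding v_def
    by (auto simp: vec_eq_iff matrix_vector_mult_def block_matrix_def sum_UNIV_sum_type split: sum.split)
  then show ?thesis
    unfolding v_def by (simp add: inner_sum_type_vec)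
      (simp add: inner_vec_def algebra_simps sum.distrib)
qed

lemma orthogonal_matrix_inner:
  fixes U :: "('n::finite) sqmat"
  assumes "orthogonal_matrix U"
  shows "(U *v p) \<bullet> (U *v q) = p \<bullet> q"
  using assms orthogonal_transformation_matrix[of "(*v) U"]
  by (simp add: orthogonal_transformation_def)

lemma inner_transpose_mult:
  fixes U V :: "('n::finite) sqmat"
  shows "p \<bullet> ((transpose U ** V) *v q) = (U *v p) \<bullet> (V *v q)"
  by (metis dot_lmul_matrix inner_commute matrix_vector_mul_assoc transpose_matrix_vector)

lemma eigensystem_mult:
  fixes U :: "('n::{finite,linorder}) sqmat"
  assumes "ordered_eigensystem H \<kappa> U"
  shows "H *v (U *v c) = U *v (diag_matrix \<kappa> *v c)"
proof -
  have D: "(diag_matrix \<kappa> *v c) $ i = \<kappa> i * c $ i" for i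
    by (simp add: matrix_vector_mult_def diag_matrix_def if_distrib[of "\<lambda>x. x * _"] cong: if_cong)
  have "H *v (U *v c) = H *v (\<Sum>i\<in>UNIV. c $ i *\<^sub>R column i U)"
    by (simp add: matrix_mult_sum scalar_mult_eq_scaleR)
  also have "\<dots> = (\<Sum>i\<in>UNIV. c $ i *\<^sub>R (H *v column i U))"
    by (simp add: linear_sum[OF matrix_vector_mul_linear] matrix_vector_mult_scaleR)
  also have "\<dots> = (\<Sum>i\<in>UNIV. (\<kappa> i * c $ i) *\<^sub>R column i U)"
    using assms by (auto simp: ordered_eigensystem_def mult.commute)
  also have "\<dots> = U *v (diag_matrix \<kappa> *v c)"
    by (subst matrix_mult_sum) (simp add: scalar_mult_eq_scaleR D)
  finally show ?thesis .
qed

text \<open>Test the block matrix with the eigenvector coordinates \<open>transpose Ul *v v\<close>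
  and \<open>transpose Ur *v w\<close>. The off-diagonal blocks contribute
  \<open>2 * (v \<bullet> w)\<close> and complete the two identity blocks to minus the square of
  \<open>norm (v - w)\<close>. Later arguments work with this basis-free inequality.\<close>

lemma curvature_condition_imp:
  fixes Hl Hr :: "('n::{finite,linorder}) sqmat"
  assumes "curvature_condition a \<eta> Hl Hr"
  shows "(norm (v - w))\<^sup>2 \<le> 2 * a * \<eta> * (v \<bullet> (Hl *v v) + w \<bullet> (Hr *v w))"
proof -
  obtain \<kappa>l Ul \<kappa>r Ur where l: "ordered_eigensystem Hl \<kappa>l Ul" and r: "ordered_eigensystem Hr \<kappa>r Ur"
    and ps: "pos_semidefinite
          (block_matrix
            ((2 * a * \<eta>) *\<^sub>R diag_matrix \<kappa>l - mat 1) (transpose Ul ** Ur)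
            (transpose Ur ** Ul) ((2 * a * \<eta>) *\<^sub>R diag_matrix \<kappa>r - mat 1))"
    using assms unfolding curvature_condition_def by blast
  have oU: "orthogonal_matrix Ul" "orthogonal_matrix Ur"
    using l r by (auto simp: ordered_eigensystem_def)
  define p where "p = transpose Ul *v v"
  define q where "q = transpose Ur *v w"
  have v: "v = Ul *v p" and w: "w = Ur *v q"
    using oU unfolding p_def q_def by (simp_all only: orthogonal_matrix_def matrix_vector_mul_assoc matrix_vector_mul_lid)
  have "0 \<le> p \<bullet> (((2 * a * \<eta>) *\<^sub>R diag_matrix \<kappa>l - mat 1) *v p) + p \<bullet> ((transpose Ul ** Ur) *v q)
     + q \<bullet> ((transpose Ur ** Ul) *v p) + q \<bullet> (((2 * a * \<eta>) *\<^sub>R diag_matrix \<kappa>r - mat 1) *v q)"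
    using ps unfolding pos_semidefinite_def inner_block_matrix[symmetric] by blast
  then have "0 \<le> 2 * a * \<eta> * (p \<bullet> (diag_matrix \<kappa>l *v p)) - p \<bullet> p + 2 * (v \<bullet> w)
      + 2 * a * \<eta> * (q \<bullet> (diag_matrix \<kappa>r *v q)) - q \<bullet> q"
    by (simp add: inner_transpose_mult v[symmetric] w[symmetric] matrix_vector_mult_diff_rdistrib
      scaleR_matrix_vector_assoc[symmetric] inner_diff_right inner_commute)
  moreover have "p \<bullet> (diag_matrix \<kappa>l *v p) = v \<bullet> (Hl *v v)" "p \<bullet> p = v \<bullet> v"
     "q \<bullet> (diag_matrix \<kappa>r *v q) = w \<bullet> (Hr *v w)" "q \<bullet> q = w \<bullet> w"
    unfolding v w by (simp_all add: eigensystem_mult[OF l] eigensystem_mult[OF r]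
        orthogonal_matrix_inner[OF oU(1)] orthogonal_matrix_inner[OF oU(2)])
  ultimately show ?thesis
    by (simp add: power2_norm_eq_inner inner_diff_left inner_diff_right inner_commute algebra_simps)
qed

text \<open>The gradient vanishes at \<open>0\<close>, where the nonnegative \<open>s\<close>
  attains its minimum. Along the segment to \<open>w\<close> the remainder has derivative \<open>w
  \<bullet> (grad (t *\<^sub>R w) - Hess 0 *v (t *\<^sub>R w))\<close>, so the mean value theorem
  reduces the claim to differentiability of \<open>grad\<close> at \<open>0\<close>.\<close>

lemma C2_Taylor:
  fixes s :: "real^'n::finite \<Rightarrow> real"
  assumes C2: "C2_on W s Hess" and W: "open W" "0 \<in> W" and s: "s 0 = 0" "\<And>w. w \<in> W \<Longrightarrow> 0 \<le> s w"
    and e: "e > 0"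
  shows "\<exists>\<rho>>0. \<forall>w. norm w < \<rho> \<longrightarrow> w \<in> W \<and> \<bar>s w - (1/2) * (w \<bullet> (Hess 0 *v w))\<bar> \<le> e * (norm w)\<^sup>2"
proof -
  obtain grad where g: "\<And>w. w \<in> W \<Longrightarrow> GDERIV s w :> grad w"
    "(grad has_derivative (\<lambda>h. Hess 0 *v h)) (at 0)"
    using C2 W unfolding C2_on_def by blast
  have "(\<lambda>h. h \<bullet> grad 0) = (\<lambda>_. 0)"
    by (rule differential_zero_maxmin[OF W(2,1)]) (use g(1)[OF W(2)] s in \<open>auto simp: gderiv_def\<close>)
  then have g0: "grad 0 = 0"
    by (metis inner_eq_zero_iff)
  obtain \<rho>1 where \<rho>1: "\<rho>1 > 0" "ball 0 \<rho>1 \<subseteq> W"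
    using W open_contains_ball by blast
  obtain \<rho>2 where \<rho>2: "\<rho>2 > 0" "\<And>w. norm w < \<rho>2 \<Longrightarrow> norm (grad w - Hess 0 *v w) \<le> e * norm w"
    using g(2) e unfolding has_derivative_at_alt by (auto simp: g0)
  show ?thesis
  proof (intro exI[of _ "min \<rho>1 \<rho>2"] conjI allI impI)
    fix w :: "real^'n" assume w: "norm w < min \<rho>1 \<rho>2"
    show "w \<in> W" using w \<rho>1 by auto
    define h where "h t = s (t *\<^sub>R w) - (1/2) * t\<^sup>2 * (w \<bullet> (Hess 0 *v w))" for t
    have dh: "(h has_real_derivative (w \<bullet> (grad (t *\<^sub>R w) - Hess 0 *v (t *\<^sub>R w)))) (at t)"
      if "0 \<le> t" "t \<le> 1" for t
    proof -
      have "norm (t *\<^sub>R w) < \<rho>1"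
        using that w mult_right_mono[of t 1 "norm w"] by auto
      then have "t *\<^sub>R w \<in> W" using \<rho>1 by auto
      from g(1)[OF this] have "(s has_derivative (\<lambda>h. h \<bullet> grad (t *\<^sub>R w))) (at (t *\<^sub>R w))"
        by (simp add: gderiv_def)
      have "((\<lambda>t. t *\<^sub>R w) has_derivative (\<lambda>x. x *\<^sub>R w)) (at t)"
        by (auto intro!: derivative_eq_intros)
      from has_derivative_compose[OF this \<open>(s has_derivative _) _\<close>]
      have "((\<lambda>t. s (t *\<^sub>R w)) has_derivative (\<lambda>x. (x *\<^sub>R w) \<bullet> grad (t *\<^sub>R w))) (at t)"
        .
      then have "((\<lambda>t. s (t *\<^sub>R w)) has_real_derivative (w \<bullet> grad (t *\<^sub>R w))) (at t)"
        by (simp add: has_field_derivative_def mult.commute[of _ "w \<bullet> _"])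
      then show ?thesis
        unfolding h_def
        by (auto intro!: derivative_eq_intros simp: inner_diff_right matrix_vector_mult_scaleR)
    qed
    obtain z where z: "0 < z" "z < 1" "h 1 - h 0 = (1 - 0) * (w \<bullet> (grad (z *\<^sub>R w) - Hess 0 *v (z *\<^sub>R w)))"
      using MVT2[of 0 1 h, OF _ dh] by auto
    have zw: "norm (z *\<^sub>R w) \<le> norm w"
      using z by (simp add: mult_left_le_one_le)
    have "\<bar>h 1\<bar> \<le> norm w * norm (grad (z *\<^sub>R w) - Hess 0 *v (z *\<^sub>R w))"
      using z by (simp add: h_def s Cauchy_Schwarz_ineq2)
    also have "\<dots> \<le> norm w * (e * norm (z *\<^sub>R w))"
      by (rule mult_left_mono[OF \<rho>2(2)]) (use zw w in auto)
    also have "\<dots> \<le> norm w * (e * norm w)"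
      using zw e by (intro mult_left_mono) auto
    finally show "\<bar>s w - (1/2) * (w \<bullet> (Hess 0 *v w))\<bar> \<le> e * (norm w)\<^sup>2"
      by (simp add: h_def power2_eq_square mult_ac)
  qed (use \<rho>1 \<rho>2 in auto)
qed

text \<open>\<open>\<delta>\<close> and \<open>s\<close> come before the accuracy \<open>e\<close>,
  so that one cap function serves all accuracies; \<open>\<rho>\<close> also absorbs its domain.
  Membership of the pole forces \<open>s 0 \<le> 0\<close>, hence \<open>s 0 = 0\<close>, which
  starts the Taylor expansion.\<close>

lemma smooth_left_cap_approx:
  fixes F :: "('n::finite) point set"
  assumes "smooth_left_cap a F H" and "(- a, 0) \<in> F"
  obtains \<delta> s where "\<delta> > 0"
    and "\<And>e. e > 0 \<Longrightarrow> \<exists>\<rho>>0. \<forall>w. norm w < \<rho> \<longrightarrow>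
      \<bar>s w - (1/2) * (w \<bullet> (H *v w))\<bar> \<le> e * (norm w)\<^sup>2 \<and>
      (\<forall>t<\<delta>. (t - a, w) \<in> F \<longleftrightarrow> s w \<le> t)"
proof -
  obtain \<delta> W s Hess where *: "0 < \<delta>" "open W" "0 \<in> W" "\<And>w. w\<in>W \<Longrightarrow> 0 \<le> s w"
        "C2_on W s Hess" "Hess 0 = H"
    and F: "F \<inter> {z. fst z < - a + \<delta>} = {(z1, w). - a + s w \<le> z1 \<and> z1 < - a + \<delta> \<and> w \<in> W}"
    using assms(1) unfolding smooth_left_cap_def by blast
  have mem: "(z1, w) \<in> F \<longleftrightarrow> - a + s w \<le> z1 \<and> w \<in> W" if "z1 < - a + \<delta>" for z1 w
    using that set_eq_iff[THEN iffD1, OF F, rule_format, of "(z1, w)"] by simp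
  have "s 0 = 0"
    using mem[of "-a" 0] assms(2) * by force
  show thesis
  proof
    show "0 < \<delta>" by fact
    fix e :: real assume "e > 0"
    from C2_Taylor[OF *(5,2,3) \<open>s 0 = 0\<close> *(4) this]
    show "\<exists>\<rho>>0. \<forall>w. norm w < \<rho> \<longrightarrow> \<bar>s w - (1/2) * (w \<bullet> (H *v w))\<bar> \<le> e * (norm w)\<^sup>2 \<and>
      (\<forall>t<\<delta>. (t - a, w) \<in> F \<longleftrightarrow> s w \<le> t)"
      unfolding *(6) by (auto simp: mem)
  qed
qed

section \<open>Lebesgue measure under rigid motions and zooming\<close>

lemma nn_integral_lborel_shift:
  fixes g :: "'a::euclidean_space \<Rightarrow> ennreal"
  assumes [measurable]: "g \<in> borel_measurable borel"
  shows "(\<integral>\<^sup>+x. g (c + x) \<partial>lborel) = (\<integral>\<^sup>+x. g x \<partial>lborel)"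
  by (subst (2) lborel_distr_plus[of c, symmetric]) (simp add: nn_integral_distr)

text \<open>The uniqueness proof for Haar measure: integrate \<open>f x * g (x + T y)\<close> in both orders, where \<open>f\<close> is
  the indicator of the unit ball and hence invariant under \<open>T\<close>.\<close>

lemma nn_integral_lborel_orthogonal:
  fixes T :: "'a::euclidean_space \<Rightarrow> 'a" and g :: "'a \<Rightarrow> ennreal"
  assumes T: "orthogonal_transformation T" and [measurable]: "g \<in> borel_measurable borel"
  shows "(\<integral>\<^sup>+x. g (T x) \<partial>lborel) = (\<integral>\<^sup>+x. g x \<partial>lborel)"
proof -
  have lin: "linear T" using T by (rule orthogonal_transformation_linear)
  have [measurable]: "T \<in> borel_measurable borel"
    using linear_continuous_on[of T UNIV] lin
    by (auto simp: linear_conv_bounded_linear intro!: borel_measurable_continuous_onI)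
  define T' where "T' = inv T"
  have TT': "T (T' x) = x" for x
    using orthogonal_transformation_surj[OF T] by (simp add: T'_def surj_f_inv_f)
  define f :: "'a \<Rightarrow> ennreal" where "f = indicator (ball 0 1)"
  have [measurable]: "f \<in> borel_measurable borel" unfolding f_def by (rule borel_measurable_indicator) simp
  have fT: "f (- T y) = f y" for y
    by (auto simp: f_def indicator_def orthogonal_transformation_norm[OF T])
  have meas [measurable]: "(\<lambda>(y, x). f x * g (x + T y)) \<in> borel_measurable (lborel \<Otimes>\<^sub>M lborel)"
    "(\<lambda>(y, x). f (x - T y) * g x) \<in> borel_measurable (lborel \<Otimes>\<^sub>M lborel)"
    by measurable
  have "(\<integral>\<^sup>+x. f x \<partial>lborel) * (\<integral>\<^sup>+y. g (T y) \<partial>lborel)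
      = (\<integral>\<^sup>+x. \<integral>\<^sup>+y. f x * g (T y) \<partial>lborel \<partial>lborel)"
    by (simp add: nn_integral_cmult nn_integral_multc)
  also have "\<dots> = (\<integral>\<^sup>+x. \<integral>\<^sup>+y. f x * g (x + T y) \<partial>lborel \<partial>lborel)"
  proof (rule nn_integral_cong)
    fix x
    \<comment> \<open>Shifting \<open>y\<close> by the preimage \<open>T' x\<close> replaces
      \<open>T y\<close> by \<open>x + T y\<close>.\<close>
    have "(\<integral>\<^sup>+y. f x * g (T (T' x + y)) \<partial>lborel) = (\<integral>\<^sup>+y. f x * g (T y) \<partial>lborel)"
      by (rule nn_integral_lborel_shift) measurable
    then show "(\<integral>\<^sup>+y. f x * g (T y) \<partial>lborel) = (\<integral>\<^sup>+y. f x * g (x + T y) \<partial>lborel)"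
      by (simp add: linear_add[OF lin] TT')
  qed
  also have "\<dots> = (\<integral>\<^sup>+y. \<integral>\<^sup>+x. f x * g (x + T y) \<partial>lborel \<partial>lborel)"
    using lborel_pair.Fubini'[of "\<lambda>y x. f x * g (x + T y)"] meas(1) by simp
  also have "\<dots> = (\<integral>\<^sup>+y. \<integral>\<^sup>+x. f (x - T y) * g x \<partial>lborel \<partial>lborel)"
  proof (rule nn_integral_cong)
    fix y
    have "(\<integral>\<^sup>+x. f (T y + x - T y) * g (T y + x) \<partial>lborel) = (\<integral>\<^sup>+x. f (x - T y) * g x \<partial>lborel)"
      by (rule nn_integral_lborel_shift) measurable
    then show "(\<integral>\<^sup>+x. f x * g (x + T y) \<partial>lborel) = (\<integral>\<^sup>+x. f (x - T y) * g x \<partial>lborel)"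
      by (simp add: add.commute)
  qed
  also have "\<dots> = (\<integral>\<^sup>+x. \<integral>\<^sup>+y. f (x - T y) * g x \<partial>lborel \<partial>lborel)"
    using lborel_pair.Fubini'[of "\<lambda>y x. f (x - T y) * g x"] meas(2) by simp
  also have "\<dots> = (\<integral>\<^sup>+x. \<integral>\<^sup>+y. f y * g x \<partial>lborel \<partial>lborel)"
  proof (rule nn_integral_cong)
    fix x
    have "(\<integral>\<^sup>+y. f (x - T (T' x + y)) * g x \<partial>lborel) = (\<integral>\<^sup>+y. f (x - T y) * g x \<partial>lborel)"
      by (rule nn_integral_lborel_shift) measurable
    then show "(\<integral>\<^sup>+y. f (x - T y) * g x \<partial>lborel) = (\<integral>\<^sup>+y. f y * g x \<partial>lborel)"
      by (simp add: linear_add[OF lin] TT' fT)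
  qed
  also have "\<dots> = (\<integral>\<^sup>+x. f x \<partial>lborel) * (\<integral>\<^sup>+x. g x \<partial>lborel)"
    by (simp add: nn_integral_cmult nn_integral_multc)
  finally have *: "(\<integral>\<^sup>+x. f x \<partial>lborel) * (\<integral>\<^sup>+y. g (T y) \<partial>lborel) =
      (\<integral>\<^sup>+x. f x \<partial>lborel) * (\<integral>\<^sup>+x. g x \<partial>lborel)" .
  have c: "(\<integral>\<^sup>+x. f x \<partial>lborel) = emeasure lborel (ball 0 1 :: 'a set)"
    by (simp add: f_def)
  moreover have "emeasure lborel (ball 0 1 :: 'a set) \<noteq> 0"
    using content_ball_pos[of 1 "0::'a"] by (auto simp: measure_def)
  moreover have "emeasure lborel (ball 0 1 :: 'a set) < \<infinity>"
    by (rule emeasure_lborel_ball_finite)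
  ultimately show ?thesis
    using * by (auto simp: ennreal_mult_cancel_left)
qed

lemma rigid_motion_bij: "rigid_motion \<psi> \<Longrightarrow> bij \<psi>"
  unfolding rigid_motion_def
  using orthogonal_transformation_bij bij_plus_right bij_comp by (fastforce simp: comp_def)

lemma rigid_motion_dist: "rigid_motion \<psi> \<Longrightarrow> norm (\<psi> u - \<psi> v) = norm (u - v)"
  unfolding rigid_motion_def
  by (auto simp: linear_diff[OF orthogonal_transformation_linear, symmetric] orthogonal_transformation_norm)

lemma orthogonal_transformation_continuous_on:
  fixes T :: "'a::euclidean_space \<Rightarrow> 'a"
  assumes "orthogonal_transformation T"
  shows "continuous_on S T"
  using assms by (intro linear_continuous_on)
    (simp add: linear_conv_bounded_linear[symmetric] orthogonal_transformation_linear)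

lemma rigid_motion_continuous: "rigid_motion \<psi> \<Longrightarrow> continuous_on S \<psi>"
  unfolding rigid_motion_def
  by (force intro: continuous_on_add[OF orthogonal_transformation_continuous_on continuous_on_const])

lemma nn_integral_rigid_motion:
  fixes g :: "'a::euclidean_space \<Rightarrow> ennreal"
  assumes "rigid_motion \<psi>" and [measurable]: "g \<in> borel_measurable borel"
  shows "(\<integral>\<^sup>+x. g (\<psi> x) \<partial>lborel) = (\<integral>\<^sup>+x. g x \<partial>lborel)"
proof -
  obtain T c where T: "orthogonal_transformation T" and \<psi>: "\<psi> = (\<lambda>z. T z + c)"
    using assms(1) by (auto simp: rigid_motion_def)
  have "(\<integral>\<^sup>+x. g (T x + c) \<partial>lborel) = (\<integral>\<^sup>+x. g (x + c) \<partial>lborel)"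
    by (rule nn_integral_lborel_orthogonal[OF T]) measurable
  then show ?thesis
    by (simp add: \<psi> add.commute[of _ c] nn_integral_lborel_shift)
qed

section \<open>Parabolic zooming at the left pole\<close>

definition unzoom :: "real \<Rightarrow> real \<Rightarrow> ('n::finite) point \<Rightarrow> 'n point" where
  "unzoom a r \<xi> = (r * fst \<xi> - a, sqrt r *\<^sub>R snd \<xi>)"

definition zoom :: "real \<Rightarrow> real \<Rightarrow> ('n::finite) point \<Rightarrow> 'n point" where
  "zoom a r z = ((fst z + a) / r, snd z /\<^sub>R sqrt r)"

lemma zoom_unzoom [simp]: "r > 0 \<Longrightarrow> zoom a r (unzoom a r \<xi>) = \<xi>"
  by (simp add: zoom_def unzoom_def)

lemma unzoom_zoom [simp]: "r > 0 \<Longrightarrow> unzoom a r (zoom a r z) = z"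
  by (simp add: zoom_def unzoom_def)

lemma measurable_zoom [measurable]: "zoom a r \<in> borel_measurable borel"
  unfolding zoom_def[abs_def] divide_inverse by (intro borel_measurable_continuous_onI continuous_intros)

lemma measurable_unzoom [measurable]: "unzoom a r \<in> borel_measurable borel"
  unfolding unzoom_def[abs_def] by (intro borel_measurable_continuous_onI continuous_intros)

text \<open>The linear part is diagonal in \<open>Basis\<close>, with entry \<open>r\<close> at
  \<open>(1, 0)\<close> and \<open>sqrt r\<close> at the other d - 1 vectors. The product of the
  entries is the stated power, since 1 + (d - 1) / 2 = (d + 1) / 2.\<close>

lemma nn_integral_unzoom:
  fixes g :: "('n::finite) point \<Rightarrow> ennreal"
  assumes r: "r > 0" and [measurable]: "g \<in> borel_measurable borel"
  shows "(\<integral>\<^sup>+z. g z \<partial>lborel) =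
    ennreal (r powr ((real DIM('n point) + 1) / 2)) * (\<integral>\<^sup>+\<xi>. g (unzoom a r \<xi>) \<partial>lborel)"
proof -
  define c :: "'n point \<Rightarrow> real" where "c j = (if j = (1, 0) then r else sqrt r)" for j
  let ?B = "Basis :: 'n point set"
  have B: "?B = (\<lambda>u. (u, 0)) ` Basis \<union> (\<lambda>v. (0, v)) ` Basis"
    by (simp add: Basis_prod_def)
  have disj: "(\<lambda>u. (u, 0)) ` (Basis :: real set) \<inter> (\<lambda>v. (0, v)) ` (Basis :: (real^'n) set) = {}"
    by auto
  have inj: "inj_on (\<lambda>v. (0::real, v)) (Basis :: (real^'n) set)"
    by (auto simp: inj_on_def)
  have T: "(-a, 0) + (\<Sum>j\<in>?B. (c j * (x \<bullet> j)) *\<^sub>R j) = unzoom a r x" for x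
  proof -
    have "(\<Sum>j\<in>?B. (c j * (x \<bullet> j)) *\<^sub>R j) =
       (r * fst x, 0) + (\<Sum>v\<in>Basis. (sqrt r * (snd x \<bullet> v)) *\<^sub>R (0, v))"
      unfolding B
      by (subst sum.union_disjoint[OF _ _ disj])
        (auto simp: sum.reindex[OF inj] c_def inner_prod_def scaleR_Pair)
    also have "(\<Sum>v\<in>Basis. (sqrt r * (snd x \<bullet> v)) *\<^sub>R (0::real, v)) =
        (0, \<Sum>v\<in>Basis. (sqrt r * (snd x \<bullet> v)) *\<^sub>R v)"
      by (simp add: sum_prod scaleR_Pair)
    also have "(\<Sum>v\<in>Basis. (sqrt r * (snd x \<bullet> v)) *\<^sub>R v) = sqrt r *\<^sub>R snd x"
      unfolding scaleR_scaleR[symmetric] scaleR_sum_right[symmetric] euclidean_representation ..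
    finally show ?thesis by (simp add: unzoom_def)
  qed
  have "(\<Prod>j\<in>?B. \<bar>c j\<bar>) = r * (\<Prod>v\<in>(Basis :: (real^'n) set). sqrt r)"
    unfolding B using r
    by (subst prod.union_disjoint[OF _ _ disj]) (auto simp: prod.reindex[OF inj] c_def)
  also have "\<dots> = r powr ((real DIM('n point) + 1) / 2)"
    using r by (simp add: powr_half_sqrt[symmetric] powr_realpow[symmetric] powr_powr powr_add[symmetric]
        powr_mult_base field_simps)
  finally have D: "(\<Prod>j\<in>?B. \<bar>c j\<bar>) = r powr ((real DIM('n point) + 1) / 2)" .
  have "lborel = density (distr lborel borel (unzoom a r :: 'n point \<Rightarrow> _))
      (\<lambda>_. ennreal (r powr ((real DIM('n point) + 1) / 2)))"
    using lborel_affine_euclidean[of c "(-a, 0)"] r unfolding T D by (simp add: c_def)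
  then have "(\<integral>\<^sup>+z. g z \<partial>lborel) = (\<integral>\<^sup>+z. g z \<partial>density (distr lborel borel (unzoom a r :: 'n point \<Rightarrow> _))
      (\<lambda>_. ennreal (r powr ((real DIM('n point) + 1) / 2))))"
    by simp
  also have "\<dots> = ennreal (r powr ((real DIM('n point) + 1) / 2)) * (\<integral>\<^sup>+\<xi>. g (unzoom a r \<xi>) \<partial>lborel)"
    by (simp add: nn_integral_density nn_integral_distr nn_integral_cmult)
  finally show ?thesis .
qed

text \<open>By Fubini, since every slice at a fixed second component is a single point. This
  discards the boundary of the paraboloid, where membership in the zoomed caps need not
  converge.\<close>

lemma AE_off_graph:
  fixes q :: "real^'n::finite \<Rightarrow> real"
  assumes [measurable]: "q \<in> borel_measurable borel"
  shows "AE \<xi> in (lborel :: 'n point measure). fst \<xi> \<noteq> q (snd \<xi>)"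
proof -
  have M: "{\<xi> \<in> space (lborel \<Otimes>\<^sub>M lborel). fst \<xi> \<noteq> q (snd \<xi>)} \<in> sets (lborel \<Otimes>\<^sub>M lborel)"
    by (rule borel_measurable_neq) measurable
  have "AE \<xi> in lborel \<Otimes>\<^sub>M lborel. fst \<xi> \<noteq> q (snd \<xi>)"
  proof (rule lborel_pair.AE_pair_measure)
    have "AE y in lborel. AE x in lborel. x \<noteq> q y"
      by (auto simp: AE_lborel_singleton)
    then show "AE x in lborel. AE y in lborel. fst (x, y) \<noteq> q (snd (x, y))"
      using lborel_pair.AE_commute[OF M] by simp
  qed fact
  then show ?thesis unfolding lborel_prod .
qed

text \<open>Unzooming multiplies both the depth and the quadratic form of \<open>\<xi>\<close> by
  \<open>r n\<close>. Off the boundary they differ by \<open>r n * gap\<close>, and the Taylor error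
  of the cap is a smaller multiple of \<open>r n\<close>.\<close>

lemma zoom_limit_membership:
  fixes F :: "('n::finite) point set"
  assumes cap: "smooth_left_cap a F H" "(- a, 0) \<in> F"
    and r: "\<And>n. r n > 0" "r \<longlonglongrightarrow> 0" and off: "fst \<xi> \<noteq> (1/2) * (snd \<xi> \<bullet> (H *v snd \<xi>))"
  shows "\<forall>\<^sub>F n in sequentially. unzoom a (r n) \<xi> \<in> F \<longleftrightarrow> \<xi> \<in> paraboloid H"
proof -
  obtain \<delta> s where \<delta>: "\<delta> > 0"
    and s: "\<And>e. e > 0 \<Longrightarrow> \<exists>\<rho>>0. \<forall>w. norm w < \<rho> \<longrightarrow>
      \<bar>s w - (1/2) * (w \<bullet> (H *v w))\<bar> \<le> e * (norm w)\<^sup>2 \<and>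
      (\<forall>t<\<delta>. (t - a, w) \<in> F \<longleftrightarrow> s w \<le> t)"
    using smooth_left_cap_approx[OF cap] by blast
  obtain x w where \<xi>: "\<xi> = (x, w)" by (cases \<xi>)
  define gap where "gap = \<bar>(1/2) * (w \<bullet> (H *v w)) - x\<bar>"
  have gap: "gap > 0" using off by (auto simp: gap_def \<xi>)
  \<comment> \<open>Makes \<open>e * (norm w)\<^sup>2\<close> smaller than \<open>gap\<close>; the
    added 1 covers \<open>w = 0\<close>.\<close>
  define e where "e = gap / ((norm w)\<^sup>2 + 1)"
  have e: "e > 0" using gap by (auto simp: e_def add_nonneg_pos)
  have ew: "e * (norm w)\<^sup>2 < gap"
  proof -
    have "gap * (norm w)\<^sup>2 < gap * ((norm w)\<^sup>2 + 1)" using gap by simp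
    then show ?thesis by (simp add: e_def divide_less_eq add_nonneg_pos)
  qed
  obtain \<rho> where \<rho>: "\<rho> > 0" "\<And>w t. norm w < \<rho> \<Longrightarrow>
      \<bar>s w - (1/2) * (w \<bullet> (H *v w))\<bar> \<le> e * (norm w)\<^sup>2"
      "\<And>w t. norm w < \<rho> \<Longrightarrow> t < \<delta> \<Longrightarrow> (t - a, w) \<in> F \<longleftrightarrow> s w \<le> t"
    using s[OF e] by blast
  have "(\<lambda>n. sqrt (r n) * norm w) \<longlonglongrightarrow> sqrt 0 * norm w" "(\<lambda>n. r n * x) \<longlonglongrightarrow> 0 * x"
    by (intro tendsto_intros r)+
  then have "\<forall>\<^sub>F n in sequentially. sqrt (r n) * norm w < \<rho>" "\<forall>\<^sub>F n in sequentially. r n * x < \<delta>"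
    using \<rho>(1) \<delta> by (auto dest: order_tendstoD(2))
  then show ?thesis
  proof eventually_elim
    case (elim n)
    let ?w = "sqrt (r n) *\<^sub>R w"
    have nw: "norm ?w < \<rho>" using elim(1) r(1)[of n] by (simp add: less_imp_le)
    have "unzoom a (r n) \<xi> \<in> F \<longleftrightarrow> s ?w \<le> r n * x"
      using \<rho>(3)[OF nw elim(2)] by (simp add: unzoom_def \<xi>)
    moreover have "\<bar>s ?w - r n * ((1/2) * (w \<bullet> (H *v w)))\<bar> \<le> r n * (e * (norm w)\<^sup>2)"
    proof -
      have "?w \<bullet> (H *v ?w) = r n * (w \<bullet> (H *v w))"
        using r(1)[of n] by (simp add: matrix_vector_mult_scaleR mult.assoc[symmetric])
      moreover have "(norm ?w)\<^sup>2 = r n * (norm w)\<^sup>2"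
        using r(1)[of n] by (simp add: power_mult_distrib)
      ultimately show ?thesis
        using \<rho>(2)[OF nw] by (simp only: mult.left_commute)
    qed
    moreover have "r n * (e * (norm w)\<^sup>2) < r n * gap"
      using ew r(1)[of n] by simp
    ultimately have "unzoom a (r n) \<xi> \<in> F \<longleftrightarrow> s ?w \<le> r n * x"
      and *: "\<bar>s ?w - r n * ((1/2) * (w \<bullet> (H *v w)))\<bar> < r n * gap" by auto
    have "\<xi> \<in> paraboloid H \<longleftrightarrow> (1/2) * (w \<bullet> (H *v w)) \<le> x"
      by (simp add: paraboloid_def \<xi>)
    moreover have "s ?w \<le> r n * x" if "(1/2) * (w \<bullet> (H *v w)) \<le> x"
    proof -
      have "r n * gap = r n * x - r n * ((1/2) * (w \<bullet> (H *v w)))"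
        using that by (simp add: gap_def right_diff_distrib)
      then show ?thesis using * by linarith
    qed
    moreover have "s ?w > r n * x" if "\<not> (1/2) * (w \<bullet> (H *v w)) \<le> x"
    proof -
      have "r n * gap = r n * ((1/2) * (w \<bullet> (H *v w))) - r n * x"
        using that by (simp add: gap_def right_diff_distrib)
      then show ?thesis using * by linarith
    qed
    ultimately show ?case
      using \<open>_ \<longleftrightarrow> s ?w \<le> r n * x\<close> by force
  qed
qed

lemma dist_unzoom_pole_le:
  assumes "r > 0" "r \<le> 1"
  shows "dist (unzoom a r \<xi>) (- a, 0) \<le> sqrt r * (\<bar>fst \<xi>\<bar> + norm (snd \<xi>))"
proof -
  have "r \<le> sqrt r" using assms
    by (simp add: real_le_rsqrt power2_eq_square mult_left_le)
  have "dist (unzoom a r \<xi>) (- a, 0) = norm (r * fst \<xi>, sqrt r *\<^sub>R snd \<xi>)"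
    by (simp add: dist_norm unzoom_def)
  also have "\<dots> \<le> \<bar>r * fst \<xi>\<bar> + sqrt r * norm (snd \<xi>)"
    using norm_Pair_le[of "r * fst \<xi>" "sqrt r *\<^sub>R snd \<xi>"] assms by simp
  also have "\<bar>r * fst \<xi>\<bar> \<le> sqrt r * \<bar>fst \<xi>\<bar>"
    using assms \<open>r \<le> sqrt r\<close> by (simp add: abs_mult mult_right_mono)
  finally show ?thesis by (simp add: distrib_left)
qed

lemma measurable_quadratic_form [measurable]:
  "(\<lambda>w. (1/2) * (w \<bullet> (H *v w))) \<in> borel_measurable (borel :: (real^'n::finite) measure)"
  by (intro borel_measurable_continuous_onI continuous_intros
      linear_continuous_on matrix_vector_mul_bounded_linear)

lemma sets_paraboloid [measurable]: "paraboloid H \<in> sets borel"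
proof -
  have "paraboloid H = {z \<in> space borel. (1/2) * (snd z \<bullet> (H *v snd z)) \<le> fst z}"
    by (auto simp: paraboloid_def)
  also have "\<dots> \<in> sets borel"
    by (rule borel_measurable_le measurable_compose[OF _ measurable_quadratic_form[of H]]
        borel_measurable_continuous_onI continuous_on_fst continuous_on_snd continuous_on_id)+
  finally show ?thesis .
qed

text \<open>Dominated convergence: for almost every \<open>\<xi>\<close> in \<open>B\<close> the
  density tends to its pole value inside the paraboloid and is eventually 0 outside. As
  \<open>B\<close> is bounded, its unzoomed image shrinks uniformly to the pole, where continuity of
  \<open>g\<close> yields the dominating constant.\<close>

lemma zoom_density_tendsto:
  fixes F B :: "('n::finite) point set" and g :: "'n point \<Rightarrow> real"
  assumes cap: "smooth_left_cap a F H" "(- a, 0) \<in> F"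
    and r: "\<And>n. r n > 0" "r \<longlonglongrightarrow> 0"
    and g [measurable]: "g \<in> borel_measurable borel" and g0: "\<And>z. 0 \<le> g z" "\<And>z. z \<notin> F \<Longrightarrow> g z = 0"
    and cont: "continuous (at (- a, 0) within F) g"
    and B: "bounded B" and [measurable]: "B \<in> sets borel"
  shows "(\<lambda>n. \<integral>\<^sup>+\<xi>. ennreal (g (unzoom a (r n) \<xi>)) * indicator B \<xi> \<partial>lborel) \<longlonglongrightarrow>
    ennreal (g (- a, 0)) * emeasure lborel (B \<inter> paraboloid H)"
proof -
  obtain R where R: "\<And>\<xi>. \<xi> \<in> B \<Longrightarrow> norm \<xi> \<le> R" "R > 0"
    using B bounded_pos by blast
  have near: "\<forall>\<^sub>F n in sequentially. \<forall>\<xi>\<in>B. dist (unzoom a (r n) \<xi>) (-a, 0) < d" if "d > 0" for d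
  proof -
    have "(\<lambda>n. sqrt (r n) * (2 * R)) \<longlonglongrightarrow> sqrt 0 * (2 * R)"
      by (intro tendsto_intros r)
    then have "\<forall>\<^sub>F n in sequentially. sqrt (r n) * (2 * R) < d"
      using that by (auto dest: order_tendstoD(2))
    moreover have "\<forall>\<^sub>F n in sequentially. r n < 1"
      using r(2) by (rule order_tendstoD(2)) simp
    ultimately show ?thesis
    proof eventually_elim
      case (elim n)
      show ?case
      proof
        fix \<xi> assume "\<xi> \<in> B"
        then have "\<bar>fst \<xi>\<bar> + norm (snd \<xi>) \<le> 2 * R"
          using R(1)[of \<xi>] norm_fst_le[of "fst \<xi>" "snd \<xi>"] norm_snd_le[of "snd \<xi>" "fst \<xi>"] by simp
        then have "sqrt (r n) * (\<bar>fst \<xi>\<bar> + norm (snd \<xi>)) \<le> sqrt (r n) * (2 * R)"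
          by (intro mult_left_mono) (use r(1)[of n] in auto)
        with dist_unzoom_pole_le[of "r n" a \<xi>] elim r(1)[of n]
        show "dist (unzoom a (r n) \<xi>) (-a, 0) < d" by linarith
      qed
    qed
  qed
  obtain d1 where d1: "d1 > 0" "\<And>z. z \<in> F \<Longrightarrow> dist z (-a,0) < d1 \<Longrightarrow> dist (g z) (g (-a,0)) < 1"
    using cont[unfolded continuous_within_eps_delta, rule_format, of 1] by auto
  \<comment> \<open>Outside \<open>F\<close> the density is 0, so continuity relative to
    \<open>F\<close> bounds \<open>g\<close> on a full neighbourhood of the pole.\<close>
  have g_le: "g z \<le> g (-a,0) + 1" if "dist z (-a,0) < d1" for z
    using d1(2)[of z] that g0(1)[of "(-a,0)"] g0(2)[of z] by (cases "z \<in> F") (auto simp: dist_real_def)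
  obtain n0 where n0: "\<And>n. n \<ge> n0 \<Longrightarrow> \<forall>\<xi>\<in>B. dist (unzoom a (r n) \<xi>) (-a, 0) < d1"
    using near[OF d1(1)] by (auto simp: eventually_sequentially)
  have lim: "(\<lambda>n. g (unzoom a (r n) \<xi>)) \<longlonglongrightarrow> g (- a, 0) * indicator (paraboloid H) \<xi>"
    if "\<xi> \<in> B" and off: "fst \<xi> \<noteq> (1/2) * (snd \<xi> \<bullet> (H *v snd \<xi>))" for \<xi>
  proof (cases "\<xi> \<in> paraboloid H")
    case True
    show ?thesis
    proof (rule tendstoI)
      fix e :: real assume "e > 0"
      then obtain d where d: "d > 0" "\<And>z. z \<in> F \<Longrightarrow> dist z (-a,0) < d \<Longrightarrow> dist (g z) (g (-a,0)) < e"
        using cont[unfolded continuous_within_eps_delta, rule_format, of e] by auto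
      show "\<forall>\<^sub>F n in sequentially. dist (g (unzoom a (r n) \<xi>)) (g (-a, 0) * indicator (paraboloid H) \<xi>) < e"
        using zoom_limit_membership[OF cap r off] near[OF d(1)]
        by eventually_elim (use True that(1) d(2) in auto)
    qed
  next
    case False
    have "\<forall>\<^sub>F n in sequentially. g (unzoom a (r n) \<xi>) = 0"
      using zoom_limit_membership[OF cap r off] by eventually_elim (use False g0(2) in auto)
    then show ?thesis using False by (auto intro: tendsto_eventually)
  qed
  \<comment> \<open>The dominating bound holds from \<open>n0\<close> on, so the convergence theorem
    is applied to the shifted sequence.\<close>
  have "(\<lambda>n. \<integral>\<^sup>+\<xi>. ennreal (g (unzoom a (r (n + n0)) \<xi>)) * indicator B \<xi> \<partial>lborel) \<longlonglongrightarrow>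
    (\<integral>\<^sup>+\<xi>. ennreal (g (- a, 0)) * indicator (B \<inter> paraboloid H) \<xi> \<partial>lborel)"
  proof (rule nn_integral_dominated_convergence[where w="\<lambda>\<xi>. ennreal (g (-a,0) + 1) * indicator B \<xi>"])
    show "AE \<xi> in lborel. ennreal (g (unzoom a (r (j + n0)) \<xi>)) * indicator B \<xi>
        \<le> ennreal (g (-a,0) + 1) * indicator B \<xi>" for j
      using n0[of "j + n0"] by (intro AE_I2) (auto simp: indicator_def intro!: ennreal_leI g_le)
    have "emeasure lborel B < \<infinity>" by (rule emeasure_bounded_finite[OF B])
    then show "(\<integral>\<^sup>+\<xi>. ennreal (g (-a,0) + 1) * indicator B \<xi> \<partial>lborel) < \<infinity>"
      by (simp add: nn_integral_cmult ennreal_mult_less_top)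
    show "AE \<xi> in lborel. (\<lambda>i. ennreal (g (unzoom a (r (i + n0)) \<xi>)) * indicator B \<xi>)
       \<longlonglongrightarrow> ennreal (g (- a, 0)) * indicator (B \<inter> paraboloid H) \<xi>"
      using AE_off_graph[OF measurable_quadratic_form[of H]]
    proof eventually_elim
      case (elim \<xi>)
      show ?case
      proof (cases "\<xi> \<in> B")
        case True
        have "(\<lambda>n. ennreal (g (unzoom a (r (n + n0)) \<xi>))) \<longlonglongrightarrow>
            ennreal (g (- a, 0) * indicator (paraboloid H) \<xi>)"
          by (rule tendsto_ennrealI, rule LIMSEQ_ignore_initial_segment, rule lim[OF True elim])
        then show ?thesis using True by (auto simp: indicator_def split: if_splits)
      qed simp
    qed
  qed measurable
  then have "(\<lambda>n. \<integral>\<^sup>+\<xi>. ennreal (g (unzoom a (r (n + n0)) \<xi>)) * indicator B \<xi> \<partial>lborel) \<longlonglongrightarrow>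
     ennreal (g (- a, 0)) * emeasure lborel (B \<inter> paraboloid H)"
    by (simp add: nn_integral_cmult)
  then show ?thesis by (rule LIMSEQ_offset)
qed

text \<open>The zoom factor \<open>r\<close> is chosen such that zooming multiplies volumes by \<open>n\<close>.\<close>

definition zoom_rate :: "'n::finite point itself \<Rightarrow> nat \<Rightarrow> real" where
  "zoom_rate _ n = real (max 1 n) powr (- (2 / (real DIM('n point) + 1)))"

text \<open>Thanks to \<open>max 1 n\<close> this includes \<open>n = 0\<close>, so zooming never
  divides by 0.\<close>

lemma zoom_rate_pos: "zoom_rate TYPE('n::finite point) n > 0"
  by (simp add: zoom_rate_def)

lemma zoom_rate_tendsto: "zoom_rate TYPE('n::finite point) \<longlonglongrightarrow> 0"
proof -
  have "filterlim (\<lambda>n::nat. real (max 1 n)) at_top sequentially"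
    by (rule filterlim_at_top_mono[OF filterlim_real_sequentially]) auto
  then show ?thesis
    unfolding zoom_rate_def[abs_def]
    by (intro tendsto_neg_powr) (auto intro!: divide_pos_pos)
qed

text \<open>The motion \<open>\<psi>\<close> preserves Lebesgue measure, and by the choice of the
  rate zooming contributes the factor \<open>1 / n\<close>, which cancels the factor
  \<open>n\<close> in front. What remains is the limit of the zoomed densities.\<close>

lemma zoom_mass_tendsto:
  fixes E B :: "('n::finite) point set" and f :: "'n point \<Rightarrow> real"
  defines "r \<equiv> zoom_rate TYPE('n point)"
  assumes \<psi>: "rigid_motion \<psi>" and cap: "smooth_left_cap a (\<psi> ` E) H" "(- a, 0) \<in> \<psi> ` E"
    and f [measurable]: "f \<in> borel_measurable borel" and f0: "\<And>z. 0 \<le> f z" "\<And>z. z \<notin> E \<Longrightarrow> f z = 0"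
    and cont: "continuous (at (- a, 0) within \<psi> ` E) (f \<circ> inv \<psi>)"
    and B: "bounded B" and Bs [measurable]: "B \<in> sets borel"
  shows "(\<lambda>n. ennreal (real n) * emeasure (density lborel (\<lambda>z. ennreal (f z))) {z. zoom a (r n) (\<psi> z) \<in> B})
    \<longlonglongrightarrow> ennreal ((f \<circ> inv \<psi>) (- a, 0)) * emeasure lborel (B \<inter> paraboloid H)"
proof -
  have bij: "bij \<psi>" using \<psi> by (rule rigid_motion_bij)
  have [measurable]: "\<psi> \<in> borel_measurable borel"
    using rigid_motion_continuous[OF \<psi>] by (rule borel_measurable_continuous_onI)
  \<comment> \<open>The inverse of \<open>T z + c\<close> is \<open>inv T z - inv T c\<close>. Being
    rigid it is continuous, so the transported density is measurable.\<close>
  have inv\<psi>: "rigid_motion (inv \<psi>)"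
  proof -
    obtain T c where T: "orthogonal_transformation T" and \<psi>e: "\<psi> = (\<lambda>z. T z + c)"
      using \<psi> by (auto simp: rigid_motion_def)
    have T': "orthogonal_transformation (inv T)"
      using T by (rule orthogonal_transformation_inv)
    have "inv \<psi> = (\<lambda>z. inv T (z - c))"
      unfolding \<psi>e using orthogonal_transformation_bij[OF T]
      by (intro inv_equality) (auto simp: bij_is_inj bij_is_surj surj_f_inv_f)
    then have "inv \<psi> = (\<lambda>z. inv T z + (- inv T c))"
      by (simp add: linear_diff[OF orthogonal_transformation_linear[OF T']])
    then show ?thesis unfolding rigid_motion_def using T' by blast
  qed
  have [measurable]: "inv \<psi> \<in> borel_measurable borel"
    using rigid_motion_continuous[OF inv\<psi>] by (rule borel_measurable_continuous_onI)
  let ?g = "f \<circ> inv \<psi>"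
  have g [measurable]: "?g \<in> borel_measurable borel"
    by (simp add: comp_def)
  have r: "r n > 0" for n by (simp add: r_def zoom_rate_pos)
  have *: "ennreal (real n) * emeasure (density lborel (\<lambda>z. ennreal (f z))) {z. zoom a (r n) (\<psi> z) \<in> B}
      = (\<integral>\<^sup>+\<xi>. ennreal (?g (unzoom a (r n) \<xi>)) * indicator B \<xi> \<partial>lborel)" if n: "n \<ge> 1" for n
  proof -
    have "emeasure (density lborel (\<lambda>z. ennreal (f z))) {z. zoom a (r n) (\<psi> z) \<in> B}
       = (\<integral>\<^sup>+z. ennreal (f z) * indicator {z. zoom a (r n) (\<psi> z) \<in> B} z \<partial>lborel)"
      by (rule emeasure_density) measurable
    also have "\<dots> = (\<integral>\<^sup>+z. ennreal (?g (\<psi> z)) * indicator B (zoom a (r n) (\<psi> z)) \<partial>lborel)"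
      using bij by (intro nn_integral_cong) (auto simp: bij_is_inj indicator_def)
    also have "\<dots> = (\<integral>\<^sup>+z. ennreal (?g z) * indicator B (zoom a (r n) z) \<partial>lborel)"
      by (rule nn_integral_rigid_motion[OF \<psi>]) measurable
    also have "\<dots> = ennreal (r n powr ((real DIM('n point) + 1) / 2)) *
        (\<integral>\<^sup>+\<xi>. ennreal (?g (unzoom a (r n) \<xi>)) * indicator B (zoom a (r n) (unzoom a (r n) \<xi>)) \<partial>lborel)"
      by (rule nn_integral_unzoom[OF r]) measurable
    also have "r n powr ((real DIM('n point) + 1) / 2) = inverse (real n)"
    proof -
      define D where "D = real DIM('n point) + 1"
      have "D > 0" by (simp add: D_def)
      have "r n = real n powr (- (2 / D))"
        using n by (simp add: r_def zoom_rate_def D_def)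
      then have "r n powr (D / 2) = real n powr (- 1)"
        using \<open>D > 0\<close> by (simp add: powr_powr)
      then show ?thesis
        using n by (simp add: D_def powr_minus)
    qed
    finally show ?thesis
      using n r by (simp add: mult.assoc[symmetric] ennreal_mult[symmetric])
  qed
  have "(\<lambda>n. \<integral>\<^sup>+\<xi>. ennreal (?g (unzoom a (r n) \<xi>)) * indicator B \<xi> \<partial>lborel) \<longlonglongrightarrow>
      ennreal (?g (- a, 0)) * emeasure lborel (B \<inter> paraboloid H)"
  proof (rule zoom_density_tendsto[OF cap r])
    show "r \<longlonglongrightarrow> 0" unfolding r_def by (rule zoom_rate_tendsto)
    show "?g z = 0" if "z \<notin> \<psi> ` E" for z
    proof -
      have "inv \<psi> z \<notin> E"
      proof
        assume "inv \<psi> z \<in> E"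
        then have "\<psi> (inv \<psi> z) \<in> \<psi> ` E" by (rule imageI)
        then show False using that by (simp add: surj_f_inv_f bij_is_surj[OF bij])
      qed
      then show ?thesis by (simp add: f0(2))
    qed
    show "0 \<le> ?g z" for z by (simp add: f0(1))
  qed (rule g cont B Bs)+
  moreover have "\<forall>\<^sub>F n in sequentially.
      (\<integral>\<^sup>+\<xi>. ennreal (?g (unzoom a (r n) \<xi>)) * indicator B \<xi> \<partial>lborel) =
      ennreal (real n) * emeasure (density lborel (\<lambda>z. ennreal (f z))) {z. zoom a (r n) (\<psi> z) \<in> B}"
    using *[symmetric] by (rule eventually_sequentiallyI[of 1])
  ultimately show ?thesis by (rule Lim_transform_eventually)
qed

section \<open>Pairs of points at almost maximal distance\<close>

definition mirror :: "('n::finite) point \<Rightarrow> 'n point" where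
  "mirror z = (- fst z, snd z)"

lemma mirror_mirror [simp]: "mirror (mirror z) = z"
  by (simp add: mirror_def)

lemma orthogonal_transformation_mirror: "orthogonal_transformation mirror"
  by (auto simp: orthogonal_transformation_def mirror_def[abs_def] linear_iff inner_prod_def)

lemma rigid_motion_mirror: "rigid_motion \<psi> \<Longrightarrow> rigid_motion (\<lambda>z. mirror (\<psi> z))"
proof -
  assume "rigid_motion \<psi>"
  then obtain T c where T: "orthogonal_transformation T" "\<psi> = (\<lambda>z. T z + c)"
    by (auto simp: rigid_motion_def)
  have "orthogonal_transformation (\<lambda>z. mirror (T z))"
    using orthogonal_transformation_compose[OF orthogonal_transformation_mirror T(1)]
    by (simp add: comp_def)
  moreover have "(\<lambda>z. mirror (\<psi> z)) = (\<lambda>z. mirror (T z) + mirror c)"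
    by (auto simp: T(2) mirror_def)
  ultimately show ?thesis unfolding rigid_motion_def by blast
qed

lemma smooth_right_cap_mirror:
  fixes F :: "('n::finite) point set"
  assumes "smooth_right_cap a F H"
  shows "smooth_left_cap a (mirror ` F) H"
proof -
  obtain \<delta> W s Hess where *: "0 < \<delta> \<and> \<delta> \<le> a \<and> open W \<and> 0 \<in> W \<and> (\<forall>w\<in>W. 0 \<le> s w) \<and>
        C2_on W s Hess \<and> Hess 0 = H"
    and F: "F \<inter> {z. a - \<delta> < fst z} = {(z1, w). a - \<delta> < z1 \<and> z1 \<le> a - s w \<and> w \<in> W}"
    using assms unfolding smooth_right_cap_def by blast
  have mem: "z \<in> mirror ` F \<longleftrightarrow> mirror z \<in> F" for z
    by (metis imageE image_eqI mirror_mirror)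
  have "mirror ` F \<inter> {z. fst z < - a + \<delta>} = {(z1, w). - a + s w \<le> z1 \<and> z1 < - a + \<delta> \<and> w \<in> W}"
  proof (rule set_eqI)
    fix z :: "'n point"
    obtain z1 w where z: "z = (z1, w)" by (cases z)
    have "(- z1, w) \<in> F \<inter> {z. a - \<delta> < fst z} \<longleftrightarrow>
        (- z1, w) \<in> {(z1, w). a - \<delta> < z1 \<and> z1 \<le> a - s w \<and> w \<in> W}"
      unfolding F ..
    then show "z \<in> mirror ` F \<inter> {z. fst z < - a + \<delta>} \<longleftrightarrow>
        z \<in> {(z1, w). - a + s w \<le> z1 \<and> z1 < - a + \<delta> \<and> w \<in> W}"
      unfolding Int_iff mem by (auto simp: z mirror_def)
  qed
  with * show ?thesis unfolding smooth_left_cap_def by blast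
qed

text \<open>\<open>pole m False\<close> and \<open>pole m True\<close> are the two ends of the \<open>m\<close>-th diameter. Each has its own chart
  that moves it to the left pole \<open>(- a, 0)\<close>; the two charts of a diameter differ by a reflection.\<close>

locale diametral_set =
  fixes a :: real and k :: nat and E :: "('n::finite) point set"
    and pole :: "nat \<Rightarrow> bool \<Rightarrow> 'n point" and chart :: "nat \<Rightarrow> bool \<Rightarrow> 'n point \<Rightarrow> 'n point"
    and hess :: "nat \<Rightarrow> bool \<Rightarrow> 'n sqmat"
  assumes a_pos: "a > 0" and closed_E: "closed E" and bounded_E: "bounded E"
    and diameter_E: "diameter E = 2 * a"
    and pole_in: "m \<in> {1..k} \<Longrightarrow> pole m c \<in> E"
    and off_poles: "u \<in> E \<Longrightarrow> (\<And>m c. m \<in> {1..k} \<Longrightarrow> u \<noteq> pole m c) \<Longrightarrow> v \<in> E \<Longrightarrow> norm (u - v) < 2 * a"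
    and pairs_distinct: "m \<in> {1..k} \<Longrightarrow> m' \<in> {1..k} \<Longrightarrow> m \<noteq> m' \<Longrightarrow>
      pole m c \<noteq> pole m' c' \<or> pole m (\<not> c) \<noteq> pole m' (\<not> c')"
    and chart_rigid: "m \<in> {1..k} \<Longrightarrow> rigid_motion (chart m c)"
    and chart_pole: "m \<in> {1..k} \<Longrightarrow> chart m c (pole m c) = (- a, 0)"
    and chart_flip: "m \<in> {1..k} \<Longrightarrow> chart m (\<not> c) z = mirror (chart m c z)"
    and cap: "m \<in> {1..k} \<Longrightarrow> smooth_left_cap a (chart m c ` E) (hess m c)"
    and curv: "m \<in> {1..k} \<Longrightarrow> \<exists>\<eta>>0. \<eta> < 1 \<and> (\<forall>c v w. (norm (v - w))\<^sup>2 \<le>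
      2 * a * \<eta> * (v \<bullet> (hess m c *v v) + w \<bullet> (hess m (\<not> c) *v w)))"
begin

lemma dist_le: "u \<in> E \<Longrightarrow> v \<in> E \<Longrightarrow> norm (u - v) \<le> 2 * a"
  using diameter_bounded_bound[OF bounded_E] diameter_E by (metis dist_norm)

lemma left_pole_in: "m \<in> {1..k} \<Longrightarrow> (- a, 0) \<in> chart m c ` E"
  using chart_pole pole_in by (metis image_eqI)

text \<open>Each point is read in the chart of its own end, where \<open>fst + a\<close> is its
  depth below the pole. The reflection between the two charts turns the difference of first
  coordinates into \<open>2 * a\<close> minus both depths.\<close>

lemma norm_diff_charts:
  assumes "m \<in> {1..k}"
  shows "(norm (u - v))\<^sup>2 = (2 * a - (fst (chart m c u) + a) - (fst (chart m (\<not> c) v) + a))\<^sup>2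
    + (norm (snd (chart m c u) - snd (chart m (\<not> c) v)))\<^sup>2"
proof -
  have "norm (u - v) = norm (chart m c u - chart m c v)"
    using chart_rigid[OF assms] by (simp add: rigid_motion_dist)
  also have "chart m c v = mirror (chart m (\<not> c) v)"
    using chart_flip[OF assms, of "\<not> c"] by simp
  finally show ?thesis
    by (simp add: norm_prod_def mirror_def power2_commute) (simp add: power2_eq_square algebra_simps)
qed

lemma dist_pole:
  assumes "m \<in> {1..k}"
  shows "\<bar>fst (chart m c u) + a\<bar> \<le> dist u (pole m c)" "norm (snd (chart m c u)) \<le> dist u (pole m c)"
proof -
  have "dist u (pole m c) = norm (chart m c u - (- a, 0))"
    using rigid_motion_dist[OF chart_rigid[OF assms], of c u "pole m c"] chart_pole[OF assms]
    by (simp add: dist_norm)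
  then show "\<bar>fst (chart m c u) + a\<bar> \<le> dist u (pole m c)" "norm (snd (chart m c u)) \<le> dist u (pole m c)"
    using norm_fst_le[of "fst (chart m c u) + a" "snd (chart m c u)"]
      norm_snd_le[of "snd (chart m c u)" "fst (chart m c u) + a"]
    by (cases "chart m c u"; simp)+
qed

text \<open>If the chart gives a second partner \<open>v\<close> a nonzero tangential part \<open>b\<close>, then points of the cap near the
  pole in the tangential direction \<open>- b\<close> are at distance more than \<open>2 a\<close> from \<open>v\<close>.\<close>

lemma partner_unique:
  assumes m: "m \<in> {1..k}" and v: "v \<in> E" and d: "norm (pole m c - v) = 2 * a"
  shows "v = pole m (\<not> c)"
proof -
  define b where "b = chart m c v"
  obtain \<delta> s where \<delta>: "\<delta> > 0" and s: "\<And>e. e > 0 \<Longrightarrow> \<exists>\<rho>>0. \<forall>w. norm w < \<rho> \<longrightarrow>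
      \<bar>s w - (1/2) * (w \<bullet> (hess m c *v w))\<bar> \<le> e * (norm w)\<^sup>2 \<and>
      (\<forall>t<\<delta>. (t - a, w) \<in> chart m c ` E \<longleftrightarrow> s w \<le> t)"
    using smooth_left_cap_approx[OF cap[OF m] left_pole_in[OF m]] by blast
  obtain \<rho> where \<rho>: "\<rho> > 0" "\<And>w. norm w < \<rho> \<Longrightarrow>
      \<bar>s w - (1/2) * (w \<bullet> (hess m c *v w))\<bar> \<le> 1 * (norm w)\<^sup>2"
      "\<And>w t. norm w < \<rho> \<Longrightarrow> t < \<delta> \<Longrightarrow> (t - a, w) \<in> chart m c ` E \<longleftrightarrow> s w \<le> t"
    using s[of 1] by auto
  have db: "norm (pole m c - v) = norm ((- a, 0) - b)"
    using rigid_motion_dist[OF chart_rigid[OF m], of c "pole m c" v] chart_pole[OF m] by (simp add: b_def)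
  have norm2: "(norm z)\<^sup>2 = (fst z)\<^sup>2 + (norm (snd z))\<^sup>2" for z :: "'n point"
    by (simp add: norm_prod_def)
  have "(norm ((- a, 0) - b))\<^sup>2 = (2 * a)\<^sup>2"
    using d db by simp
  then have nb: "(fst b + a)\<^sup>2 + (norm (snd b))\<^sup>2 = (2 * a)\<^sup>2"
    unfolding norm2 by (simp add: power2_eq_square algebra_simps)
  \<comment> \<open>This is the bound \<open>2 * a\<close> for the distance from \<open>v\<close>,
    squared, with the equation \<open>nb\<close> for the pole subtracted.\<close>
  have far: "t * t - 2 * (fst b + a) * t - 2 * (snd b \<bullet> w) + (norm w)\<^sup>2 \<le> 0"
    if "(t - a, w) \<in> chart m c ` E" for t w
  proof -
    obtain u where u: "u \<in> E" "chart m c u = (t - a, w)" using \<open>(t - a, w) \<in> _\<close> by auto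
    have "norm ((t - a, w) - b) = norm (u - v)"
      using rigid_motion_dist[OF chart_rigid[OF m], of c u v] u by (simp add: b_def)
    then have "(norm ((t - a, w) - b))\<^sup>2 \<le> (2 * a)\<^sup>2"
      using power_mono[OF dist_le[OF u(1) v], of 2] by simp
    moreover have "(norm ((t - a, w) - b))\<^sup>2 = (t - a - fst b)\<^sup>2 + (norm (w - snd b))\<^sup>2"
      unfolding norm2 by simp
    moreover have "(norm (w - snd b))\<^sup>2 = (norm w)\<^sup>2 - 2 * (snd b \<bullet> w) + (norm (snd b))\<^sup>2"
      by (simp add: power2_norm_eq_inner inner_diff_left inner_diff_right inner_commute)
    moreover have "(t - a - fst b)\<^sup>2 = t * t - 2 * (fst b + a) * t + (fst b + a)\<^sup>2"
      by (simp add: power2_eq_square algebra_simps)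
    ultimately show ?thesis using nb by linarith
  qed
  have b0: "snd b = 0"
  proof -
    \<comment> \<open>\<open>C * \<epsilon>\<^sup>2\<close> bounds the cap function at
      \<open>- \<epsilon> *\<^sub>R snd b\<close>, so the point at this depth lies in the set. The
      tangential shift increases the squared distance from \<open>v\<close> to order
      \<open>\<epsilon>\<close>, while the depth costs at most order
      \<open>\<epsilon>\<^sup>2\<close>.\<close>
    define C where "C = \<bar>(1/2) * (snd b \<bullet> (hess m c *v snd b))\<bar> + (norm (snd b))\<^sup>2"
    have ub: "(norm (snd b))\<^sup>2 \<le> (fst b + a) * C * \<epsilon>"
      if \<epsilon>: "\<epsilon> > 0" and small: "\<epsilon> * norm (snd b) < \<rho>" "C * \<epsilon>\<^sup>2 < \<delta>" for \<epsilon>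
    proof -
      let ?w = "- \<epsilon> *\<^sub>R snd b"
      have nw: "norm ?w < \<rho>" using small \<epsilon> by simp
      have "?w \<bullet> (hess m c *v ?w) = \<epsilon>\<^sup>2 * (snd b \<bullet> (hess m c *v snd b))"
        by (simp add: matrix_vector_mult_scaleR power2_eq_square
            linear_neg[OF matrix_vector_mul_linear])
      then have "s ?w \<le> \<epsilon>\<^sup>2 * ((1/2) * (snd b \<bullet> (hess m c *v snd b))) + \<epsilon>\<^sup>2 * (norm (snd b))\<^sup>2"
        using \<rho>(2)[OF nw] \<epsilon> by (simp add: power_mult_distrib)
      also have "\<dots> \<le> C * \<epsilon>\<^sup>2"
        unfolding C_def distrib_right by (simp add: mult.commute mult_left_mono)
      finally have "(C * \<epsilon>\<^sup>2 - a, ?w) \<in> chart m c ` E"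
        using \<rho>(3)[OF nw small(2)] by simp
      note far[OF this]
      moreover have "snd b \<bullet> ?w = - (\<epsilon> * (norm (snd b))\<^sup>2)"
        by (simp add: power2_norm_eq_inner)
      moreover have "0 \<le> C * \<epsilon>\<^sup>2 * (C * \<epsilon>\<^sup>2)" "0 \<le> (norm ?w)\<^sup>2" by simp_all
      ultimately have "2 * (\<epsilon> * (norm (snd b))\<^sup>2) \<le> 2 * (fst b + a) * (C * \<epsilon>\<^sup>2)"
        by linarith
      then have "\<epsilon> * (norm (snd b))\<^sup>2 \<le> \<epsilon> * ((fst b + a) * C * \<epsilon>)"
        by (simp add: power2_eq_square algebra_simps)
      then show ?thesis using \<epsilon> by simp
    qed
    have "((\<lambda>\<epsilon>. \<epsilon> * norm (snd b)) \<longlongrightarrow> 0) (at_right 0)" "((\<lambda>\<epsilon>. C * \<epsilon>\<^sup>2) \<longlongrightarrow> 0) (at_right 0)"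
      by (auto intro!: tendsto_eq_intros)
    then have "\<forall>\<^sub>F \<epsilon> in at_right 0. \<epsilon> * norm (snd b) < \<rho>" "\<forall>\<^sub>F \<epsilon> in at_right 0. C * \<epsilon>\<^sup>2 < \<delta>"
      using \<rho>(1) \<delta> by (auto dest: order_tendstoD(2))
    with eventually_at_right_less[of 0]
    have "\<forall>\<^sub>F \<epsilon> in at_right 0. (norm (snd b))\<^sup>2 \<le> (fst b + a) * C * \<epsilon>"
      by eventually_elim (rule ub)
    moreover have "((\<lambda>\<epsilon>. (fst b + a) * C * \<epsilon>) \<longlongrightarrow> 0) (at_right 0)"
      by (auto intro!: tendsto_eq_intros)
    ultimately have "(norm (snd b))\<^sup>2 \<le> 0"
      using tendsto_lowerbound by (metis trivial_limit_at_right_real)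
    then show ?thesis by simp
  qed
  \<comment> \<open>With \<open>snd b = 0\<close> the only alternative is
    \<open>fst b = - 3 * a\<close>, where \<open>v\<close> lies outward of the pole; then the inner
    point at depth \<open>\<delta> / 2\<close> would be farther than \<open>2 * a\<close> from
    \<open>v\<close>.\<close>
  have "fst b = a"
  proof (rule ccontr)
    assume "fst b \<noteq> a"
    moreover have "(fst b - a) * (fst b + 3 * a) = 0"
      using nb b0 by (simp add: power2_eq_square algebra_simps)
    ultimately have b1: "fst b + a = - 2 * a" by auto
    have "s 0 \<le> 0" using \<rho>(2)[of 0] \<rho>(1) by simp
    then have "(\<delta> / 2 - a, 0) \<in> chart m c ` E"
      using \<rho>(3)[of 0 "\<delta> / 2"] \<rho>(1) \<delta> by simp
    from far[OF this] have "\<delta> / 2 * (\<delta> / 2) + 4 * a * (\<delta> / 2) \<le> 0"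
      by (simp add: b1)
    moreover have "0 < \<delta> / 2 * (\<delta> / 2)" "0 < 4 * a * (\<delta> / 2)" using \<delta> a_pos by auto
    ultimately show False by linarith
  qed
  then have "chart m c v = mirror (- a, 0)"
    using b0 by (simp add: b_def mirror_def prod_eq_iff)
  also have "\<dots> = chart m c (pole m (\<not> c))"
    using chart_flip[OF m, of "\<not> c" "pole m (\<not> c)"] chart_pole[OF m, of "\<not> c"] by simp
  finally show ?thesis
    using rigid_motion_bij[OF chart_rigid[OF m]] by (simp add: bij_is_inj inj_eq)
qed

text \<open>Diameters sharing one end share the other by \<open>partner_unique\<close>, which
  distinctness of the pairs forbids; the two ends of one diameter are \<open>2 * a\<close> apart.
  This is what later separates the cells at different poles.\<close>

lemma pole_inj:
  assumes "m \<in> {1..k}" "m' \<in> {1..k}" "pole m c = pole m' c'"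
  shows "m = m' \<and> c = c'"
proof -
  have opp: "norm (pole m c - pole m (\<not> c)) = 2 * a" if "m \<in> {1..k}" for m c
  proof -
    have "(norm (pole m c - pole m (\<not> c)))\<^sup>2 = (2 * a)\<^sup>2"
      using norm_diff_charts[OF that, of "pole m c" "pole m (\<not> c)" c] chart_pole[OF that] by simp
    then show ?thesis by (rule power2_eq_imp_eq) (use a_pos in auto)
  qed
  have "norm (pole m c - pole m' (\<not> c')) = 2 * a"
    using opp[OF assms(2), of c'] assms(3) by simp
  then have "pole m' (\<not> c') = pole m (\<not> c)"
    by (rule partner_unique[OF assms(1) pole_in[OF assms(2)]])
  then have "m = m'" using pairs_distinct[OF assms(1,2), of c c'] assms(3) by auto
  moreover have "c = c'"
  proof (rule ccontr)
    assume "c \<noteq> c'"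
    then have "c' = (\<not> c)" by auto
    then have "pole m c = pole m (\<not> c)" using assms(3) \<open>m = m'\<close> by simp
    then show False using opp[OF assms(1), of c] a_pos by simp
  qed
  ultimately show ?thesis ..
qed

text \<open>Removing the open neighbourhood \<open>U\<close> of all pole pairs from
  \<open>E \<times> E\<close> leaves a compact set. If it is nonempty, its largest distance is
  attained and is below \<open>2 * a\<close>, since a pair at distance \<open>2 * a\<close> consists
  of a pole and its unique partner; \<open>\<tau>\<close> is half of the gap.\<close>

lemma near_poles:
  assumes "\<epsilon> > 0"
  shows "\<exists>\<tau>>0. \<forall>u\<in>E. \<forall>v\<in>E. norm (u - v) \<ge> 2 * a - \<tau> \<longrightarrow>
    (\<exists>m\<in>{1..k}. \<exists>c. dist u (pole m c) < \<epsilon> \<and> dist v (pole m (\<not> c)) < \<epsilon>)"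
proof -
  define U where "U = (\<Union>m\<in>{1..k}. \<Union>c. ball (pole m c) \<epsilon> \<times> ball (pole m (\<not> c)) \<epsilon>)"
  have "open U" unfolding U_def by (intro open_UN ballI open_Times open_ball)
  have inU: "(u, v) \<in> U \<longleftrightarrow> (\<exists>m\<in>{1..k}. \<exists>c. dist u (pole m c) < \<epsilon> \<and> dist v (pole m (\<not> c)) < \<epsilon>)" for u v
    by (auto simp: U_def dist_commute)
  define K where "K = E \<times> E - U"
  have "compact E" using closed_E bounded_E compact_eq_bounded_closed by blast
  then have K: "compact K"
    unfolding K_def using \<open>open U\<close> by (intro compact_diff compact_Times)
  show ?thesis
  proof (cases "K = {}")
    case True
    then have "(u, v) \<in> U" if "u \<in> E" "v \<in> E" for u v using that by (auto simp: K_def)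
    then show ?thesis unfolding inU by (intro exI[of _ 1]) simp
  next
    case False
    have "continuous_on K (\<lambda>z. norm (fst z - snd z))"
      by (intro continuous_intros)
    then obtain z where z: "z \<in> K" "\<And>z'. z' \<in> K \<Longrightarrow> norm (fst z' - snd z') \<le> norm (fst z - snd z)"
      using continuous_attains_sup[OF K False] by blast
    obtain u v where uv: "z = (u, v)" by (cases z)
    have "norm (u - v) < 2 * a"
    proof (rule ccontr)
      assume "\<not> norm (u - v) < 2 * a"
      moreover have E: "u \<in> E" "v \<in> E" using z(1) by (auto simp: K_def uv)
      ultimately have d: "norm (u - v) = 2 * a" using dist_le[OF E] by simp
      then obtain m c where m: "m \<in> {1..k}" and u: "u = pole m c"
        using off_poles[OF E(1) _ E(2)] by fastforce
      have "v = pole m (\<not> c)" using partner_unique[OF m E(2)] d u by simp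
      then have "(u, v) \<in> U" unfolding inU using m u \<open>\<epsilon> > 0\<close>
        by (intro bexI[of _ m] exI[of _ c]) simp_all
      then show False using z(1) by (simp add: K_def uv)
    qed
    define \<tau> where "\<tau> = (2 * a - norm (u - v)) / 2"
    have "(u', v') \<in> U" if "u' \<in> E" "v' \<in> E" "norm (u' - v') \<ge> 2 * a - \<tau>" for u' v'
      using z(2)[of "(u', v')"] that \<open>norm (u - v) < 2 * a\<close> by (auto simp: K_def uv \<tau>_def field_simps)
    then show ?thesis
      unfolding inU using \<open>norm (u - v) < 2 * a\<close> by (intro exI[of _ \<tau>]) (simp add: \<tau>_def)
  qed
qed

text \<open>Let S be the sum of the two depths. Caps and curvature bound the squared tangential
  distance by \<open>4 * a * p * S\<close> with \<open>p < 1\<close>, so the squared norm falls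
  below \<open>4 * a\<^sup>2\<close> by at least \<open>4 * a * (1 - p) * S - S\<^sup>2\<close>.
  Close to the poles the last square takes away at most half of the main term, so S is at most a
  multiple of \<open>\<tau>\<close>.\<close>

lemma pole_pair_bound:
  assumes m: "m \<in> {1..k}"
  shows "\<exists>\<epsilon>>0. \<exists>K>0. \<forall>u\<in>E. \<forall>v\<in>E. \<forall>\<tau>. 0 \<le> \<tau> \<longrightarrow> \<tau> \<le> 2 * a \<longrightarrow> dist u (pole m c) < \<epsilon> \<longrightarrow>
    dist v (pole m (\<not> c)) < \<epsilon> \<longrightarrow> norm (u - v) \<ge> 2 * a - \<tau> \<longrightarrow>
    \<bar>fst (chart m c u) + a\<bar> \<le> K * \<tau> \<and> (norm (snd (chart m c u)))\<^sup>2 \<le> K * \<tau> \<and>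
    \<bar>fst (chart m (\<not> c) v) + a\<bar> \<le> K * \<tau> \<and> (norm (snd (chart m (\<not> c) v)))\<^sup>2 \<le> K * \<tau>"
proof -
  obtain \<eta> where \<eta>: "0 < \<eta>" "\<eta> < 1" and cv: "\<And>c v w. (norm (v - w))\<^sup>2 \<le>
      2 * a * \<eta> * (v \<bullet> (hess m c *v v) + w \<bullet> (hess m (\<not> c) *v w))"
    using curv[OF m] by blast
  \<comment> \<open>Any value strictly between \<open>\<eta>\<close> and 1 would do: the caps may
    lose the factor \<open>\<theta>\<close> against the paraboloids, and
    \<open>\<eta> / \<theta>\<close> is still below 1. The accuracy \<open>e\<close> is such that
    \<open>e * (norm w)\<^sup>2\<close>, estimated by the curvature condition with one vector 0,
    costs at most \<open>(1 - \<theta>) / 2\<close> times the quadratic form.\<close>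
  define \<theta> where "\<theta> = (1 + \<eta>) / 2"
  define e where "e = (1 - \<theta>) / (4 * a * \<eta>)"
  have \<theta>: "\<eta> < \<theta>" "\<theta> < 1" "0 < \<theta>" using \<eta> by (auto simp: \<theta>_def)
  have e: "e > 0" using \<theta> \<eta> a_pos by (simp add: e_def)
  have q: "(norm w)\<^sup>2 \<le> 2 * a * \<eta> * (w \<bullet> (hess m c *v w))" for w c
    using cv[of w 0 c] by simp
  have "\<exists>\<rho>>0. \<forall>u\<in>E. dist u (pole m c) < \<rho> \<longrightarrow>
     \<theta> / 2 * (snd (chart m c u) \<bullet> (hess m c *v snd (chart m c u))) \<le> fst (chart m c u) + a" for c
  proof -
    obtain \<delta> s where \<delta>: "\<delta> > 0" and s: "\<And>e. e > 0 \<Longrightarrow> \<exists>\<rho>>0. \<forall>w. norm w < \<rho> \<longrightarrow>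
        \<bar>s w - (1/2) * (w \<bullet> (hess m c *v w))\<bar> \<le> e * (norm w)\<^sup>2 \<and>
        (\<forall>t<\<delta>. (t - a, w) \<in> chart m c ` E \<longleftrightarrow> s w \<le> t)"
      using smooth_left_cap_approx[OF cap[OF m] left_pole_in[OF m]] by blast
    obtain \<rho> where \<rho>: "\<rho> > 0" "\<And>w. norm w < \<rho> \<Longrightarrow>
        \<bar>s w - (1/2) * (w \<bullet> (hess m c *v w))\<bar> \<le> e * (norm w)\<^sup>2"
        "\<And>w t. norm w < \<rho> \<Longrightarrow> t < \<delta> \<Longrightarrow> (t - a, w) \<in> chart m c ` E \<longleftrightarrow> s w \<le> t"
      using s[OF e] by blast
    show ?thesis
    proof (intro exI[of _ "min \<rho> \<delta>"] conjI ballI impI)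
      fix u assume u: "u \<in> E" "dist u (pole m c) < min \<rho> \<delta>"
      let ?t = "fst (chart m c u) + a" and ?w = "snd (chart m c u)"
      have w: "norm ?w < \<rho>" and t: "?t < \<delta>"
        using u dist_pole[OF m, of c u] by auto
      have "(?t - a, ?w) \<in> chart m c ` E" using u by simp
      then have "s ?w \<le> ?t" using \<rho>(3)[OF w t] by blast
      moreover have "s ?w \<ge> (1/2) * (?w \<bullet> (hess m c *v ?w)) - e * (norm ?w)\<^sup>2"
        using \<rho>(2)[OF w] by simp
      moreover have "e * (norm ?w)\<^sup>2 \<le> e * (2 * a * \<eta> * (?w \<bullet> (hess m c *v ?w)))"
        using e q by (intro mult_left_mono) auto
      moreover have "e * (2 * a * \<eta> * (?w \<bullet> (hess m c *v ?w))) = (1 - \<theta>) / 2 * (?w \<bullet> (hess m c *v ?w))"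
        using a_pos \<eta> by (simp add: e_def)
      ultimately show "\<theta> / 2 * (?w \<bullet> (hess m c *v ?w)) \<le> ?t"
        by (simp add: algebra_simps)
    qed (use \<rho> \<delta> in auto)
  qed
  then obtain \<rho> where \<rho>: "\<And>c. \<rho> c > 0" "\<And>c u. u \<in> E \<Longrightarrow> dist u (pole m c) < \<rho> c \<Longrightarrow>
     \<theta> / 2 * (snd (chart m c u) \<bullet> (hess m c *v snd (chart m c u))) \<le> fst (chart m c u) + a"
    by metis
  define p where "p = \<eta> / \<theta>"
  have p: "0 < p" "p < 1" using \<eta> \<theta> by (auto simp: p_def)
  \<comment> \<open>The third entry gives \<open>\<alpha> + \<beta> \<le> 2 * a * (1 - p)\<close>,
    which absorbs the square of the depths. In \<open>K\<close>, the factor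
    \<open>2 / (1 - p)\<close> serves the depths and the summand \<open>4 * a * p\<close> the
    tangential norms.\<close>
  define \<epsilon> where "\<epsilon> = min (min (\<rho> c) (\<rho> (\<not> c))) (a * (1 - p))"
  define K where "K = 2 / (1 - p) * (1 + 4 * a * p)"
  have "\<epsilon> > 0" using \<rho>(1) a_pos p by (simp add: \<epsilon>_def)
  moreover have "K > 0" using a_pos p by (simp add: K_def add_pos_pos)
  moreover have "\<bar>fst (chart m c u) + a\<bar> \<le> K * \<tau> \<and> (norm (snd (chart m c u)))\<^sup>2 \<le> K * \<tau> \<and>
    \<bar>fst (chart m (\<not> c) v) + a\<bar> \<le> K * \<tau> \<and> (norm (snd (chart m (\<not> c) v)))\<^sup>2 \<le> K * \<tau>"
    if E: "u \<in> E" "v \<in> E" and \<tau>: "0 \<le> \<tau>" "\<tau> \<le> 2 * a" and du: "dist u (pole m c) < \<epsilon>"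
      and dv: "dist v (pole m (\<not> c)) < \<epsilon>" and uv: "norm (u - v) \<ge> 2 * a - \<tau>" for u v \<tau>
  proof -
    define \<alpha> \<beta> w w' where "\<alpha> = fst (chart m c u) + a" "\<beta> = fst (chart m (\<not> c) v) + a"
      "w = snd (chart m c u)" "w' = snd (chart m (\<not> c) v)"
    note defs = this
    define q1 q2 where "q1 = w \<bullet> (hess m c *v w)" "q2 = w' \<bullet> (hess m (\<not> c) *v w')"
    have \<alpha>: "\<theta> / 2 * q1 \<le> \<alpha>" and \<beta>: "\<theta> / 2 * q2 \<le> \<beta>"
      using \<rho>(2)[OF E(1), of c] \<rho>(2)[OF E(2), of "\<not> c"] du dv
      by (auto simp: defs q1_q2_def \<epsilon>_def)
    have q1: "(norm w)\<^sup>2 \<le> 2 * a * \<eta> * q1" and q2: "(norm w')\<^sup>2 \<le> 2 * a * \<eta> * q2"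
      using q by (auto simp: q1_q2_def)
    have "0 < 2 * a * \<eta>" using a_pos \<eta> by simp
    then have pos: "0 \<le> q1" "0 \<le> q2"
      using order_trans[OF zero_le_power2 q1] order_trans[OF zero_le_power2 q2]
      by (meson not_le order_trans zero_le_mult_iff)+
    have scale: "2 * a * \<eta> * x \<le> 4 * a * p * y" if "\<theta> / 2 * x \<le> y" for x y
    proof -
      have "4 * a * p * (\<theta> / 2 * x) \<le> 4 * a * p * y"
        using that a_pos p by (intro mult_left_mono) auto
      moreover have "4 * a * p * (\<theta> / 2 * x) = 2 * a * \<eta> * x" using \<theta> by (simp add: p_def)
      ultimately show ?thesis by linarith
    qed
    have ab: "0 \<le> \<alpha>" "0 \<le> \<beta>"
      using order_trans[OF _ \<alpha>] order_trans[OF _ \<beta>] pos \<theta> by auto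
    have S: "\<alpha> + \<beta> \<le> 2 * a * (1 - p)"
    proof -
      have "\<alpha> \<le> a * (1 - p)" "\<beta> \<le> a * (1 - p)"
        using dist_pole(1)[OF m, of c u] dist_pole(1)[OF m, of "\<not> c" v] du dv
        by (auto simp: defs \<epsilon>_def)
      then show ?thesis by linarith
    qed
    have "(norm (w - w'))\<^sup>2 \<le> 2 * a * \<eta> * (q1 + q2)"
      using cv by (simp add: q1_q2_def)
    also have "\<dots> \<le> 4 * a * p * (\<alpha> + \<beta>)"
      by (rule scale) (use \<alpha> \<beta> in \<open>simp add: distrib_left\<close>)
    finally have "(norm (u - v))\<^sup>2 \<le> (2 * a - \<alpha> - \<beta>)\<^sup>2 + 4 * a * p * (\<alpha> + \<beta>)"
      by (simp add: norm_diff_charts[OF m, of u v c] defs)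
    moreover have "(2 * a - \<tau>)\<^sup>2 \<le> (norm (u - v))\<^sup>2"
      using uv \<tau> by (intro power_mono) auto
    moreover have "(2 * a - \<tau>)\<^sup>2 \<ge> 4 * a\<^sup>2 - 4 * a * \<tau>"
      by (simp add: power2_eq_square algebra_simps)
    moreover have "(2 * a - \<alpha> - \<beta>)\<^sup>2 = 4 * a\<^sup>2 - 4 * a * (\<alpha> + \<beta>) + (\<alpha> + \<beta>) * (\<alpha> + \<beta>)"
      by (simp add: power2_eq_square algebra_simps)
    moreover have "(\<alpha> + \<beta>) * (\<alpha> + \<beta>) \<le> 2 * a * (1 - p) * (\<alpha> + \<beta>)"
      using S ab by (intro mult_right_mono) auto
    ultimately have "4 * a * (\<alpha> + \<beta>) - 2 * a * (1 - p) * (\<alpha> + \<beta>) - 4 * a * p * (\<alpha> + \<beta>) \<le> 4 * a * \<tau>"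
      by linarith
    then have "2 * a * ((1 - p) * (\<alpha> + \<beta>)) \<le> 2 * a * (2 * \<tau>)"
      by (simp add: algebra_simps)
    then have "(1 - p) * (\<alpha> + \<beta>) \<le> 2 * \<tau>"
      using a_pos by simp
    then have S\<tau>: "\<alpha> + \<beta> \<le> 2 / (1 - p) * \<tau>"
      using p by (simp add: field_simps)
    have K1: "2 / (1 - p) * \<tau> \<le> K * \<tau>"
    proof -
      have "K * \<tau> = 2 / (1 - p) * \<tau> + 4 * a * p * (2 / (1 - p) * \<tau>)"
        by (simp add: K_def algebra_simps)
      moreover have "0 \<le> 4 * a * p * (2 / (1 - p) * \<tau>)" using p \<tau> a_pos by simp
      ultimately show ?thesis by linarith
    qed
    have K2: "4 * a * p * (2 / (1 - p) * \<tau>) \<le> K * \<tau>"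
    proof -
      have "K * \<tau> = 2 / (1 - p) * \<tau> + 4 * a * p * (2 / (1 - p) * \<tau>)"
        by (simp add: K_def algebra_simps)
      moreover have "0 \<le> 2 / (1 - p) * \<tau>" using p \<tau> by simp
      ultimately show ?thesis by linarith
    qed
    have w: "4 * a * p * (\<alpha> + \<beta>) \<le> K * \<tau>"
      using mult_left_mono[OF S\<tau>, of "4 * a * p"] a_pos p K2 by simp
    have "4 * a * p * \<alpha> \<le> 4 * a * p * (\<alpha> + \<beta>)" "4 * a * p * \<beta> \<le> 4 * a * p * (\<alpha> + \<beta>)"
      using ab a_pos p by (simp_all add: distrib_left)
    then have "(norm w)\<^sup>2 \<le> K * \<tau>" "(norm w')\<^sup>2 \<le> K * \<tau>"
      using q1 q2 scale[OF \<alpha>] scale[OF \<beta>] w by linarith+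
    moreover have "\<bar>\<alpha>\<bar> \<le> K * \<tau>" "\<bar>\<beta>\<bar> \<le> K * \<tau>"
      using S\<tau> K1 ab by auto
    ultimately show ?thesis by (simp add: defs)
  qed
  ultimately show ?thesis by blast
qed

text \<open>For \<open>\<tau> = T * r\<close> the depths are of order \<open>r\<close> and the
  tangential parts of order \<open>sqrt r\<close>, exactly what the zoom divides by. There are
  finitely many poles, so the constants can be made common.\<close>

lemma zoomed_bounded:
  assumes T: "T \<ge> 0"
  shows "\<exists>R>0. \<exists>r0>0. \<forall>r u v. 0 < r \<longrightarrow> r < r0 \<longrightarrow> u \<in> E \<longrightarrow> v \<in> E \<longrightarrow> norm (u - v) \<ge> 2 * a - T * r \<longrightarrow>
    (\<exists>m\<in>{1..k}. \<exists>c. norm (zoom a r (chart m c u)) \<le> R \<and> norm (zoom a r (chart m (\<not> c) v)) \<le> R)"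
proof -
  have "\<forall>m\<in>{1..k}. \<forall>c. \<exists>\<epsilon> K. \<epsilon> > 0 \<and> K > 0 \<and> (\<forall>u\<in>E. \<forall>v\<in>E. \<forall>\<tau>. 0 \<le> \<tau> \<longrightarrow> \<tau> \<le> 2 * a \<longrightarrow> dist u (pole m c) < \<epsilon> \<longrightarrow>
    dist v (pole m (\<not> c)) < \<epsilon> \<longrightarrow> norm (u - v) \<ge> 2 * a - \<tau> \<longrightarrow>
    \<bar>fst (chart m c u) + a\<bar> \<le> K * \<tau> \<and> (norm (snd (chart m c u)))\<^sup>2 \<le> K * \<tau> \<and>
    \<bar>fst (chart m (\<not> c) v) + a\<bar> \<le> K * \<tau> \<and> (norm (snd (chart m (\<not> c) v)))\<^sup>2 \<le> K * \<tau>)"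
    using pole_pair_bound by blast
  then obtain \<epsilon> K where \<epsilon>K: "\<And>m c. m \<in> {1..k} \<Longrightarrow> \<epsilon> m c > 0 \<and> K m c > 0"
    "\<And>m c u v \<tau>. m \<in> {1..k} \<Longrightarrow> u \<in> E \<Longrightarrow> v \<in> E \<Longrightarrow> 0 \<le> \<tau> \<Longrightarrow> \<tau> \<le> 2 * a \<Longrightarrow> dist u (pole m c) < \<epsilon> m c \<Longrightarrow>
    dist v (pole m (\<not> c)) < \<epsilon> m c \<Longrightarrow> norm (u - v) \<ge> 2 * a - \<tau> \<Longrightarrow>
    \<bar>fst (chart m c u) + a\<bar> \<le> K m c * \<tau> \<and> (norm (snd (chart m c u)))\<^sup>2 \<le> K m c * \<tau> \<and>
    \<bar>fst (chart m (\<not> c) v) + a\<bar> \<le> K m c * \<tau> \<and> (norm (snd (chart m (\<not> c) v)))\<^sup>2 \<le> K m c * \<tau>"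
    by metis
  define I where "I = {1..k} \<times> (UNIV :: bool set)"
  \<comment> \<open>The inserted 1 gives \<open>Min\<close> and \<open>Max\<close> a meaning even
    for \<open>k = 0\<close>.\<close>
  define \<epsilon>0 where "\<epsilon>0 = Min (insert 1 ((\<lambda>(m, c). \<epsilon> m c) ` I))"
  define K0 where "K0 = Max (insert 1 ((\<lambda>(m, c). K m c) ` I))"
  have fin: "finite I" by (simp add: I_def)
  have \<epsilon>0: "\<epsilon>0 > 0" unfolding \<epsilon>0_def using fin \<epsilon>K(1) by (subst Min_gr_iff) (auto simp: I_def)
  have \<epsilon>0_le: "\<epsilon>0 \<le> \<epsilon> m c" and K0_ge: "K m c \<le> K0" if "m \<in> {1..k}" for m c
    unfolding \<epsilon>0_def K0_def using that fin
    by (intro Min_le Max_ge; force simp: I_def)+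
  have K0: "K0 \<ge> 1" unfolding K0_def using fin by simp
  obtain \<tau>0 where \<tau>0: "\<tau>0 > 0" "\<And>u v. u \<in> E \<Longrightarrow> v \<in> E \<Longrightarrow> norm (u - v) \<ge> 2 * a - \<tau>0 \<Longrightarrow>
    \<exists>m\<in>{1..k}. \<exists>c. dist u (pole m c) < \<epsilon>0 \<and> dist v (pole m (\<not> c)) < \<epsilon>0"
    using near_poles[OF \<epsilon>0] by blast
  \<comment> \<open>Ensures both \<open>T * r < \<tau>0\<close> and
    \<open>T * r \<le> 2 * a\<close>; the added 1 covers \<open>T = 0\<close>.\<close>
  define r0 where "r0 = min \<tau>0 (2 * a) / (T + 1)"
  define R where "R = K0 * T + sqrt (K0 * T) + 1"
  have "r0 > 0" using \<tau>0 a_pos T by (simp add: r0_def)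
  moreover have "R > 0" using K0 T by (simp add: R_def add_nonneg_pos)
  moreover have "\<exists>m\<in>{1..k}. \<exists>c. norm (zoom a r (chart m c u)) \<le> R \<and> norm (zoom a r (chart m (\<not> c) v)) \<le> R"
    if r: "0 < r" "r < r0" and E: "u \<in> E" "v \<in> E" and uv: "norm (u - v) \<ge> 2 * a - T * r" for r u v
  proof -
    have "(T + 1) * r < min \<tau>0 (2 * a)" using r T by (simp add: r0_def pos_less_divide_eq mult.commute)
    moreover have "(T + 1) * r = T * r + r" by (simp add: algebra_simps)
    ultimately have Tr: "T * r < \<tau>0" "T * r \<le> 2 * a" using r by auto
    obtain m c where m: "m \<in> {1..k}" and d: "dist u (pole m c) < \<epsilon>0" "dist v (pole m (\<not> c)) < \<epsilon>0"
      using \<tau>0(2)[OF E] uv Tr by force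
    have z: "norm (zoom a r z) \<le> R" if "\<bar>fst z + a\<bar> \<le> K m c * (T * r)" "(norm (snd z))\<^sup>2 \<le> K m c * (T * r)" for z
    proof -
      have "K m c * (T * r) \<le> K0 * (T * r)"
        using K0_ge[OF m] T r by (intro mult_right_mono) auto
      then have *: "\<bar>fst z + a\<bar> \<le> K0 * T * r" "(norm (snd z))\<^sup>2 \<le> K0 * T * r"
        using that by (auto simp: mult.assoc)
      have "norm (zoom a r z) \<le> \<bar>fst z + a\<bar> / r + norm (snd z) / sqrt r"
        using norm_Pair_le[of "(fst z + a) / r" "snd z /\<^sub>R sqrt r"] r
        by (simp add: zoom_def divide_inverse mult.commute abs_mult)
      also have "\<bar>fst z + a\<bar> / r \<le> K0 * T"
        using *(1) r by (simp add: pos_divide_le_eq)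
      also have "norm (snd z) / sqrt r \<le> sqrt (K0 * T)"
      proof -
        have "norm (snd z) \<le> sqrt (K0 * T * r)"
          using *(2) by (rule real_le_rsqrt)
        then show ?thesis using r by (simp add: real_sqrt_mult pos_divide_le_eq)
      qed
      finally show ?thesis by (simp add: R_def)
    qed
    have "0 \<le> T * r" using T r by simp
    from \<epsilon>K(2)[OF m E this Tr(2) _ _ uv, of c] d \<epsilon>0_le[OF m, of c]
    have "\<bar>fst (chart m c u) + a\<bar> \<le> K m c * (T * r) \<and> (norm (snd (chart m c u)))\<^sup>2 \<le> K m c * (T * r) \<and>
    \<bar>fst (chart m (\<not> c) v) + a\<bar> \<le> K m c * (T * r) \<and> (norm (snd (chart m (\<not> c) v)))\<^sup>2 \<le> K m c * (T * r)"
      by auto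
    then show ?thesis using m z by blast
  qed
  ultimately show ?thesis by blast
qed

text \<open>The limit version of \<open>pole_pair_bound\<close>: on the paraboloids the quadratic
  forms are at most twice the depths, so the curvature condition gives \<open>(1 - \<eta>) * (fst
  \<xi> + fst \<zeta>) \<le> pair_value a \<xi> \<zeta>\<close>. Nonnegativity makes the infimum
  over pairs a genuine one, and the norm bound makes it attained.\<close>

lemma pair_value_bounds:
  assumes m: "m \<in> {1..k}"
  shows "\<exists>R. \<forall>\<xi>\<in>paraboloid (hess m False). \<forall>\<zeta>\<in>paraboloid (hess m True).
    0 \<le> pair_value a \<xi> \<zeta> \<and> (pair_value a \<xi> \<zeta> \<le> T \<longrightarrow> norm \<xi> \<le> R \<and> norm \<zeta> \<le> R)"
proof -
  obtain \<eta> where \<eta>: "0 < \<eta>" "\<eta> < 1" and cv: "\<And>c v w. (norm (v - w))\<^sup>2 \<le>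
      2 * a * \<eta> * (v \<bullet> (hess m c *v v) + w \<bullet> (hess m (\<not> c) *v w))"
    using curv[OF m] by blast
  have q: "(norm w)\<^sup>2 \<le> 2 * a * \<eta> * (w \<bullet> (hess m c *v w))" for w c
    using cv[of w 0 c] by simp
  define B where "B = T / (1 - \<eta>)"
  define R where "R = B + sqrt (4 * a * \<eta> * B)"
  have "0 \<le> pair_value a \<xi> \<zeta> \<and> (pair_value a \<xi> \<zeta> \<le> T \<longrightarrow> norm \<xi> \<le> R \<and> norm \<zeta> \<le> R)"
    if par: "\<xi> \<in> paraboloid (hess m False)" "\<zeta> \<in> paraboloid (hess m True)" for \<xi> \<zeta>
  proof -
    define q1 q2 where "q1 = snd \<xi> \<bullet> (hess m False *v snd \<xi>)" "q2 = snd \<zeta> \<bullet> (hess m True *v snd \<zeta>)"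
    have le: "q1 \<le> 2 * fst \<xi>" "q2 \<le> 2 * fst \<zeta>"
      using par by (auto simp: paraboloid_def q1_q2_def split: prod.splits)
    have q1: "(norm (snd \<xi>))\<^sup>2 \<le> 2 * a * \<eta> * q1" and q2: "(norm (snd \<zeta>))\<^sup>2 \<le> 2 * a * \<eta> * q2"
      using q by (auto simp: q1_q2_def)
    have "0 < 2 * a * \<eta>" using a_pos \<eta> by simp
    then have pos: "0 \<le> q1" "0 \<le> q2"
      using order_trans[OF zero_le_power2 q1] order_trans[OF zero_le_power2 q2]
      by (meson not_le order_trans zero_le_mult_iff)+
    have "(norm (snd \<xi> - snd \<zeta>))\<^sup>2 \<le> 2 * a * \<eta> * (q1 + q2)"
      using cv[of "snd \<xi>" "snd \<zeta>" False] by (simp add: q1_q2_def)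
    also have "\<dots> \<le> 2 * a * \<eta> * (2 * fst \<xi> + 2 * fst \<zeta>)"
      using le a_pos \<eta> by (intro mult_left_mono) auto
    finally have "1 / (4 * a) * (norm (snd \<xi> - snd \<zeta>))\<^sup>2 \<le> \<eta> * (fst \<xi> + fst \<zeta>)"
      using a_pos by (simp add: field_simps)
    then have pv: "(1 - \<eta>) * (fst \<xi> + fst \<zeta>) \<le> pair_value a \<xi> \<zeta>"
      by (simp add: pair_value_def algebra_simps)
    moreover have "0 \<le> (1 - \<eta>) * (fst \<xi> + fst \<zeta>)"
      using le pos \<eta> by (intro mult_nonneg_nonneg) auto
    ultimately have "0 \<le> pair_value a \<xi> \<zeta>" by linarith
    moreover have "norm \<xi> \<le> R \<and> norm \<zeta> \<le> R" if "pair_value a \<xi> \<zeta> \<le> T"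
    proof -
      have "(1 - \<eta>) * (fst \<xi> + fst \<zeta>) \<le> T" using pv that by linarith
      then have B: "fst \<xi> + fst \<zeta> \<le> B"
        using \<eta> by (simp add: B_def field_simps)
      have "norm z \<le> R" if z: "0 \<le> fst z" "fst z \<le> B" "(norm (snd z))\<^sup>2 \<le> 2 * a * \<eta> * q'" "q' \<le> 2 * fst z"
        for z :: "'n point" and q'
      proof -
        have "2 * a * \<eta> * q' \<le> 2 * a * \<eta> * (2 * B)"
          using z a_pos \<eta> by (intro mult_left_mono) auto
        then have "(norm (snd z))\<^sup>2 \<le> 4 * a * \<eta> * B" using z(3) by linarith
        then have "norm (snd z) \<le> sqrt (4 * a * \<eta> * B)" by (rule real_le_rsqrt)
        moreover have "norm z \<le> fst z + norm (snd z)"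
          using norm_Pair_le[of "fst z" "snd z"] z(1) by simp
        ultimately show ?thesis using z(2) by (simp add: R_def)
      qed
      then show ?thesis using B le pos q1 q2 by (smt (verit))
    qed
    ultimately show ?thesis by blast
  qed
  then show ?thesis by blast
qed

end

section \<open>Avoidance probabilities\<close>

text \<open>Squeezed between the powers of
  \<open>exp (- (p n / (1 - p n))) \<le> 1 - p n \<le> exp (- p n)\<close>. Convergence of
  \<open>real n * p n\<close> already forces \<open>p n\<close> to tend to 0.\<close>

lemma power_tendsto_exp_neg:
  fixes p :: "nat \<Rightarrow> real"
  assumes p: "\<And>n. 0 \<le> p n" and lim: "(\<lambda>n. real n * p n) \<longlonglongrightarrow> l"
  shows "(\<lambda>n. (1 - p n) ^ n) \<longlonglongrightarrow> exp (- l)"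
proof -
  have "(\<lambda>n. real n * p n * inverse (real n)) \<longlonglongrightarrow> l * 0"
    by (intro tendsto_mult lim lim_inverse_n)
  moreover have "\<forall>\<^sub>F n in sequentially. real n * p n * inverse (real n) = p n"
    by (rule eventually_sequentiallyI[of 1]) auto
  ultimately have p0: "p \<longlonglongrightarrow> 0"
    by (simp add: filterlim_cong)
  then have small: "\<forall>\<^sub>F n in sequentially. p n < 1"
    by (rule order_tendstoD(2)) simp
  show ?thesis
  proof (rule tendsto_sandwich[where f="\<lambda>n. exp (- (real n * p n / (1 - p n)))"
        and h="\<lambda>n. exp (- (real n * p n))"])
    show "(\<lambda>n. exp (- (real n * p n))) \<longlonglongrightarrow> exp (- l)"
      by (intro tendsto_intros lim)
    have "(\<lambda>n. real n * p n / (1 - p n)) \<longlonglongrightarrow> l / (1 - 0)"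
      by (intro tendsto_intros lim p0) simp
    then show "(\<lambda>n. exp (- (real n * p n / (1 - p n)))) \<longlonglongrightarrow> exp (- l)"
      by (intro tendsto_intros) simp
    show "\<forall>\<^sub>F n in sequentially. (1 - p n) ^ n \<le> exp (- (real n * p n))"
      using small
    proof eventually_elim
      case (elim n)
      have "1 - p n \<le> exp (- p n)" using exp_ge_add_one_self[of "- p n"] by simp
      then have "(1 - p n) ^ n \<le> exp (- p n) ^ n" using elim by (intro power_mono) auto
      then show ?case by (simp add: exp_of_nat_mult[symmetric])
    qed
    show "\<forall>\<^sub>F n in sequentially. exp (- (real n * p n / (1 - p n))) \<le> (1 - p n) ^ n"
      using small
    proof eventually_elim
      case (elim n)
      have "1 / (1 - p n) = 1 + p n / (1 - p n)" using elim by (simp add: field_simps)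
      also have "\<dots> \<le> exp (p n / (1 - p n))" by (rule exp_ge_add_one_self)
      finally have "exp (- (p n / (1 - p n))) \<le> 1 - p n"
        using elim by (simp add: exp_minus field_simps)
      then have "exp (- (p n / (1 - p n))) ^ n \<le> (1 - p n) ^ n" by (intro power_mono) auto
      then show ?case by (simp add: exp_of_nat_mult[symmetric])
    qed
  qed
qed

context prob_space begin

lemma prob_sample_avoids:
  assumes indep: "indep_vars (\<lambda>_. borel) Z {1..}"
    and distr: "\<And>i. i \<ge> 1 \<Longrightarrow> distributed M lborel (Z i) f" and A [measurable]: "A \<in> sets borel"
  shows "prob {\<omega>\<in>space M. \<forall>i\<in>{1..n}. Z i \<omega> \<notin> A} = (1 - measure (density lborel f) A) ^ n"
proof (cases "n = 0")
  case True
  then show ?thesis by (simp add: prob_space)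
next
  case False
  have Z [measurable]: "Z i \<in> borel_measurable M" if "i \<ge> 1" for i
    using distributed_measurable[OF distr[OF that]] by simp
  have 1: "prob (Z i -` (- A) \<inter> space M) = 1 - measure (density lborel f) A" if i: "i \<ge> 1" for i
  proof -
    have "measure (density lborel f) A = measure (distr M lborel (Z i)) A"
      using distributed_distr_eq_density[OF distr[OF i]] by simp
    also have "\<dots> = prob (Z i -` A \<inter> space M)"
      using Z[OF i] by (intro measure_distr) auto
    finally have "measure (density lborel f) A = prob (Z i -` A \<inter> space M)" .
    moreover have "Z i -` (- A) \<inter> space M = space M - (Z i -` A \<inter> space M)" by auto
    moreover have "Z i -` A \<inter> space M \<in> events"
      by (rule measurable_sets[OF Z[OF i] A])
    ultimately show ?thesis by (simp add: prob_compl)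
  qed
  have "{\<omega>\<in>space M. \<forall>i\<in>{1..n}. Z i \<omega> \<notin> A} = (\<Inter>i\<in>{1..n}. Z i -` (- A) \<inter> space M)"
    using False by auto
  also have "prob \<dots> = (\<Prod>i\<in>{1..n}. prob (Z i -` (- A) \<inter> space M))"
    using False by (intro indep_varsD[OF indep]) auto
  also have "\<dots> = (1 - measure (density lborel f) A) ^ n"
    by (simp add: 1)
  finally show ?thesis .
qed

text \<open>Splitting according to the sample size \<open>j\<close> gives a Poisson mixture of the
  powers \<open>(1 - p) ^ j\<close>, and the exponential series sums it up.\<close>

lemma prob_poisson_sample_avoids:
  assumes indep: "indep_vars (\<lambda>_. borel) Z {1..}"
    and distr: "\<And>i. i \<ge> 1 \<Longrightarrow> distributed M lborel (Z i) f" and A [measurable]: "A \<in> sets borel"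
    and n: "n \<ge> 1" and N [measurable]: "N \<in> measurable M (count_space UNIV)"
    and pois: "distr M (count_space UNIV) N = measure_pmf (poisson_pmf (real n))"
    and NZ: "indep_set
             (sets (vimage_algebra (space M) N (count_space UNIV)))
             (sets (vimage_algebra (space M) (\<lambda>\<omega>. \<lambda>i\<in>{1..}. Z i \<omega>) (PiM {1..} (\<lambda>_. borel))))"
  shows "prob {\<omega>\<in>space M. \<forall>i\<in>{1..N \<omega>}. Z i \<omega> \<notin> A} = exp (- (real n * measure (density lborel f) A))"
proof -
  define p where "p = measure (density lborel f) A"
  have Z [measurable]: "Z i \<in> borel_measurable M" if "i \<ge> 1" for i
    using distributed_measurable[OF distr[OF that]] by simp
  define a where "a j = N -` {j} \<inter> space M" for j
  define b where "b j = {\<omega>\<in>space M. \<forall>i\<in>{1..j}. Z i \<omega> \<notin> A}" for j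
  have a: "prob (a j) = real n ^ j / fact j * exp (- real n)" for j
  proof -
    have "prob (a j) = measure (distr M (count_space UNIV) N) {j}"
      unfolding a_def by (rule measure_distr[symmetric]) auto
    also have "\<dots> = pmf (poisson_pmf (real n)) j"
      by (simp add: pois measure_pmf_single)
    finally show ?thesis using n by simp
  qed
  \<comment> \<open>The event is expressed through the sample alone, so it lies in the sigma-algebra
    that is independent of \<open>N\<close>.\<close>
  have bv: "b j \<in> sets (vimage_algebra (space M) (\<lambda>\<omega>. \<lambda>i\<in>{1..}. Z i \<omega>) (PiM {1..} (\<lambda>_. borel)))" for j
  proof -
    have "b j = (\<lambda>\<omega>. \<lambda>i\<in>{1..}. Z i \<omega>) -` {x \<in> space (PiM {1..} (\<lambda>_. borel)). \<forall>i\<in>{1..j}. x i \<notin> A} \<inter> space M"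
      by (auto simp: b_def space_PiM)
    also have "\<dots> \<in> sets (vimage_algebra (space M) (\<lambda>\<omega>. \<lambda>i\<in>{1..}. Z i \<omega>) (PiM {1..} (\<lambda>_. borel)))"
      by (rule in_vimage_algebra) (auto intro!: sets.sets_Collect_finite_All sets.sets_Collect_neg
          measurable_sets_Collect[OF measurable_component_singleton])
    finally show ?thesis .
  qed
  have av: "a j \<in> sets (vimage_algebra (space M) N (count_space UNIV))" for j
    unfolding a_def by (rule in_vimage_algebra) auto
  have ab: "prob (a j \<inter> b j) = prob (a j) * prob (b j)" "a j \<in> events" "b j \<in> events" for j
    using NZ av[of j] bv[of j] unfolding indep_sets2_eq by auto
  have "(\<lambda>j. prob (a j \<inter> b j)) sums prob (\<Union>j. a j \<inter> b j)"
    using ab by (intro finite_measure_UNION) (auto simp: disjoint_family_on_def a_def)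
  moreover have "prob (a j \<inter> b j) = exp (- real n) * ((real n * (1 - p)) ^ j /\<^sub>R fact j)" for j
  proof -
    have "prob (b j) = (1 - p) ^ j"
      unfolding b_def p_def by (rule prob_sample_avoids[OF indep distr A])
    then show ?thesis
      by (simp add: ab(1) a power_mult_distrib divide_inverse mult_ac)
  qed
  moreover have "(\<lambda>j. exp (- real n) * ((real n * (1 - p)) ^ j /\<^sub>R fact j)) sums
      (exp (- real n) * exp (real n * (1 - p)))"
    by (intro sums_mult exp_converges)
  ultimately have "prob (\<Union>j. a j \<inter> b j) = exp (- real n) * exp (real n * (1 - p))"
    by (simp add: sums_unique2)
  also have "\<dots> = exp (- (real n * p))"
    by (simp add: exp_add[symmetric] algebra_simps)
  also have "(\<Union>j. a j \<inter> b j) = {\<omega>\<in>space M. \<forall>i\<in>{1..N \<omega>}. Z i \<omega> \<notin> A}"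
    by (auto simp: a_def b_def)
  finally show ?thesis by (simp add: p_def)
qed

end

text \<open>By inclusion-exclusion, the joint law of finitely many events is determined by the
  probabilities that none of the events of a given subfamily occurs.\<close>

lemma sets_hit_avoid:
  assumes "finite S" "finite R" "\<And>j. j \<in> S \<union> R \<Longrightarrow> C j \<in> sets Q"
  shows "{\<omega>\<in>space Q. (\<forall>j\<in>S. \<omega> \<notin> C j) \<and> (\<forall>j\<in>R. \<omega> \<in> C j)} \<in> sets Q"
proof -
  have "{\<omega>\<in>space Q. \<omega> \<in> C j} \<in> sets Q" if "j \<in> S \<union> R" for j
    using assms(3)[OF that] sets.Int[OF _ sets.top] by (simp add: Collect_conj_eq Int_commute)
  then show ?thesis
    using assms(1,2)
    by (intro sets.sets_Collect_conj sets.sets_Collect_finite_All sets.sets_Collect_neg) auto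
qed

text \<open>Hitting \<open>j\<close> is the complement of avoiding \<open>j\<close>: the event for
  \<open>insert j R\<close> is the event for \<open>R\<close> minus the one in which
  \<open>j\<close> has joined the avoided set. This is why \<open>S\<close> varies in the induction
  on \<open>R\<close>.\<close>

lemma hit_avoid_tendsto:
  fixes A :: "nat \<Rightarrow> 'j \<Rightarrow> 'w set" and B :: "'j \<Rightarrow> 'p set"
  assumes M: "prob_space M" and P: "prob_space P"
    and A: "\<And>n j. j \<in> J \<Longrightarrow> A n j \<in> sets M" and B: "\<And>j. j \<in> J \<Longrightarrow> B j \<in> sets P" and J: "finite J"
    and avoid: "\<And>S. S \<subseteq> J \<Longrightarrow> (\<lambda>n. measure M (space M - \<Union>(A n ` S))) \<longlonglongrightarrow> measure P (space P - \<Union>(B ` S))"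
    and "finite R" "R \<subseteq> J" "S \<subseteq> J"
  shows "(\<lambda>n. measure M {\<omega>\<in>space M. (\<forall>j\<in>S. \<omega> \<notin> A n j) \<and> (\<forall>j\<in>R. \<omega> \<in> A n j)})
    \<longlonglongrightarrow> measure P {\<omega>\<in>space P. (\<forall>j\<in>S. \<omega> \<notin> B j) \<and> (\<forall>j\<in>R. \<omega> \<in> B j)}"
  using \<open>finite R\<close> \<open>R \<subseteq> J\<close> \<open>S \<subseteq> J\<close>
proof (induction R arbitrary: S)
  case empty
  have "space M - \<Union>(A n ` S) = {\<omega>\<in>space M. \<forall>j\<in>S. \<omega> \<notin> A n j}" for n by auto
  moreover have "space P - \<Union>(B ` S) = {\<omega>\<in>space P. \<forall>j\<in>S. \<omega> \<notin> B j}" by auto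
  ultimately show ?case using avoid[OF empty(2)] by simp
next
  case (insert j R)
  interpret M: prob_space M by fact
  interpret P: prob_space P by fact
  let ?X = "\<lambda>n S. {\<omega>\<in>space M. (\<forall>j\<in>S. \<omega> \<notin> A n j) \<and> (\<forall>j\<in>R. \<omega> \<in> A n j)}"
  let ?Y = "\<lambda>S. {\<omega>\<in>space P. (\<forall>j\<in>S. \<omega> \<notin> B j) \<and> (\<forall>j\<in>R. \<omega> \<in> B j)}"
  have fin: "finite S" "finite R" "R \<subseteq> J" "j \<in> J" using insert J finite_subset by auto
  have X: "?X n S \<in> sets M" if "S \<subseteq> J" for n S
    using that fin A by (intro sets_hit_avoid) (auto intro: finite_subset[OF _ J])
  have Y: "?Y S \<in> sets P" if "S \<subseteq> J" for S
    using that fin B by (intro sets_hit_avoid) (auto intro: finite_subset[OF _ J])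
  have "measure M {\<omega>\<in>space M. (\<forall>j\<in>S. \<omega> \<notin> A n j) \<and> (\<forall>j\<in>insert j R. \<omega> \<in> A n j)}
      = measure M (?X n S) - measure M (?X n (insert j S))" for n
  proof -
    have "{\<omega>\<in>space M. (\<forall>j\<in>S. \<omega> \<notin> A n j) \<and> (\<forall>j\<in>insert j R. \<omega> \<in> A n j)} = ?X n S - ?X n (insert j S)"
      by auto
    then show ?thesis
      using X[of S n] X[of "insert j S" n] insert.prems by (simp add: M.finite_measure_Diff subset_eq)
  qed
  moreover have "measure P {\<omega>\<in>space P. (\<forall>j\<in>S. \<omega> \<notin> B j) \<and> (\<forall>j\<in>insert j R. \<omega> \<in> B j)}
      = measure P (?Y S) - measure P (?Y (insert j S))"
  proof -
    have "{\<omega>\<in>space P. (\<forall>j\<in>S. \<omega> \<notin> B j) \<and> (\<forall>j\<in>insert j R. \<omega> \<in> B j)} = ?Y S - ?Y (insert j S)"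
      by auto
    then show ?thesis
      using Y[of S] Y[of "insert j S"] insert.prems by (simp add: P.finite_measure_Diff subset_eq)
  qed
  moreover have "(\<lambda>n. measure M (?X n S) - measure M (?X n (insert j S)))
      \<longlonglongrightarrow> measure P (?Y S) - measure P (?Y (insert j S))"
    using insert by (intro tendsto_diff insert.IH) auto
  ultimately show ?case by simp
qed

lemma prob_hit_pattern:
  assumes "prob_space Q" and J: "finite J" and C: "\<And>j. j \<in> J \<Longrightarrow> C j \<in> sets Q"
  shows "measure Q {\<omega>\<in>space Q. {j\<in>J. \<omega> \<in> C j} \<in> \<G>} =
    (\<Sum>R\<in>\<G> \<inter> Pow J. measure Q {\<omega>\<in>space Q. (\<forall>j\<in>J - R. \<omega> \<notin> C j) \<and> (\<forall>j\<in>R. \<omega> \<in> C j)})"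
proof -
  interpret Q: prob_space Q by fact
  let ?X = "\<lambda>R. {\<omega>\<in>space Q. (\<forall>j\<in>J - R. \<omega> \<notin> C j) \<and> (\<forall>j\<in>R. \<omega> \<in> C j)}"
  have pat: "?X R = {\<omega>\<in>space Q. {j\<in>J. \<omega> \<in> C j} = R}" if "R \<in> \<G> \<inter> Pow J" for R
    using that by auto
  have X: "?X R \<in> sets Q" if "R \<in> \<G> \<inter> Pow J" for R
    using that C J by (intro sets_hit_avoid) (auto intro: finite_subset)
  have "{\<omega>\<in>space Q. {j\<in>J. \<omega> \<in> C j} \<in> \<G>} = (\<Union>R\<in>\<G> \<inter> Pow J. {\<omega>\<in>space Q. {j\<in>J. \<omega> \<in> C j} = R})"
    by auto
  also have "\<dots> = (\<Union>R\<in>\<G> \<inter> Pow J. ?X R)"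
    by (rule SUP_cong[OF refl pat[symmetric]])
  also have "measure Q \<dots> = (\<Sum>R\<in>\<G> \<inter> Pow J. measure Q (?X R))"
  proof (rule Q.finite_measure_finite_Union)
    show "disjoint_family_on ?X (\<G> \<inter> Pow J)"
      unfolding disjoint_family_on_def
    proof (intro ballI impI)
      fix R S assume "R \<in> \<G> \<inter> Pow J" "S \<in> \<G> \<inter> Pow J" "R \<noteq> S"
      then show "?X R \<inter> ?X S = {}" unfolding pat[OF \<open>R \<in> _\<close>] pat[OF \<open>S \<in> _\<close>] by blast
    qed
  qed (use J X in auto)
  finally show ?thesis .
qed

lemma sets_hit_pattern:
  assumes J: "finite J" and C: "\<And>j. j \<in> J \<Longrightarrow> C j \<in> sets Q"
  shows "{\<omega>\<in>space Q. {j\<in>J. \<omega> \<in> C j} \<in> \<G>} \<in> sets Q"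
proof -
  have "{\<omega>\<in>space Q. {j\<in>J. \<omega> \<in> C j} \<in> \<G>} =
      (\<Union>R\<in>\<G> \<inter> Pow J. {\<omega>\<in>space Q. (\<forall>j\<in>J - R. \<omega> \<notin> C j) \<and> (\<forall>j\<in>R. \<omega> \<in> C j)})" (is "?L = ?R")
  proof
    show "?L \<subseteq> ?R"
    proof
      fix \<omega> assume "\<omega> \<in> ?L"
      then show "\<omega> \<in> ?R" by (intro UN_I[of "{j\<in>J. \<omega> \<in> C j}"]) auto
    qed
    show "?R \<subseteq> ?L"
    proof
      fix \<omega> assume "\<omega> \<in> ?R"
      then obtain R where R: "R \<in> \<G>" "R \<subseteq> J" "\<omega> \<in> space Q" "\<forall>j\<in>J - R. \<omega> \<notin> C j" "\<forall>j\<in>R. \<omega> \<in> C j"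
        by blast
      then have "{j\<in>J. \<omega> \<in> C j} = R" by blast
      then show "\<omega> \<in> ?L" using R by simp
    qed
  qed
  also have "\<dots> \<in> sets Q"
    using J C by (intro sets.finite_UN sets_hit_avoid) (auto intro: finite_subset)
  finally show ?thesis .
qed

text \<open>A finite \<open>J\<close> has finitely many patterns, so the limit can be taken pattern
  by pattern and the family \<open>\<G>\<close> may be arbitrary.\<close>

lemma hit_pattern_tendsto:
  fixes A :: "nat \<Rightarrow> 'j \<Rightarrow> 'w set" and B :: "'j \<Rightarrow> 'p set"
  assumes M: "prob_space M" and P: "prob_space P"
    and A: "\<And>n j. j \<in> J \<Longrightarrow> A n j \<in> sets M" and B: "\<And>j. j \<in> J \<Longrightarrow> B j \<in> sets P" and J: "finite J"
    and avoid: "\<And>S. S \<subseteq> J \<Longrightarrow> (\<lambda>n. measure M (space M - \<Union>(A n ` S))) \<longlonglongrightarrow> measure P (space P - \<Union>(B ` S))"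
  shows "(\<lambda>n. measure M {\<omega>\<in>space M. {j\<in>J. \<omega> \<in> A n j} \<in> \<G>}) \<longlonglongrightarrow>
    measure P {\<omega>\<in>space P. {j\<in>J. \<omega> \<in> B j} \<in> \<G>}"
proof -
  have "(\<lambda>n. measure M {\<omega>\<in>space M. {j\<in>J. \<omega> \<in> A n j} \<in> \<G>}) =
     (\<lambda>n. \<Sum>R\<in>\<G> \<inter> Pow J. measure M {\<omega>\<in>space M. (\<forall>j\<in>J - R. \<omega> \<notin> A n j) \<and> (\<forall>j\<in>R. \<omega> \<in> A n j)})"
    by (rule ext, rule prob_hit_pattern[OF M J A])
  moreover have "measure P {\<omega>\<in>space P. {j\<in>J. \<omega> \<in> B j} \<in> \<G>} =
     (\<Sum>R\<in>\<G> \<inter> Pow J. measure P {\<omega>\<in>space P. (\<forall>j\<in>J - R. \<omega> \<notin> B j) \<and> (\<forall>j\<in>R. \<omega> \<in> B j)})"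
    by (rule prob_hit_pattern[OF P J B])
  ultimately show ?thesis
    using J by (simp only:)
      (intro tendsto_sum hit_avoid_tendsto[OF M P A B J avoid]; auto intro: finite_subset)
qed

section \<open>Poisson processes\<close>

lemma sets_cap_intensity: "sets (cap_intensity q H) = sets borel"
  by (simp add: cap_intensity_def)

lemma emeasure_cap_intensity:
  assumes [measurable]: "B \<in> sets borel"
  shows "emeasure (cap_intensity q H) B = ennreal q * emeasure lborel (B \<inter> paraboloid H)"
proof -
  have "emeasure (cap_intensity q H) B = (\<integral>\<^sup>+z. ennreal q * indicator (paraboloid H) z * indicator B z \<partial>lborel)"
    unfolding cap_intensity_def by (rule emeasure_density) measurable
  also have "\<dots> = (\<integral>\<^sup>+z. ennreal q * indicator (B \<inter> paraboloid H) z \<partial>lborel)"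
    by (intro nn_integral_cong) (auto simp: indicator_def)
  finally show ?thesis by (simp add: nn_integral_cmult)
qed

lemma measure_cap_intensity:
  assumes "B \<in> sets borel" "q \<ge> 0"
  shows "measure (cap_intensity q H) B = q * measure lborel (B \<inter> paraboloid H)"
  using assms by (simp add: measure_def emeasure_cap_intensity enn2real_mult)

lemma emeasure_cap_intensity_bounded:
  assumes "B \<in> sets borel" "bounded B"
  shows "emeasure (cap_intensity q H) B < \<infinity>"
  using emeasure_bounded_finite[of "B \<inter> paraboloid H"] assms
  by (auto simp: emeasure_cap_intensity ennreal_mult_less_top)

lemma point_count_eq_0_iff: "point_count X B \<omega> = 0 \<longleftrightarrow> (\<forall>i\<ge>1. X i \<omega> \<notin> B)"
  by (auto simp: point_count_def emeasure_count_space_eq_0)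

context
  fixes P :: "'p measure" and \<Lambda> :: "'a measure" and X
  assumes P: "prob_space P" and pp: "poisson_process P \<Lambda> X"
begin

interpretation prob_space P by (rule P)

lemma poisson_process_measurable: "i \<ge> 1 \<Longrightarrow> X i \<in> measurable P \<Lambda>"
  using pp by (simp add: poisson_process_def)

lemma poisson_process_count:
  assumes "B \<in> sets \<Lambda>" "emeasure \<Lambda> B < \<infinity>"
  shows "prob {\<omega>\<in>space P. point_count X B \<omega> = of_nat n} = measure \<Lambda> B ^ n / fact n * exp (- measure \<Lambda> B)"
  using pp assms by (simp add: poisson_process_def)

lemma poisson_process_avoid:
  assumes "B \<in> sets \<Lambda>" "emeasure \<Lambda> B < \<infinity>"
  shows "prob {\<omega>\<in>space P. \<forall>i\<ge>1. X i \<omega> \<notin> B} = exp (- measure \<Lambda> B)"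
  using poisson_process_count[OF assms, of 0] by (simp add: point_count_eq_0_iff)

lemma poisson_process_null:
  assumes "B \<in> sets \<Lambda>" "emeasure \<Lambda> B = 0"
  shows "AE \<omega> in P. \<forall>i\<ge>1. X i \<omega> \<notin> B"
proof -
  have "prob {\<omega>\<in>space P. \<forall>i\<ge>1. X i \<omega> \<notin> B} = 1"
    using poisson_process_avoid[OF assms(1)] assms(2) by (simp add: measure_def)
  from AE_prob_1[OF this] show ?thesis by eventually_elim simp
qed

text \<open>Measurability is contained in the independence clause, applied to a family with the
  single index 0.\<close>

lemma poisson_process_count_measurable:
  assumes "B \<in> sets \<Lambda>"
  shows "point_count X B \<in> borel_measurable P"
proof -
  have "indep_vars (\<lambda>_. borel) (\<lambda>j. point_count X ((\<lambda>_. B) j)) {0::nat}"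
    using pp assms unfolding poisson_process_def by (auto simp: disjoint_family_on_def)
  then show ?thesis by (simp add: indep_vars_def)
qed

text \<open>The Poisson weights sum to 1, so the count is almost surely a natural number, whereas
  infinitely many indices would make it infinite.\<close>

lemma poisson_process_locally_finite:
  assumes "B \<in> sets \<Lambda>" "emeasure \<Lambda> B < \<infinity>"
  shows "AE \<omega> in P. finite {i\<in>{1..}. X i \<omega> \<in> B}"
proof -
  let ?l = "measure \<Lambda> B"
  let ?A = "\<lambda>n. {\<omega>\<in>space P. point_count X B \<omega> = of_nat n}"
  have A: "?A n \<in> sets P" for n
    using poisson_process_count_measurable[OF assms(1)] by measurable
  have "(\<lambda>n. prob (?A n)) sums prob (\<Union>n. ?A n)"
    using A by (intro finite_measure_UNION) (auto simp: disjoint_family_on_def)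
  moreover have "prob (?A n) = exp (- ?l) * (?l ^ n /\<^sub>R fact n)" for n
    by (simp add: poisson_process_count[OF assms] divide_inverse mult_ac)
  moreover have "(\<lambda>n. exp (- ?l) * (?l ^ n /\<^sub>R fact n)) sums (exp (- ?l) * exp ?l)"
    by (intro sums_mult exp_converges)
  ultimately have "prob (\<Union>n. ?A n) = exp (- ?l) * exp ?l"
    by (simp add: sums_unique2)
  then have "prob (\<Union>n. ?A n) = 1" by (simp add: exp_minus)
  from AE_prob_1[OF this] show ?thesis
  proof eventually_elim
    case (elim \<omega>)
    show ?case
    proof (rule ccontr)
      assume "infinite {i\<in>{1..}. X i \<omega> \<in> B}"
      then have "point_count X B \<omega> = \<infinity>"
        unfolding point_count_def by (intro emeasure_count_space_infinite) auto
      then show False using elim by auto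
    qed
  qed
qed

end

text \<open>Absence of points in \<open>B j\<close> says that the coordinate \<open>B j\<close> of
  the counting measure is 0. It is thus an event of the sigma-algebra generated by the counts,
  whatever the enumeration.\<close>

lemma indep_processes_avoid:
  fixes X :: "'i \<Rightarrow> nat \<Rightarrow> 'p \<Rightarrow> 'a::topological_space"
  assumes P: "prob_space P" and ind: "indep_point_processes P X I"
    and J: "J \<subseteq> I" "finite J" "J \<noteq> {}" and B: "\<And>j. j \<in> J \<Longrightarrow> B j \<in> sets borel"
  shows "measure P {\<omega>\<in>space P. \<forall>j\<in>J. \<forall>i\<ge>1. X j i \<omega> \<notin> B j} =
    (\<Prod>j\<in>J. measure P {\<omega>\<in>space P. \<forall>i\<ge>1. X j i \<omega> \<notin> B j})"
proof -
  interpret prob_space P by (rule P)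
  let ?S = "PiM (sets (borel :: 'a measure)) (\<lambda>_. borel :: ennreal measure)"
  let ?c = "\<lambda>j \<omega>. \<lambda>B\<in>sets borel. point_count (X j) B \<omega>"
  define A where "A j = {h \<in> space ?S. h (B j) = 0}" for j
  have ind': "indep_vars (\<lambda>_. ?S) ?c I" using ind by (simp add: indep_point_processes_def)
  have A: "A j \<in> sets ?S" if "j \<in> J" for j
  proof -
    have "(\<lambda>h. h (B j)) \<in> borel_measurable ?S"
      using B[OF that] by (rule measurable_component_singleton)
    then show ?thesis unfolding A_def by measurable
  qed
  have pre: "?c j -` A j \<inter> space P = {\<omega>\<in>space P. \<forall>i\<ge>1. X j i \<omega> \<notin> B j}" if "j \<in> J" for j
    using B[OF that] by (auto simp: A_def space_PiM point_count_eq_0_iff)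
  have "{\<omega>\<in>space P. \<forall>j\<in>J. \<forall>i\<ge>1. X j i \<omega> \<notin> B j} = (\<Inter>j\<in>J. ?c j -` A j \<inter> space P)"
    using pre J(3) by auto
  also have "prob \<dots> = (\<Prod>j\<in>J. prob (?c j -` A j \<inter> space P))"
    by (rule indep_varsD[OF ind' J(3,2,1) A])
  also have "\<dots> = (\<Prod>j\<in>J. prob {\<omega>\<in>space P. \<forall>i\<ge>1. X j i \<omega> \<notin> B j})"
    using pre by (intro prod.cong) auto
  finally show ?thesis .
qed

section \<open>The limiting minimum\<close>

text \<open>The junk value of \<open>Inf\<close> on unbounded sets is a constant, so infima are measurable unconditionally.\<close>

lemma Inf_not_bdd_below_real:
  fixes S :: "real set"
  assumes "\<not> bdd_below S"
  shows "Inf S = - (LEAST z::real. False)"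
proof -
  have "(\<lambda>z. \<forall>x\<in>uminus ` S. x \<le> z) = (\<lambda>_. False)"
  proof (rule ext)
    fix z
    have "\<not> (\<forall>x\<in>S. - z \<le> x)" using assms unfolding bdd_below_def by blast
    then show "(\<forall>x\<in>uminus ` S. x \<le> z) = False" by (auto simp: minus_le_iff)
  qed
  then show ?thesis by (simp add: Inf_real_def Sup_real_def)
qed

lemma borel_measurable_INF_real:
  fixes g :: "'i \<Rightarrow> 'w \<Rightarrow> real"
  assumes I: "countable I" "I \<noteq> {}" and [measurable]: "\<And>i. i \<in> I \<Longrightarrow> g i \<in> borel_measurable M"
  shows "(\<lambda>\<omega>. INF i\<in>I. g i \<omega>) \<in> borel_measurable M"
proof -
  define G where "G t = {\<omega>\<in>space M. \<forall>i\<in>I. t \<le> g i \<omega>}" for t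
  have G [measurable]: "G t \<in> sets M" for t
    unfolding G_def using I(1) by (intro sets.sets_Collect_countable_All') measurable
  \<comment> \<open>A lower bound can be lowered to a rational one, so boundedness below is a
    countable union of the measurable sets \<open>G q\<close>.\<close>
  have bdd: "\<omega> \<in> (\<Union>q\<in>\<rat>. G q) \<longleftrightarrow> bdd_below ((\<lambda>i. g i \<omega>) ` I)" if "\<omega> \<in> space M" for \<omega>
  proof
    assume "bdd_below ((\<lambda>i. g i \<omega>) ` I)"
    then obtain l where l: "\<And>i. i \<in> I \<Longrightarrow> l \<le> g i \<omega>" by (auto simp: bdd_below_def)
    obtain q where "q \<in> \<rat>" "q < l" using Rats_dense_in_real[of "l - 1" l] by auto
    moreover have "\<omega> \<in> G q"
      using that order_trans[OF less_imp_le[OF \<open>q < l\<close>] l] by (simp add: G_def)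
    ultimately show "\<omega> \<in> (\<Union>q\<in>\<rat>. G q)" by blast
  qed (auto simp: G_def bdd_below_def)
  define c where "c = - (LEAST z::real. False)"
  show ?thesis
    unfolding borel_measurable_iff_ge
  proof
    fix t
    \<comment> \<open>Where the family is unbounded below, the infimum has the default value
      \<open>c\<close>; that region belongs to the set exactly when
      \<open>t \<le> c\<close>.\<close>
    have "{\<omega>\<in>space M. t \<le> (INF i\<in>I. g i \<omega>)} =
        G t \<union> (if t \<le> c then space M - (\<Union>q\<in>\<rat>. G q) else {})"
    proof (rule set_eqI)
      fix \<omega>
      show "\<omega> \<in> {\<omega>\<in>space M. t \<le> (INF i\<in>I. g i \<omega>)} \<longleftrightarrow>
        \<omega> \<in> G t \<union> (if t \<le> c then space M - (\<Union>q\<in>\<rat>. G q) else {})"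
      proof (cases "\<omega> \<in> space M")
        case True
        show ?thesis
        proof (cases "bdd_below ((\<lambda>i. g i \<omega>) ` I)")
          case b: True
          then have "t \<le> (INF i\<in>I. g i \<omega>) \<longleftrightarrow> (\<forall>i\<in>I. t \<le> g i \<omega>)"
            using I(2) by (simp add: le_cINF_iff)
          moreover have "\<omega> \<in> (\<Union>q\<in>\<rat>. G q)" using bdd[OF True] b by simp
          ultimately show ?thesis using True by (auto simp: G_def)
        next
          case b: False
          then have "(INF i\<in>I. g i \<omega>) = c" unfolding c_def by (rule Inf_not_bdd_below_real)
          moreover have "\<omega> \<notin> (\<Union>q\<in>\<rat>. G q)" using bdd[OF True] b by simp
          moreover have "\<omega> \<notin> G t" using b by (auto simp: G_def bdd_below_def)
          ultimately show ?thesis using True by auto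
        qed
      qed (auto simp: G_def)
    qed
    also have "\<dots> \<in> sets M"
      using countable_rat by (auto intro!: sets.Un sets.Diff sets.countable_UN')
    finally show "{\<omega>\<in>space M. t \<le> (INF i\<in>I. g i \<omega>)} \<in> sets M" .
  qed
qed

lemma continuous_on_pair_value [continuous_intros]:
  "continuous_on S u \<Longrightarrow> continuous_on S v \<Longrightarrow> continuous_on S (\<lambda>x. pair_value a (u x) (v x))"
  unfolding pair_value_def by (intro continuous_intros)

lemma borel_measurable_pair_value [measurable]:
  assumes [measurable]: "u \<in> borel_measurable M" "v \<in> borel_measurable M"
  shows "(\<lambda>x. pair_value a (u x) (v x)) \<in> borel_measurable M"
proof -
  have "(\<lambda>z. pair_value a (fst z) (snd z)) \<in> borel_measurable borel"
    by (intro borel_measurable_continuous_onI continuous_intros)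
  from measurable_compose[OF borel_measurable_Pair[OF assms] this] show ?thesis by simp
qed

text \<open>Uniform continuity of the pair value is used on the larger radius \<open>R + 1\<close>,
  since cells centred in \<open>cball 0 R\<close> may stick out of it.\<close>

lemma pair_value_cells:
  fixes R :: real
  assumes R: "R > 0" and w: "w > 0"
  obtains \<epsilon> and C :: "('n::finite) point set" where "0 < \<epsilon>" "finite C" "C \<subseteq> cball 0 R"
    "cball 0 R \<subseteq> (\<Union>c\<in>C. ball c \<epsilon>)"
    "\<And>c c' \<xi> \<zeta>. c \<in> C \<Longrightarrow> c' \<in> C \<Longrightarrow> \<xi> \<in> ball c \<epsilon> \<Longrightarrow> \<zeta> \<in> ball c' \<epsilon> \<Longrightarrow>
      \<bar>pair_value a \<xi> \<zeta> - pair_value a c c'\<bar> < w"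
proof -
  let ?K = "cball 0 (R + 1) \<times> cball 0 (R + 1) :: ('n point \<times> 'n point) set"
  have "uniformly_continuous_on ?K (\<lambda>z. pair_value a (fst z) (snd z))"
    by (intro compact_uniformly_continuous compact_Times compact_cball continuous_intros)
  then obtain d where d: "d > 0" "\<And>z z'. z \<in> ?K \<Longrightarrow> z' \<in> ?K \<Longrightarrow> dist z' z < d \<Longrightarrow>
      dist (pair_value a (fst z') (snd z')) (pair_value a (fst z) (snd z)) < w"
    using w unfolding uniformly_continuous_on_def by metis
  \<comment> \<open>The 1 keeps the cells inside radius \<open>R + 1\<close>; the half is there
    because the distances in the two components are added.\<close>
  define \<epsilon> where "\<epsilon> = min 1 (d / 2)"
  have \<epsilon>: "0 < \<epsilon>" "\<epsilon> \<le> 1" "2 * \<epsilon> \<le> d" using d(1) by (auto simp: \<epsilon>_def)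
  obtain C :: "'n point set" where C: "finite C" "C \<subseteq> cball 0 R" "cball 0 R \<subseteq> (\<Union>c\<in>C. ball c \<epsilon>)"
    using seq_compact_imp_totally_bounded[of "cball 0 R :: 'n point set"] \<epsilon>(1)
      compact_imp_seq_compact[OF compact_cball] by meson
  have sub: "ball c \<epsilon> \<subseteq> cball 0 (R + 1)" if "c \<in> C" for c
  proof
    fix z assume "z \<in> ball c \<epsilon>"
    moreover have "norm c \<le> R" using C(2) that by auto
    moreover have "norm z \<le> norm c + dist c z" by (metis dist_0_norm dist_triangle)
    ultimately show "z \<in> cball 0 (R + 1)" using \<epsilon> by simp
  qed
  show thesis
  proof (rule that[OF \<epsilon>(1) C])
    fix c c' \<xi> \<zeta> assume cc: "c \<in> C" "c' \<in> C" and z: "\<xi> \<in> ball c \<epsilon>" "\<zeta> \<in> ball c' \<epsilon>"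
    have "dist (\<xi>, \<zeta>) (c, c') \<le> dist \<xi> c + dist \<zeta> c'"
      using norm_Pair_le[of "\<xi> - c" "\<zeta> - c'"] by (simp add: dist_norm)
    also have "\<dots> < d" using z \<epsilon> by (simp add: dist_commute)
    finally have "dist (\<xi>, \<zeta>) (c, c') < d" .
    moreover have "(\<xi>, \<zeta>) \<in> ?K" "(c, c') \<in> ?K"
      using sub[OF cc(1)] sub[OF cc(2)] z \<epsilon> by (auto simp: subset_eq)
    ultimately have "dist (pair_value a \<xi> \<zeta>) (pair_value a c c') < w"
      using d(2)[of "(c, c')" "(\<xi>, \<zeta>)"] by simp
    then show "\<bar>pair_value a \<xi> \<zeta> - pair_value a c c'\<bar> < w" by (simp add: dist_real_def)
  qed
qed

text \<open>\<open>D > 0\<close> rules out the default diameter 0 of an empty sample.\<close>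

lemma sample_diam_ge_iff:
  assumes "D > 0"
  shows "D \<le> sample_diam z N \<longleftrightarrow> (\<exists>i\<in>{1..N}. \<exists>j\<in>{1..N}. D \<le> norm (z i - z j))"
proof (cases "N = 0")
  case True
  then show ?thesis using assms by (auto simp: sample_diam_def)
next
  case False
  then have ne: "{1..N} \<times> {1..N} \<noteq> {}" by auto
  then show ?thesis using False
    unfolding sample_diam_def by (simp add: Max_ge_iff image_iff)
qed

text \<open>Distils the Poisson processes into avoidance probabilities, support and local
  finiteness. \<open>X_avoid\<close> treats both ends of a diameter jointly; the independence of the
  two processes is hidden in it.\<close>

locale pole_processes = diametral_set a k E pole chart hess
  for a k and E :: "('n::finite) point set" and pole chart hess +
  fixes p :: "nat \<Rightarrow> bool \<Rightarrow> real" and P :: "'p measure" and X :: "nat \<Rightarrow> bool \<Rightarrow> nat \<Rightarrow> 'p \<Rightarrow> 'n point"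
  assumes P_prob: "prob_space P"
    and X_meas: "m \<in> {1..k} \<Longrightarrow> i \<ge> 1 \<Longrightarrow> X m c i \<in> borel_measurable P"
    and X_avoid: "m \<in> {1..k} \<Longrightarrow> (\<And>c. B c \<in> sets borel) \<Longrightarrow> (\<And>c. bounded (B c)) \<Longrightarrow>
      measure P {\<omega>\<in>space P. \<forall>c. \<forall>i\<ge>1. X m c i \<omega> \<notin> B c} =
      exp (- (\<Sum>c\<in>UNIV. p m c * measure lborel (B c \<inter> paraboloid (hess m c))))"
    and X_paraboloid: "m \<in> {1..k} \<Longrightarrow> AE \<omega> in P. \<forall>i\<ge>1. X m c i \<omega> \<in> paraboloid (hess m c)"
    and X_locally_finite: "m \<in> {1..k} \<Longrightarrow> AE \<omega> in P. finite {i\<in>{1..}. X m c i \<omega> \<in> cball 0 R}"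
begin

definition pole_min :: "nat \<Rightarrow> 'p \<Rightarrow> real" where
  "pole_min m = min_pair_value a (X m False) (X m True)"

lemma pole_min_measurable: "m \<in> {1..k} \<Longrightarrow> pole_min m \<in> borel_measurable P"
  unfolding pole_min_def min_pair_value_def case_prod_beta
  by (intro borel_measurable_INF_real borel_measurable_pair_value X_meas) auto

lemma pair_value_nonneg:
  "m \<in> {1..k} \<Longrightarrow> \<xi> \<in> paraboloid (hess m False) \<Longrightarrow> \<zeta> \<in> paraboloid (hess m True) \<Longrightarrow> 0 \<le> pair_value a \<xi> \<zeta>"
  using pair_value_bounds[of m 0] by blast

lemma pole_min_le:
  assumes "m \<in> {1..k}"
  shows "AE \<omega> in P. \<forall>i\<ge>1. \<forall>j\<ge>1. pole_min m \<omega> \<le> pair_value a (X m False i \<omega>) (X m True j \<omega>)"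
  using X_paraboloid[OF assms, of False] X_paraboloid[OF assms, of True]
proof eventually_elim
  case (elim \<omega>)
  have "bdd_below ((\<lambda>(i, j). pair_value a (X m False i \<omega>) (X m True j \<omega>)) ` ({1..} \<times> {1..}))"
  proof (rule bdd_belowI[of _ 0])
    fix y assume "y \<in> (\<lambda>(i, j). pair_value a (X m False i \<omega>) (X m True j \<omega>)) ` ({1..} \<times> {1..})"
    then obtain i j where "i \<ge> 1" "j \<ge> 1" "y = pair_value a (X m False i \<omega>) (X m True j \<omega>)"
      by auto
    then show "0 \<le> y"
      using pair_value_nonneg[OF assms, of "X m False i \<omega>" "X m True j \<omega>"] elim by simp
  qed
  from cINF_lower[OF this] show ?case
    unfolding pole_min_def min_pair_value_def by fastforce
qed

text \<open>Pairs that are not worse than the pair \<open>(1, 1)\<close> consist of points of a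
  fixed ball, by \<open>pair_value_bounds\<close>. Local finiteness leaves finitely many of them,
  and the best of these is the best of all.\<close>

lemma pole_min_attained:
  assumes m: "m \<in> {1..k}"
  shows "AE \<omega> in P. \<exists>i\<ge>1. \<exists>j\<ge>1. pair_value a (X m False i \<omega>) (X m True j \<omega>) = pole_min m \<omega>"
proof -
  have "AE \<omega> in P. \<forall>R::nat. \<forall>c. finite {i\<in>{1..}. X m c i \<omega> \<in> cball 0 (real R)}"
    using X_locally_finite[OF m] by (simp add: AE_all_countable)
  with X_paraboloid[OF m, of False] X_paraboloid[OF m, of True] pole_min_le[OF m]
  show ?thesis
  proof eventually_elim
    case (elim \<omega>)
    let ?h = "\<lambda>(i, j). pair_value a (X m False i \<omega>) (X m True j \<omega>)"
    obtain R0 where R0: "\<And>i j. i \<ge> 1 \<Longrightarrow> j \<ge> 1 \<Longrightarrow> ?h (i, j) \<le> ?h (1, 1) \<Longrightarrow>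
        norm (X m False i \<omega>) \<le> R0 \<and> norm (X m True j \<omega>) \<le> R0"
    proof -
      obtain R0 where "\<And>\<xi> \<zeta>. \<xi> \<in> paraboloid (hess m False) \<Longrightarrow> \<zeta> \<in> paraboloid (hess m True) \<Longrightarrow>
          pair_value a \<xi> \<zeta> \<le> ?h (1, 1) \<Longrightarrow> norm \<xi> \<le> R0 \<and> norm \<zeta> \<le> R0"
        using pair_value_bounds[OF m, of "?h (1, 1)"] by blast
      then show thesis using elim(1,2) by (intro that[of R0]) (simp only: prod.case, blast)
    qed
    obtain R :: nat where R: "R0 \<le> real R" using real_arch_simple by blast
    define L where "L = {z \<in> {1..} \<times> {1..}. ?h z \<le> ?h (1, 1)}"
    have "L \<subseteq> {i\<in>{1..}. X m False i \<omega> \<in> cball 0 (real R)} \<times> {i\<in>{1..}. X m True i \<omega> \<in> cball 0 (real R)}"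
      using R0 R by (fastforce simp: L_def)
    then have L: "finite L" "(1, 1) \<in> L"
      using elim(4) by (auto intro: finite_subset simp: L_def)
    define z where "z = arg_min_on ?h L"
    have "L \<noteq> {}" using L(2) by blast
    then have z: "z \<in> L" "?h z \<le> ?h z'" if "z' \<in> L" for z'
      unfolding z_def using L(1) that by (blast intro: arg_min_if_finite(1) arg_min_least)+
    note z = z(1)[OF L(2)] z(2)
    have "?h z \<le> ?h z'" if "z' \<in> {1..} \<times> {1..}" for z'
    proof (cases "z' \<in> L")
      case False
      then have "?h (1, 1) \<le> ?h z'" using that unfolding L_def by auto
      with z(2)[OF L(2)] show ?thesis by linarith
    qed (rule z(2))
    then have "?h z \<le> pole_min m \<omega>"
      unfolding pole_min_def min_pair_value_def by (intro cINF_greatest) auto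
    moreover have "pole_min m \<omega> \<le> ?h z" using elim(3) z(1) by (cases z) (auto simp: L_def)
    ultimately have "?h z = pole_min m \<omega>" by simp
    then show ?case using z(1) by (cases z) (auto simp: L_def)
  qed
qed

lemma pair_value_bounds_uniform:
  "\<exists>R. \<forall>m\<in>{1..k}. \<forall>\<xi>\<in>paraboloid (hess m False). \<forall>\<zeta>\<in>paraboloid (hess m True).
    pair_value a \<xi> \<zeta> \<le> T \<longrightarrow> norm \<xi> \<le> R \<and> norm \<zeta> \<le> R"
proof -
  obtain R where R: "\<And>m \<xi> \<zeta>. m \<in> {1..k} \<Longrightarrow> \<xi> \<in> paraboloid (hess m False) \<Longrightarrow> \<zeta> \<in> paraboloid (hess m True) \<Longrightarrow>
    pair_value a \<xi> \<zeta> \<le> T \<Longrightarrow> norm \<xi> \<le> R m \<and> norm \<zeta> \<le> R m"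
  proof -
    have "\<forall>m\<in>{1..k}. \<exists>R. \<forall>\<xi>\<in>paraboloid (hess m False). \<forall>\<zeta>\<in>paraboloid (hess m True).
      pair_value a \<xi> \<zeta> \<le> T \<longrightarrow> norm \<xi> \<le> R \<and> norm \<zeta> \<le> R"
      using pair_value_bounds[where T=T] by meson
    then obtain R where "\<forall>m\<in>{1..k}. \<forall>\<xi>\<in>paraboloid (hess m False). \<forall>\<zeta>\<in>paraboloid (hess m True).
      pair_value a \<xi> \<zeta> \<le> T \<longrightarrow> norm \<xi> \<le> R m \<and> norm \<zeta> \<le> R m"
      unfolding bchoice_iff by blast
    then show thesis by (intro that[of R]) blast
  qed
  have "R m \<le> Max (insert 0 (R ` {1..k}))" if "m \<in> {1..k}" for m
    using that by (intro Max_ge) auto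
  then show ?thesis
    using R by (intro exI[of _ "Max (insert 0 (R ` {1..k}))"] ballI impI conjI) (blast intro: order_trans)+
qed

text \<open>On independent copies of the probability space the \<open>k\<close> minima are independent by construction; one
  need not write them as measurable functions of the point counts.\<close>

definition copies :: "(nat \<Rightarrow> 'p) measure" where
  "copies = PiM {1..k} (\<lambda>_. P)"

lemma copies_prob: "prob_space copies"
  unfolding copies_def by (intro prob_space_PiM P_prob)

lemma space_copies: "\<omega> \<in> space copies \<Longrightarrow> m \<in> {1..k} \<Longrightarrow> \<omega> m \<in> space P"
  by (auto simp: copies_def space_PiM)

lemma copies_product:
  assumes "\<And>m. m \<in> {1..k} \<Longrightarrow> {\<omega>\<in>space P. Q m \<omega>} \<in> sets P"
  shows "measure copies {\<omega>\<in>space copies. \<forall>m\<in>{1..k}. Q m (\<omega> m)} = (\<Prod>m\<in>{1..k}. measure P {\<omega>\<in>space P. Q m \<omega>})"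
proof -
  interpret P: prob_space P by (rule P_prob)
  interpret copies: finite_product_prob_space "\<lambda>_. P" "{1..k}"
    by unfold_locales auto
  have "{\<omega>\<in>space copies. \<forall>m\<in>{1..k}. Q m (\<omega> m)} = (\<Pi>\<^sub>E m\<in>{1..k}. {\<omega>\<in>space P. Q m \<omega>})"
    by (auto simp: copies_def space_PiM PiE_iff extensional_def)
  then show ?thesis unfolding copies_def by (simp only:) (rule copies.prob_times[OF assms])
qed

lemma copies_AE: "m \<in> {1..k} \<Longrightarrow> AE \<omega> in P. Q \<omega> \<Longrightarrow> AE \<omega> in copies. Q (\<omega> m)"
  unfolding copies_def by (intro AE_PiM_component P_prob)

lemma copies_component [measurable]: "m \<in> {1..k} \<Longrightarrow> (\<lambda>\<omega>. \<omega> m) \<in> measurable copies P"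
  unfolding copies_def by (rule measurable_component_singleton)

end

section \<open>Convergence of occupied cells\<close>

text \<open>Apart from measurability, the sample size \<open>K n\<close> enters through the single
  limit \<open>sample_avoid\<close>. Deterministic and Poisson sizes both satisfy it, so one
  argument serves both assertions.\<close>

locale diametral_sample = pole_processes a k E pole chart hess p P X
  for a k and E :: "('n::finite) point set" and pole chart hess p
    and P :: "'p measure" and X +
  fixes f :: "'n point \<Rightarrow> real" and M :: "'w measure" and Z :: "nat \<Rightarrow> 'w \<Rightarrow> 'n point"
    and K :: "nat \<Rightarrow> 'w \<Rightarrow> nat"
  assumes f_borel: "f \<in> borel_measurable borel" and f_nonneg: "\<And>z. 0 \<le> f z" and f_off: "\<And>z. z \<notin> E \<Longrightarrow> f z = 0"
    and f_prob: "(\<integral>\<^sup>+ z. ennreal (f z) \<partial>lborel) = 1"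
    and f_cont: "m \<in> {1..k} \<Longrightarrow> continuous (at (- a, 0) within chart m c ` E) (f \<circ> inv (chart m c))"
    and f_pole: "m \<in> {1..k} \<Longrightarrow> p m c = (f \<circ> inv (chart m c)) (- a, 0)"
    and M_prob: "prob_space M"
    and Z_distr: "i \<ge> 1 \<Longrightarrow> distributed M lborel (Z i) (\<lambda>z. ennreal (f z))"
    and K_meas: "K n \<in> measurable M (count_space UNIV)"
    and sample_avoid: "(\<And>n. A n \<in> sets borel) \<Longrightarrow>
      (\<lambda>n. real n * measure (density lborel (\<lambda>z. ennreal (f z))) (A n)) \<longlonglongrightarrow> l \<Longrightarrow>
      (\<lambda>n. measure M {\<omega>\<in>space M. \<forall>i\<in>{1..K n \<omega>}. Z i \<omega> \<notin> A n}) \<longlonglongrightarrow> exp (- l)"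
begin

abbreviation \<mu> :: "'n point measure" where
  "\<mu> \<equiv> density lborel (\<lambda>z. ennreal (f z))"

lemma \<mu>_prob: "prob_space \<mu>"
  using f_prob f_borel by (intro prob_spaceI) (simp add: emeasure_density)

lemma Z_meas: "i \<ge> 1 \<Longrightarrow> Z i \<in> borel_measurable M"
  using distributed_measurable[OF Z_distr] by simp

lemma Z_in_E: "AE \<omega> in M. \<forall>i\<ge>1. Z i \<omega> \<in> E"
proof -
  have "AE \<omega> in M. Z i \<omega> \<in> E" if "i \<ge> 1" for i
  proof -
    have "AE z in \<mu>. z \<in> E"
    proof (subst AE_density)
      show "AE z in lborel. 0 < ennreal (f z) \<longrightarrow> z \<in> E"
        by (rule AE_I2) (metis ennreal_0 f_off less_irrefl)
    qed (use f_borel in simp)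
    then have "AE z in distr M lborel (Z i). z \<in> E"
      unfolding distributed_distr_eq_density[OF Z_distr[OF that]] .
    then show ?thesis by (rule AE_distrD[rotated]) (use Z_meas[OF that] in simp)
  qed
  then show ?thesis by (simp add: AE_all_countable)
qed

definition zoomed :: "nat \<Rightarrow> nat \<Rightarrow> bool \<Rightarrow> 'n point \<Rightarrow> 'n point" where
  "zoomed n m c z = zoom a (zoom_rate TYPE('n point) n) (chart m c z)"

lemma zoomed_meas: "m \<in> {1..k} \<Longrightarrow> zoomed n m c \<in> borel_measurable borel"
  unfolding zoomed_def using rigid_motion_continuous[OF chart_rigid]
  by (intro measurable_compose[OF _ measurable_zoom] borel_measurable_continuous_onI)

lemma zoomed_mass_single:
  assumes m: "m \<in> {1..k}" and B: "B \<in> sets borel" "bounded B"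
  shows "(\<lambda>n. real n * measure \<mu> {z. zoomed n m c z \<in> B}) \<longlonglongrightarrow>
    p m c * measure lborel (B \<inter> paraboloid (hess m c))"
proof -
  interpret \<mu>: prob_space \<mu> by (rule \<mu>_prob)
  have "(\<lambda>n. ennreal (real n) * emeasure \<mu> {z. zoomed n m c z \<in> B})
    \<longlonglongrightarrow> ennreal (p m c) * emeasure lborel (B \<inter> paraboloid (hess m c))"
    unfolding zoomed_def f_pole[OF m]
    by (rule zoom_mass_tendsto[OF chart_rigid[OF m] cap[OF m] left_pole_in[OF m] f_borel f_nonneg f_off
          f_cont[OF m] B(2,1)])
  moreover have "emeasure lborel (B \<inter> paraboloid (hess m c)) < \<infinity>"
    by (rule emeasure_bounded_finite) (use B in auto)
  then have "emeasure lborel (B \<inter> paraboloid (hess m c)) = ennreal (measure lborel (B \<inter> paraboloid (hess m c)))"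
    by (simp add: emeasure_eq_ennreal_measure)
  moreover have p: "0 \<le> p m c" using f_pole[OF m] f_nonneg by simp
  ultimately have "(\<lambda>n. ennreal (real n * measure \<mu> {z. zoomed n m c z \<in> B})) \<longlonglongrightarrow>
    ennreal (p m c * measure lborel (B \<inter> paraboloid (hess m c)))"
    by (simp add: \<mu>.emeasure_eq_measure ennreal_mult)
  then show ?thesis by (rule tendsto_ennrealD) (use p in \<open>auto intro!: always_eventually\<close>)
qed

lemma zoomed_near_pole:
  assumes m: "m \<in> {1..k}" and B: "bounded B" and d: "d > 0"
  shows "\<forall>\<^sub>F n in sequentially. \<forall>z. zoomed n m c z \<in> B \<longrightarrow> dist z (pole m c) < d"
proof -
  obtain R where R: "R > 0" "\<And>\<xi>. \<xi> \<in> B \<Longrightarrow> norm \<xi> \<le> R" using B bounded_pos by blast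
  have "(\<lambda>n. sqrt (zoom_rate TYPE('n point) n) * (2 * R)) \<longlonglongrightarrow> sqrt 0 * (2 * R)"
    by (intro tendsto_intros zoom_rate_tendsto)
  then have "\<forall>\<^sub>F n in sequentially. sqrt (zoom_rate TYPE('n point) n) * (2 * R) < d"
    using d by (auto dest: order_tendstoD(2))
  moreover have "\<forall>\<^sub>F n in sequentially. zoom_rate TYPE('n point) n < 1"
    using zoom_rate_tendsto by (rule order_tendstoD(2)) simp
  ultimately show ?thesis
  proof eventually_elim
    case (elim n)
    have r: "zoom_rate TYPE('n point) n > 0" by (rule zoom_rate_pos)
    show ?case
    proof (intro allI impI)
      fix z assume z: "zoomed n m c z \<in> B"
      let ?\<xi> = "zoomed n m c z"
      have "dist z (pole m c) = dist (chart m c z) (- a, 0)"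
        using rigid_motion_dist[OF chart_rigid[OF m], of c z "pole m c"] chart_pole[OF m] by (simp add: dist_norm)
      also have "chart m c z = unzoom a (zoom_rate TYPE('n point) n) ?\<xi>" using r by (simp add: zoomed_def)
      also have "dist (unzoom a (zoom_rate TYPE('n point) n) ?\<xi>) (- a, 0) \<le> sqrt (zoom_rate TYPE('n point) n) * (\<bar>fst ?\<xi>\<bar> + norm (snd ?\<xi>))"
        by (rule dist_unzoom_pole_le) (use r elim in auto)
      also have "\<dots> \<le> sqrt (zoom_rate TYPE('n point) n) * (2 * R)"
        using norm_fst_le[of "fst ?\<xi>" "snd ?\<xi>"] norm_snd_le[of "snd ?\<xi>" "fst ?\<xi>"] R(2)[OF z] r
        by (intro mult_left_mono) auto
      finally show "dist z (pole m c) < d" using elim by simp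
    qed
  qed
qed

text \<open>Unzoomed bounded sets shrink to their poles, which are distinct by
  \<open>pole_inj\<close>. For large \<open>n\<close> the preimages at different poles are therefore
  disjoint, and the single masses add up.\<close>

lemma zoomed_mass:
  assumes B: "\<And>m c. B m c \<in> sets borel" "\<And>m c. bounded (B m c)"
  shows "(\<lambda>n. real n * measure \<mu> {z. \<exists>m\<in>{1..k}. \<exists>c. zoomed n m c z \<in> B m c}) \<longlonglongrightarrow>
    (\<Sum>m\<in>{1..k}. \<Sum>c\<in>UNIV. p m c * measure lborel (B m c \<inter> paraboloid (hess m c)))"
proof -
  interpret \<mu>: prob_space \<mu> by (rule \<mu>_prob)
  define I where "I = {1..k} \<times> (UNIV :: bool set)"
  define S where "S n b = {z. zoomed n (fst b) (snd b) z \<in> B (fst b) (snd b)}" for n b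
  have S: "S n b \<in> sets borel" if "b \<in> I" for n b
    using measurable_sets[OF zoomed_meas B(1)] that by (auto simp: I_def S_def vimage_def)
  have "\<forall>\<^sub>F n in sequentially. \<forall>b\<in>I. \<forall>b'\<in>I. b \<noteq> b' \<longrightarrow> S n b \<inter> S n b' = {}"
  proof (intro eventually_ball_finite ballI)
    fix b b' assume b: "b \<in> I" "b' \<in> I"
    show "\<forall>\<^sub>F n in sequentially. b \<noteq> b' \<longrightarrow> S n b \<inter> S n b' = {}"
    proof (cases "b = b'")
      case False
      \<comment> \<open>Half the distance of the two poles: by the triangle inequality no point is
        within \<open>d\<close> of both.\<close>
      define d where "d = dist (pole (fst b) (snd b)) (pole (fst b') (snd b')) / 2"
      have "pole (fst b) (snd b) \<noteq> pole (fst b') (snd b')"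
        using pole_inj[of "fst b" "fst b'" "snd b" "snd b'"] b False by (auto simp: I_def prod_eq_iff)
      then have d: "d > 0" by (simp add: d_def)
      have m: "fst b \<in> {1..k}" "fst b' \<in> {1..k}" using b by (auto simp: I_def)
      show ?thesis
        using zoomed_near_pole[OF m(1) B(2)[of "fst b" "snd b"] d, of "snd b"]
          zoomed_near_pole[OF m(2) B(2)[of "fst b'" "snd b'"] d, of "snd b'"]
      proof eventually_elim
        case (elim n)
        have False if "z \<in> S n b" "z \<in> S n b'" for z
        proof -
          have "dist z (pole (fst b) (snd b)) < d" "dist z (pole (fst b') (snd b')) < d"
            using elim that unfolding S_def by blast+
          then have "dist (pole (fst b) (snd b)) (pole (fst b') (snd b')) < 2 * d"
            using dist_triangle3[of "pole (fst b) (snd b)" "pole (fst b') (snd b')" z] by simp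
          then show False by (simp add: d_def)
        qed
        then show ?case by blast
      qed
    qed simp
  qed (auto simp: I_def)
  then have "\<forall>\<^sub>F n in sequentially. (\<Sum>b\<in>I. real n * measure \<mu> (S n b)) =
      real n * measure \<mu> {z. \<exists>m\<in>{1..k}. \<exists>c. zoomed n m c z \<in> B m c}"
  proof eventually_elim
    case (elim n)
    have "{z. \<exists>m\<in>{1..k}. \<exists>c. zoomed n m c z \<in> B m c} = (\<Union>m\<in>{1..k}. \<Union>c. S n (m, c))"
      unfolding S_def fst_conv snd_conv by blast
    also have "\<dots> = (\<Union>b\<in>I. S n b)"
      unfolding I_def by blast
    also have "measure \<mu> \<dots> = (\<Sum>b\<in>I. measure \<mu> (S n b))"
      using S elim by (intro \<mu>.finite_measure_finite_Union) (auto simp: I_def disjoint_family_on_def)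
    finally show ?case by (simp add: sum_distrib_left)
  qed
  moreover have "(\<lambda>n. \<Sum>b\<in>I. real n * measure \<mu> (S n b)) \<longlonglongrightarrow>
      (\<Sum>b\<in>I. p (fst b) (snd b) * measure lborel (B (fst b) (snd b) \<inter> paraboloid (hess (fst b) (snd b))))"
    unfolding S_def by (intro tendsto_sum zoomed_mass_single B) (auto simp: I_def)
  ultimately have "(\<lambda>n. real n * measure \<mu> {z. \<exists>m\<in>{1..k}. \<exists>c. zoomed n m c z \<in> B m c}) \<longlonglongrightarrow>
      (\<Sum>b\<in>I. p (fst b) (snd b) * measure lborel (B (fst b) (snd b) \<inter> paraboloid (hess (fst b) (snd b))))"
    by (rule Lim_transform_eventually[rotated])
  then show ?thesis unfolding I_def by (simp add: sum.cartesian_product case_prod_beta)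
qed

definition sample_hits :: "'n point set \<Rightarrow> nat \<Rightarrow> nat \<times> bool \<Rightarrow> 'w set" where
  "sample_hits B n b = {\<omega>\<in>space M. \<exists>i\<in>{1..K n \<omega>}. zoomed n (fst b) (snd b) (Z i \<omega>) \<in> B}"

text \<open>The processes of the \<open>m\<close>-th diameter are evaluated at the
  \<open>m\<close>-th coordinate of \<open>\<omega>\<close>, so that hits at different diameters are
  independent under \<open>copies\<close>.\<close>

definition limit_hits :: "'n point set \<Rightarrow> nat \<times> bool \<Rightarrow> (nat \<Rightarrow> 'p) set" where
  "limit_hits B b = {\<omega>\<in>space copies. \<exists>i\<ge>1. X (fst b) (snd b) i (\<omega> (fst b)) \<in> B}"

lemma sets_sample_avoid:
  assumes "A \<in> sets borel"
  shows "{\<omega>\<in>space M. \<exists>i\<in>{1..K n \<omega>}. Z i \<omega> \<in> A} \<in> sets M"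
proof -
  have "{\<omega>\<in>space M. \<exists>i\<in>{1..K n \<omega>}. Z i \<omega> \<in> A} =
      (\<Union>i\<in>{1..}. (K n -` {i..} \<inter> space M) \<inter> (Z i -` A \<inter> space M))"
    by (rule set_eqI) (simp add: Bex_def, blast)
  also have "\<dots> \<in> sets M"
    using measurable_sets[OF K_meas] measurable_sets[OF Z_meas assms]
    by (intro sets.countable_UN' sets.Int) auto
  finally show ?thesis .
qed

lemma sets_sample_hits: "fst b \<in> {1..k} \<Longrightarrow> B \<in> sets borel \<Longrightarrow> sample_hits B n b \<in> sets M"
  using sets_sample_avoid[of "zoomed n (fst b) (snd b) -` B"]
    measurable_sets[OF zoomed_meas[of "fst b" n "snd b"], of B]
  by (simp add: sample_hits_def)

lemma sets_process_hits:
  assumes "m \<in> {1..k}" "B \<in> sets borel"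
  shows "{\<omega>\<in>space P. \<exists>i\<ge>1. X m c i \<omega> \<in> B} \<in> sets P"
proof -
  have "{\<omega>\<in>space P. \<exists>i\<ge>1. X m c i \<omega> \<in> B} = (\<Union>i\<in>{1..}. X m c i -` B \<inter> space P)"
    by auto
  also have "\<dots> \<in> sets P"
    using measurable_sets[OF X_meas[OF assms(1)] assms(2)] by (intro sets.countable_UN') auto
  finally show ?thesis .
qed

lemma sets_limit_hits: 
  assumes "fst b \<in> {1..k}" "B \<in> sets borel"
  shows "limit_hits B b \<in> sets copies"
proof -
  have "limit_hits B b = (\<lambda>\<omega>. \<omega> (fst b)) -` {\<omega>\<in>space P. \<exists>i\<ge>1. X (fst b) (snd b) i \<omega> \<in> B} \<inter> space copies"
    using assms space_copies by (auto simp: limit_hits_def)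
  also have "\<dots> \<in> sets copies"
    by (rule measurable_sets[OF copies_component[OF assms(1)] sets_process_hits[OF assms]])
  finally show ?thesis .
qed

text \<open>Avoiding all of \<open>S\<close> means avoiding, at each pole, the union
  \<open>B\<close> of its cells. For the sample this is one avoidance event whose rescaled mass
  tends to \<open>l\<close>. In the limit it factorizes over the diameters by \<open>copies\<close>
  and over the two ends by \<open>X_avoid\<close>, and the exponents add up to the same
  \<open>l\<close>.\<close>

lemma avoid_tendsto:
  fixes C :: "'n point set"
  assumes "finite S" and S: "S \<subseteq> ({1..k} \<times> UNIV) \<times> C"
  shows "(\<lambda>n. measure M (space M - (\<Union>(b, c)\<in>S. sample_hits (ball c \<epsilon>) n b))) \<longlonglongrightarrow>
    measure copies (space copies - (\<Union>(b, c)\<in>S. limit_hits (ball c \<epsilon>) b))"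
proof -
  define B where "B m d = (\<Union>c\<in>{c. ((m, d), c) \<in> S}. ball c \<epsilon>)" for m d
  have fin: "finite {c. ((m, d), c) \<in> S}" for m d
    by (rule finite_subset[OF _ finite_imageI[OF \<open>finite S\<close>, of snd]]) force
  have B: "B m d \<in> sets borel" "bounded (B m d)" for m d
    unfolding B_def using fin by (auto intro: borel_open)
  define l where "l = (\<Sum>m\<in>{1..k}. \<Sum>d\<in>UNIV. p m d * measure lborel (B m d \<inter> paraboloid (hess m d)))"
  \<comment> \<open>Stated for an arbitrary \<open>g\<close> because it is applied both to zoomed
    sample points and to points of the limit processes.\<close>
  have inB: "(\<exists>m\<in>{1..k}. \<exists>d. g m d \<in> B m d) \<longleftrightarrow> (\<exists>s\<in>S. g (fst (fst s)) (snd (fst s)) \<in> ball (snd s) \<epsilon>)" for g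
  proof
    assume "\<exists>m\<in>{1..k}. \<exists>d. g m d \<in> B m d"
    then obtain m d c where "((m, d), c) \<in> S" "g m d \<in> ball c \<epsilon>" unfolding B_def by blast
    then show "\<exists>s\<in>S. g (fst (fst s)) (snd (fst s)) \<in> ball (snd s) \<epsilon>"
      by (intro bexI[of _ "((m, d), c)"]) simp_all
  next
    assume "\<exists>s\<in>S. g (fst (fst s)) (snd (fst s)) \<in> ball (snd s) \<epsilon>"
    then obtain s where s: "s \<in> S" "g (fst (fst s)) (snd (fst s)) \<in> ball (snd s) \<epsilon>" by blast
    moreover have "((fst (fst s), snd (fst s)), snd s) \<in> S" "fst (fst s) \<in> {1..k}"
      using s S by auto
    ultimately show "\<exists>m\<in>{1..k}. \<exists>d. g m d \<in> B m d"
      unfolding B_def by (intro bexI[of _ "fst (fst s)"] exI[of _ "snd (fst s)"]) blast+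
  qed
  let ?A = "\<lambda>n. {z. \<exists>m\<in>{1..k}. \<exists>d. zoomed n m d z \<in> B m d}"
  have A: "?A n \<in> sets borel" for n
  proof -
    have "?A n = (\<Union>m\<in>{1..k}. \<Union>d\<in>UNIV. zoomed n m d -` B m d)" by blast
    also have "\<dots> \<in> sets borel"
      using measurable_sets[OF zoomed_meas B(1)] by (intro sets.finite_UN) auto
    finally show ?thesis .
  qed
  have "(\<lambda>n. measure M {\<omega>\<in>space M. \<forall>i\<in>{1..K n \<omega>}. Z i \<omega> \<notin> ?A n}) \<longlonglongrightarrow> exp (- l)"
    unfolding l_def by (rule sample_avoid[OF A zoomed_mass[OF B]])
  moreover have "{\<omega>\<in>space M. \<forall>i\<in>{1..K n \<omega>}. Z i \<omega> \<notin> ?A n} =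
      space M - (\<Union>(b, c)\<in>S. sample_hits (ball c \<epsilon>) n b)" for n
    unfolding inB sample_hits_def case_prod_beta by blast
  moreover have "measure copies (space copies - (\<Union>(b, c)\<in>S. limit_hits (ball c \<epsilon>) b)) = exp (- l)"
  proof -
    let ?Q = "\<lambda>m \<omega>. \<forall>d. \<forall>i\<ge>1. X m d i \<omega> \<notin> B m d"
    have Q: "{\<omega>\<in>space P. ?Q m \<omega>} \<in> sets P" if m: "m \<in> {1..k}" for m
    proof -
      have "{\<omega>\<in>space P. ?Q m \<omega>} = space P - (\<Union>d\<in>UNIV. {\<omega>\<in>space P. \<exists>i\<ge>1. X m d i \<omega> \<in> B m d})"
        by auto
      also have "\<dots> \<in> sets P"
        by (intro sets.Diff sets.top sets.finite_UN sets_process_hits m B) auto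
      finally show ?thesis .
    qed
    have "space copies - (\<Union>(b, c)\<in>S. limit_hits (ball c \<epsilon>) b) = {\<omega>\<in>space copies. \<forall>m\<in>{1..k}. ?Q m (\<omega> m)}"
    proof -
      have "(\<forall>m\<in>{1..k}. ?Q m (\<omega> m)) \<longleftrightarrow>
          \<not> (\<exists>i\<ge>1. \<exists>s\<in>S. X (fst (fst s)) (snd (fst s)) i (\<omega> (fst (fst s))) \<in> ball (snd s) \<epsilon>)" for \<omega>
        unfolding inB[of "\<lambda>m d. X m d _ (\<omega> m)", symmetric] by blast
      then show ?thesis unfolding limit_hits_def case_prod_beta by blast
    qed
    also have "measure copies \<dots> = (\<Prod>m\<in>{1..k}. measure P {\<omega>\<in>space P. ?Q m \<omega>})"
      by (rule copies_product[OF Q])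
    also have "\<dots> = (\<Prod>m\<in>{1..k}. exp (- (\<Sum>d\<in>UNIV. p m d * measure lborel (B m d \<inter> paraboloid (hess m d)))))"
      by (intro prod.cong refl X_avoid B)
    also have "\<dots> = exp (- l)"
      by (simp add: l_def exp_sum[symmetric] sum_negf[symmetric])
    finally show ?thesis .
  qed
  ultimately show ?thesis by simp
qed

lemma pattern_tendsto:
  fixes C :: "'n point set"
  assumes C: "finite C"
  defines "J \<equiv> ({1..k} \<times> UNIV) \<times> C"
  shows "(\<lambda>n. measure M {\<omega>\<in>space M. {(b, c)\<in>J. \<omega> \<in> sample_hits (ball c \<epsilon>) n b} \<in> \<G>}) \<longlonglongrightarrow>
    measure copies {\<omega>\<in>space copies. {(b, c)\<in>J. \<omega> \<in> limit_hits (ball c \<epsilon>) b} \<in> \<G>}"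
proof -
  have J: "finite J" using C by (simp add: J_def)
  have "(\<lambda>n. measure M {\<omega>\<in>space M. {j\<in>J. \<omega> \<in> (case j of (b, c) \<Rightarrow> sample_hits (ball c \<epsilon>) n b)} \<in> \<G>}) \<longlonglongrightarrow>
    measure copies {\<omega>\<in>space copies. {j\<in>J. \<omega> \<in> (case j of (b, c) \<Rightarrow> limit_hits (ball c \<epsilon>) b)} \<in> \<G>}"
  proof (rule hit_pattern_tendsto[OF M_prob copies_prob])
    fix S assume "S \<subseteq> J"
    then show "(\<lambda>n. measure M (space M - (\<Union>j\<in>S. case j of (b, c) \<Rightarrow> sample_hits (ball c \<epsilon>) n b))) \<longlonglongrightarrow>
        measure copies (space copies - (\<Union>j\<in>S. case j of (b, c) \<Rightarrow> limit_hits (ball c \<epsilon>) b))"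
      by (intro avoid_tendsto finite_subset[OF _ J]) (auto simp: J_def)
  qed (use J in \<open>auto simp: J_def intro!: sets_sample_hits sets_limit_hits\<close>)
  moreover have "{(b, c)\<in>J. Q b c} = {j\<in>J. case j of (b, c) \<Rightarrow> Q b c}" for Q by auto
  ultimately show ?thesis by (simp add: case_prod_beta)
qed

end

section \<open>Convergence of the rescaled diameter\<close>

text \<open>A condition on occupied cells alone, phrased with their centres: the pair values of the
  points themselves are not determined by the pattern, but pattern probabilities are what
  converges.\<close>

definition close_pairs :: "real \<Rightarrow> real \<Rightarrow> ((nat \<times> bool) \<times> ('n::finite) point) set set" where
  "close_pairs a s = {R. \<exists>m c c'. ((m, False), c) \<in> R \<and> ((m, True), c') \<in> R \<and> pair_value a c c' \<le> s}"

context diametral_sample begin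

text \<open>An exact identity. Its last term is the whole discrepancy between the deficit of the
  squared norm and the pair value; it is nonnegative, and of order \<open>(\<rho> n)\<^sup>2\<close>
  on bounded sets.\<close>

lemma norm_diff_zoomed:
  assumes m: "m \<in> {1..k}"
  defines "\<rho> \<equiv> zoom_rate TYPE('n point)"
  shows "(norm (u - v))\<^sup>2 = 4 * a\<^sup>2 - 4 * a * (\<rho> n * pair_value a (zoomed n m c u) (zoomed n m (\<not> c) v))
    + (\<rho> n)\<^sup>2 * (fst (zoomed n m c u) + fst (zoomed n m (\<not> c) v))\<^sup>2"
proof -
  have \<rho>: "\<rho> n > 0" by (simp add: \<rho>_def zoom_rate_pos)
  let ?x = "zoomed n m c u" and ?y = "zoomed n m (\<not> c) v"
  have 1: "fst (chart m d z) + a = \<rho> n * fst (zoomed n m d z)"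
    and 2: "snd (chart m d z) = sqrt (\<rho> n) *\<^sub>R snd (zoomed n m d z)" for d z
    using \<rho> by (simp_all add: zoomed_def zoom_def \<rho>_def)
  have "(norm (u - v))\<^sup>2 = (2 * a - \<rho> n * fst ?x - \<rho> n * fst ?y)\<^sup>2
      + (norm (sqrt (\<rho> n) *\<^sub>R snd ?x - sqrt (\<rho> n) *\<^sub>R snd ?y))\<^sup>2"
    unfolding norm_diff_charts[OF m, of u v c] 1 2 ..
  also have "(norm (sqrt (\<rho> n) *\<^sub>R snd ?x - sqrt (\<rho> n) *\<^sub>R snd ?y))\<^sup>2 = \<rho> n * (norm (snd ?x - snd ?y))\<^sup>2"
    using \<rho> by (simp add: scaleR_diff_right[symmetric] power_mult_distrib)
  also have "(norm (snd ?x - snd ?y))\<^sup>2 = 4 * a * (fst ?x + fst ?y - pair_value a ?x ?y)"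
    using a_pos by (simp add: pair_value_def)
  finally show ?thesis by (simp add: power2_eq_square algebra_simps)
qed

definition sample_stat :: "nat \<Rightarrow> 'w \<Rightarrow> real" where
  "sample_stat n \<omega> = real n powr (2 / (real DIM('n point) + 1)) * (2 * a - sample_diam (\<lambda>i. Z i \<omega>) (K n \<omega>))"

lemma sample_stat_measurable: "sample_stat n \<in> borel_measurable M"
proof -
  have "(\<lambda>\<omega>. sample_diam (\<lambda>i. Z i \<omega>) N) \<in> borel_measurable M" for N
  proof (cases "N = 0")
    case False
    have "(\<lambda>\<omega>. norm (Z i \<omega> - Z j \<omega>)) \<in> borel_measurable M" if "i \<ge> 1" "j \<ge> 1" for i j
      using Z_meas[OF that(1)] Z_meas[OF that(2)] by measurable
    then have "(\<lambda>\<omega>. Max ((\<lambda>z. norm (Z (fst z) \<omega> - Z (snd z) \<omega>)) ` ({1..N} \<times> {1..N}))) \<in> borel_measurable M"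
      by (intro borel_measurable_Max) auto
    then show ?thesis using False by (simp add: sample_diam_def case_prod_beta)
  qed (simp add: sample_diam_def)
  from measurable_compose_countable[OF this K_meas]
  show ?thesis unfolding sample_stat_def[abs_def] by measurable
qed

text \<open>For \<open>n \<ge> 1\<close> the normalizing power is the reciprocal of the zoom rate,
  and a positive threshold excludes the default diameter of an empty sample.\<close>

lemma sample_stat_le_iff:
  assumes n: "n \<ge> 1" and pos: "2 * a - t * zoom_rate TYPE('n point) n > 0"
  shows "sample_stat n \<omega> \<le> t \<longleftrightarrow> (\<exists>i\<in>{1..K n \<omega>}. \<exists>j\<in>{1..K n \<omega>}.
    2 * a - t * zoom_rate TYPE('n point) n \<le> norm (Z i \<omega> - Z j \<omega>))"
proof -
  let ?\<rho> = "zoom_rate TYPE('n point) n"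
  define s where "s = real n powr (2 / (real DIM('n point) + 1))"
  have s: "s > 0" "?\<rho> = inverse s"
    using n by (simp_all add: s_def zoom_rate_def powr_minus max_def)
  have "sample_stat n \<omega> \<le> t \<longleftrightarrow> 2 * a - t * ?\<rho> \<le> sample_diam (\<lambda>i. Z i \<omega>) (K n \<omega>)"
    unfolding sample_stat_def s_def[symmetric] s(2) using s(1) by (simp add: field_simps)
  then show ?thesis using sample_diam_ge_iff[OF pos] by simp
qed

definition limit_cdf :: "real \<Rightarrow> real" where
  "limit_cdf s = measure copies {\<omega>\<in>space copies. \<exists>m\<in>{1..k}. pole_min m (\<omega> m) \<le> s}"

lemma sets_limit_cdf: "{\<omega>\<in>space copies. \<exists>m\<in>{1..k}. pole_min m (\<omega> m) \<le> s} \<in> sets copies"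
  using measurable_compose[OF copies_component pole_min_measurable]
  by (intro sets.sets_Collect_finite_Ex borel_measurable_le) auto

definition sample_pattern :: "'n point set \<Rightarrow> real \<Rightarrow> nat \<Rightarrow> 'w \<Rightarrow> ((nat \<times> bool) \<times> 'n point) set" where
  "sample_pattern C \<epsilon> n \<omega> = {(b, c)\<in>({1..k} \<times> UNIV) \<times> C. \<omega> \<in> sample_hits (ball c \<epsilon>) n b}"

definition limit_pattern :: "'n point set \<Rightarrow> real \<Rightarrow> (nat \<Rightarrow> 'p) \<Rightarrow> ((nat \<times> bool) \<times> 'n point) set" where
  "limit_pattern C \<epsilon> \<omega> = {(b, c)\<in>({1..k} \<times> UNIV) \<times> C. \<omega> \<in> limit_hits (ball c \<epsilon>) b}"

lemma sets_sample_pattern: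
  assumes "finite C"
  shows "{\<omega>\<in>space M. sample_pattern C \<epsilon> n \<omega> \<in> \<G>} \<in> sets M"
proof -
  have "{\<omega>\<in>space M. {j\<in>({1..k} \<times> UNIV) \<times> C. \<omega> \<in> sample_hits (ball (snd j) \<epsilon>) n (fst j)} \<in> \<G>} \<in> sets M"
    using assms by (intro sets_hit_pattern sets_sample_hits) auto
  moreover have "{j\<in>({1..k} \<times> UNIV) \<times> C. \<omega> \<in> sample_hits (ball (snd j) \<epsilon>) n (fst j)} = sample_pattern C \<epsilon> n \<omega>" for \<omega>
    unfolding sample_pattern_def by (rule Collect_cong) (simp add: case_prod_beta mem_Times_iff)
  ultimately show ?thesis by simp
qed

lemma sets_limit_pattern:
  assumes "finite C"
  shows "{\<omega>\<in>space copies. limit_pattern C \<epsilon> \<omega> \<in> \<G>} \<in> sets copies"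
proof -
  have "{\<omega>\<in>space copies. {j\<in>({1..k} \<times> UNIV) \<times> C. \<omega> \<in> limit_hits (ball (snd j) \<epsilon>) (fst j)} \<in> \<G>} \<in> sets copies"
    using assms by (intro sets_hit_pattern sets_limit_hits) auto
  moreover have "{j\<in>({1..k} \<times> UNIV) \<times> C. \<omega> \<in> limit_hits (ball (snd j) \<epsilon>) (fst j)} = limit_pattern C \<epsilon> \<omega>" for \<omega>
    unfolding limit_pattern_def by (rule Collect_cong) (simp add: case_prod_beta mem_Times_iff)
  ultimately show ?thesis by simp
qed

lemma sample_close_pairs:
  "sample_pattern C \<epsilon> n \<omega> \<in> close_pairs a s \<longleftrightarrow> \<omega> \<in> space M \<and>
    (\<exists>m\<in>{1..k}. \<exists>c\<in>C. \<exists>c'\<in>C. \<exists>i\<in>{1..K n \<omega>}. \<exists>j\<in>{1..K n \<omega>}.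
      zoomed n m False (Z i \<omega>) \<in> ball c \<epsilon> \<and> zoomed n m True (Z j \<omega>) \<in> ball c' \<epsilon> \<and> pair_value a c c' \<le> s)"
proof -
  have "((m, d), c) \<in> sample_pattern C \<epsilon> n \<omega> \<longleftrightarrow> m \<in> {1..k} \<and> c \<in> C \<and> \<omega> \<in> space M \<and>
      (\<exists>i\<in>{1..K n \<omega>}. zoomed n m d (Z i \<omega>) \<in> ball c \<epsilon>)" for m d c
    by (simp add: sample_pattern_def sample_hits_def)
  then show ?thesis unfolding close_pairs_def mem_Collect_eq by (simp only:) blast
qed

lemma limit_close_pairs:
  "limit_pattern C \<epsilon> \<omega> \<in> close_pairs a s \<longleftrightarrow> \<omega> \<in> space copies \<and>
    (\<exists>m\<in>{1..k}. \<exists>c\<in>C. \<exists>c'\<in>C. \<exists>i\<ge>1. \<exists>j\<ge>1.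
      X m False i (\<omega> m) \<in> ball c \<epsilon> \<and> X m True j (\<omega> m) \<in> ball c' \<epsilon> \<and> pair_value a c c' \<le> s)"
proof -
  have "((m, d), c) \<in> limit_pattern C \<epsilon> \<omega> \<longleftrightarrow> m \<in> {1..k} \<and> c \<in> C \<and> \<omega> \<in> space copies \<and>
      (\<exists>i\<ge>1. X m d i (\<omega> m) \<in> ball c \<epsilon>)" for m d c
    by (simp add: limit_pattern_def limit_hits_def)
  then show ?thesis unfolding close_pairs_def mem_Collect_eq by (simp only:) blast
qed

lemma close_pairs_tendsto:
  assumes "finite C"
  shows "(\<lambda>n. measure M {\<omega>\<in>space M. sample_pattern C \<epsilon> n \<omega> \<in> close_pairs a s}) \<longlonglongrightarrow>
    measure copies {\<omega>\<in>space copies. limit_pattern C \<epsilon> \<omega> \<in> close_pairs a s}"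
  unfolding sample_pattern_def limit_pattern_def by (rule pattern_tendsto[OF assms])

lemma eventually_zoom_rate_less:
  "d > 0 \<Longrightarrow> \<forall>\<^sub>F n in sequentially. zoom_rate TYPE('n point) n * x < d"
proof -
  assume "d > 0"
  have "(\<lambda>n. zoom_rate TYPE('n point) n * x) \<longlonglongrightarrow> 0 * x"
    by (intro tendsto_intros zoom_rate_tendsto)
  then show ?thesis using \<open>d > 0\<close> by (auto dest: order_tendstoD(2))
qed

text \<open>The three \<open>w\<close> pay for the last term of \<open>norm_diff_zoomed\<close>, for
  passing from sample points to the centres of their cells, and for passing from the centres to
  points of the limit processes in the same cells.\<close>

lemma sample_stat_upper:
  assumes w: "w > 0"
  shows "\<exists>b B. b \<longlonglongrightarrow> B \<and> B \<le> limit_cdf (t + 3 * w) \<and>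
    (\<forall>\<^sub>F n in sequentially. measure M {\<omega>\<in>space M. sample_stat n \<omega> \<le> t} \<le> b n)"
proof -
  interpret M: prob_space M by (rule M_prob)
  interpret copies: prob_space copies by (rule copies_prob)
  have a2: "2 * a > 0" and aw: "4 * a * w > 0" using a_pos w by simp_all
  let ?\<rho> = "zoom_rate TYPE('n point)"
  \<comment> \<open>\<open>zoomed_bounded\<close> takes a nonnegative level, hence
    \<open>\<bar>t\<bar>\<close> instead of \<open>t\<close>.\<close>
  obtain R r0 where R: "R > 0" and r0: "r0 > 0" and zb: "\<And>r u v. 0 < r \<Longrightarrow> r < r0 \<Longrightarrow> u \<in> E \<Longrightarrow> v \<in> E \<Longrightarrow>
      norm (u - v) \<ge> 2 * a - \<bar>t\<bar> * r \<Longrightarrow>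
      \<exists>m\<in>{1..k}. \<exists>c. norm (zoom a r (chart m c u)) \<le> R \<and> norm (zoom a r (chart m (\<not> c) v)) \<le> R"
    using zoomed_bounded[of "\<bar>t\<bar>"] by (metis abs_ge_zero)
  obtain \<epsilon> and C :: "'n point set" where C: "0 < \<epsilon>" "finite C" "C \<subseteq> cball 0 R" "cball 0 R \<subseteq> (\<Union>c\<in>C. ball c \<epsilon>)"
    and osc: "\<And>c c' \<xi> \<zeta>. c \<in> C \<Longrightarrow> c' \<in> C \<Longrightarrow> \<xi> \<in> ball c \<epsilon> \<Longrightarrow> \<zeta> \<in> ball c' \<epsilon> \<Longrightarrow>
      \<bar>pair_value a \<xi> \<zeta> - pair_value a c c'\<bar> < w"
    using pair_value_cells[OF R w, of a] by metis
  let ?b = "\<lambda>n. measure M {\<omega>\<in>space M. sample_pattern C \<epsilon> n \<omega> \<in> close_pairs a (t + 2 * w)}"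
  let ?B = "measure copies {\<omega>\<in>space copies. limit_pattern C \<epsilon> \<omega> \<in> close_pairs a (t + 2 * w)}"
  have "?B \<le> limit_cdf (t + 3 * w)"
    unfolding limit_cdf_def
  proof (rule copies.finite_measure_mono_AE[OF _ sets_limit_cdf])
    have "AE \<omega> in copies. \<forall>m\<in>{1..k}. \<forall>i\<ge>1. \<forall>j\<ge>1. pole_min m (\<omega> m) \<le> pair_value a (X m False i (\<omega> m)) (X m True j (\<omega> m))"
      by (intro AE_finite_allI finite_atLeastAtMost copies_AE pole_min_le)
    then show "AE \<omega> in copies. \<omega> \<in> {\<omega>\<in>space copies. limit_pattern C \<epsilon> \<omega> \<in> close_pairs a (t + 2 * w)} \<longrightarrow>
      \<omega> \<in> {\<omega>\<in>space copies. \<exists>m\<in>{1..k}. pole_min m (\<omega> m) \<le> t + 3 * w}"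
    proof eventually_elim
      case (elim \<omega>)
      show ?case
      proof
        assume "\<omega> \<in> {\<omega>\<in>space copies. limit_pattern C \<epsilon> \<omega> \<in> close_pairs a (t + 2 * w)}"
        then obtain m c c' i j where *: "\<omega> \<in> space copies" "m \<in> {1..k}" "c \<in> C" "c' \<in> C" "i \<ge> 1" "j \<ge> 1"
          "X m False i (\<omega> m) \<in> ball c \<epsilon>" "X m True j (\<omega> m) \<in> ball c' \<epsilon>" "pair_value a c c' \<le> t + 2 * w"
          unfolding mem_Collect_eq limit_close_pairs by blast
        have "pole_min m (\<omega> m) \<le> pair_value a (X m False i (\<omega> m)) (X m True j (\<omega> m))"
          using elim *(2,5,6) by blast
        also have "\<dots> \<le> t + 3 * w" using osc[OF *(3,4,7,8)] *(9) by simp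
        finally show "\<omega> \<in> {\<omega>\<in>space copies. \<exists>m\<in>{1..k}. pole_min m (\<omega> m) \<le> t + 3 * w}"
          using * by blast
      qed
    qed
  qed
  moreover have "\<forall>\<^sub>F n in sequentially. measure M {\<omega>\<in>space M. sample_stat n \<omega> \<le> t} \<le> ?b n"
    \<comment> \<open>In this order: the normalization is valid, zoomed points stay in the fixed
      ball, the threshold is positive, and the quadratic remainder is below
      \<open>4 * a * w\<close>.\<close>
    using eventually_ge_at_top[of 1] eventually_zoom_rate_less[OF r0, of 1]
      eventually_zoom_rate_less[OF a2, of t] eventually_zoom_rate_less[OF aw, of "(2 * R)\<^sup>2"]
  proof eventually_elim
    case (elim n)
    have \<rho>: "?\<rho> n > 0" by (rule zoom_rate_pos)
    have pos: "2 * a - t * ?\<rho> n > 0" using elim a_pos by (simp add: mult.commute)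
    show ?case
    proof (rule M.finite_measure_mono_AE[OF _ sets_sample_pattern[OF C(2)]])
      show "AE \<omega> in M. \<omega> \<in> {\<omega>\<in>space M. sample_stat n \<omega> \<le> t} \<longrightarrow>
        \<omega> \<in> {\<omega>\<in>space M. sample_pattern C \<epsilon> n \<omega> \<in> close_pairs a (t + 2 * w)}"
        using Z_in_E
      proof eventually_elim
        case (elim \<omega>)
        show ?case
        proof
          assume "\<omega> \<in> {\<omega>\<in>space M. sample_stat n \<omega> \<le> t}"
          then obtain i j where \<omega>: "\<omega> \<in> space M" and ij: "i \<in> {1..K n \<omega>}" "j \<in> {1..K n \<omega>}"
            and d: "2 * a - t * ?\<rho> n \<le> norm (Z i \<omega> - Z j \<omega>)"
            using sample_stat_le_iff[OF \<open>1 \<le> n\<close> pos] by blast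
          have "t * ?\<rho> n \<le> \<bar>t\<bar> * ?\<rho> n" using \<rho> by (intro mult_right_mono) auto
          then have "2 * a - \<bar>t\<bar> * ?\<rho> n \<le> norm (Z i \<omega> - Z j \<omega>)" using d by simp
          then obtain m c where m: "m \<in> {1..k}" and zR: "norm (zoomed n m c (Z i \<omega>)) \<le> R"
            "norm (zoomed n m (\<not> c) (Z j \<omega>)) \<le> R"
            using zb[OF \<rho> _, of "Z i \<omega>" "Z j \<omega>"] elim ij \<open>?\<rho> n * 1 < r0\<close> unfolding zoomed_def by auto
          \<comment> \<open>The sample pair is unordered; swapping the indices if necessary puts the
            point at the end \<open>False\<close> first.\<close>
          have "\<exists>i j. i \<in> {1..K n \<omega>} \<and> j \<in> {1..K n \<omega>} \<and> 2 * a - t * ?\<rho> n \<le> norm (Z i \<omega> - Z j \<omega>) \<and>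
              norm (zoomed n m False (Z i \<omega>)) \<le> R \<and> norm (zoomed n m True (Z j \<omega>)) \<le> R"
          proof (cases c)
            case True
            then show ?thesis
              using ij d zR by (intro exI[of _ j] exI[of _ i]) (simp add: norm_minus_commute)
          next
            case False
            then show ?thesis using ij d zR by (intro exI[of _ i] exI[of _ j]) simp
          qed
          then obtain i j where ij: "i \<in> {1..K n \<omega>}" "j \<in> {1..K n \<omega>}"
            and d: "2 * a - t * ?\<rho> n \<le> norm (Z i \<omega> - Z j \<omega>)"
            and zR: "norm (zoomed n m False (Z i \<omega>)) \<le> R" "norm (zoomed n m True (Z j \<omega>)) \<le> R"
            by blast
          let ?\<xi> = "zoomed n m False (Z i \<omega>)" and ?\<zeta> = "zoomed n m True (Z j \<omega>)"
          have "?\<xi> \<in> cball 0 R" "?\<zeta> \<in> cball 0 R" using zR by simp_all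
          then have "?\<xi> \<in> (\<Union>c\<in>C. ball c \<epsilon>)" "?\<zeta> \<in> (\<Union>c\<in>C. ball c \<epsilon>)"
            by (simp_all only: subsetD[OF C(4)])
          then obtain c c' where c: "c \<in> C" "c' \<in> C" "?\<xi> \<in> ball c \<epsilon>" "?\<zeta> \<in> ball c' \<epsilon>"
            by blast
          have "(2 * a - t * ?\<rho> n)\<^sup>2 \<le> (norm (Z i \<omega> - Z j \<omega>))\<^sup>2"
            using d pos by (intro power_mono) auto
          also have "\<dots> = 4 * a\<^sup>2 - 4 * a * (?\<rho> n * pair_value a ?\<xi> ?\<zeta>) + (?\<rho> n)\<^sup>2 * (fst ?\<xi> + fst ?\<zeta>)\<^sup>2"
            using norm_diff_zoomed[OF m, of "Z i \<omega>" "Z j \<omega>" n False] by simp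
          also have "(?\<rho> n)\<^sup>2 * (fst ?\<xi> + fst ?\<zeta>)\<^sup>2 \<le> (?\<rho> n)\<^sup>2 * (2 * R)\<^sup>2"
          proof -
            have "\<bar>fst ?\<xi> + fst ?\<zeta>\<bar> \<le> \<bar>2 * R\<bar>"
              using zR norm_fst_le[of "fst ?\<xi>" "snd ?\<xi>"] norm_fst_le[of "fst ?\<zeta>" "snd ?\<zeta>"] R by simp
            then show ?thesis by (intro mult_left_mono) (simp_all only: abs_le_square_iff zero_le_power2)
          qed
          also have "(?\<rho> n)\<^sup>2 * (2 * R)\<^sup>2 \<le> ?\<rho> n * (4 * a * w)"
            using \<open>?\<rho> n * (2 * R)\<^sup>2 < 4 * a * w\<close> a_pos w \<rho>
            by (simp only: power2_eq_square[of "?\<rho> n"] mult.assoc) (intro mult_left_mono; simp)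
          \<comment> \<open>Expanding the square on the left produces
            \<open>(t * ?\<rho> n)\<^sup>2\<close>, which is dropped as nonnegative.\<close>
          finally have "?\<rho> n * (4 * a * pair_value a ?\<xi> ?\<zeta>) \<le> ?\<rho> n * (4 * a * (t + w))"
            using zero_le_power2[of "t * ?\<rho> n"] by (simp add: power2_eq_square algebra_simps)
          then have "pair_value a ?\<xi> ?\<zeta> \<le> t + w"
            using \<rho> a_pos by simp
          then have "pair_value a c c' \<le> t + 2 * w" using osc[OF c] by simp
          then show "\<omega> \<in> {\<omega>\<in>space M. sample_pattern C \<epsilon> n \<omega> \<in> close_pairs a (t + 2 * w)}"
            unfolding mem_Collect_eq sample_close_pairs using \<omega> m c ij by blast
        qed
      qed
    qed
  qed
  ultimately show ?thesis
    using close_pairs_tendsto[OF C(2), of \<epsilon> "t + 2 * w"] by blast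
qed

text \<open>The reverse passage, from limit points that attain the minimum to centres and on to
  sample points. The third \<open>w\<close> pays for the square of \<open>t * ?\<rho> n\<close> in
  the threshold, while the last term of \<open>norm_diff_zoomed\<close> now has the favourable
  sign.\<close>

lemma sample_stat_lower:
  assumes w: "w > 0"
  shows "\<exists>b B. b \<longlonglongrightarrow> B \<and> B \<ge> limit_cdf (t - 3 * w) \<and>
    (\<forall>\<^sub>F n in sequentially. measure M {\<omega>\<in>space M. sample_stat n \<omega> \<le> t} \<ge> b n)"
proof -
  interpret M: prob_space M by (rule M_prob)
  interpret copies: prob_space copies by (rule copies_prob)
  have a2: "2 * a > 0" and aw: "4 * a * w > 0" using a_pos w by simp_all
  let ?\<rho> = "zoom_rate TYPE('n point)"
  obtain R0 where R0: "\<And>m \<xi> \<zeta>. m \<in> {1..k} \<Longrightarrow> \<xi> \<in> paraboloid (hess m False) \<Longrightarrow> \<zeta> \<in> paraboloid (hess m True) \<Longrightarrow>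
      pair_value a \<xi> \<zeta> \<le> t \<Longrightarrow> norm \<xi> \<le> R0 \<and> norm \<zeta> \<le> R0"
    using pair_value_bounds_uniform[of t] by blast
  \<comment> \<open>The covering by cells is built in a ball of positive radius.\<close>
  define R where "R = max 1 R0"
  have R: "R > 0" "R0 \<le> R" by (auto simp: R_def)
  obtain \<epsilon> and C :: "'n point set" where C: "0 < \<epsilon>" "finite C" "C \<subseteq> cball 0 R" "cball 0 R \<subseteq> (\<Union>c\<in>C. ball c \<epsilon>)"
    and osc: "\<And>c c' \<xi> \<zeta>. c \<in> C \<Longrightarrow> c' \<in> C \<Longrightarrow> \<xi> \<in> ball c \<epsilon> \<Longrightarrow> \<zeta> \<in> ball c' \<epsilon> \<Longrightarrow>
      \<bar>pair_value a \<xi> \<zeta> - pair_value a c c'\<bar> < w"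
    using pair_value_cells[OF R(1) w, of a] by metis
  let ?b = "\<lambda>n. measure M {\<omega>\<in>space M. sample_pattern C \<epsilon> n \<omega> \<in> close_pairs a (t - 2 * w)}"
  let ?B = "measure copies {\<omega>\<in>space copies. limit_pattern C \<epsilon> \<omega> \<in> close_pairs a (t - 2 * w)}"
  have "limit_cdf (t - 3 * w) \<le> ?B"
    unfolding limit_cdf_def
  proof (rule copies.finite_measure_mono_AE[OF _ sets_limit_pattern[OF C(2)]])
    have "AE \<omega> in copies. \<forall>m\<in>{1..k}. \<exists>i\<ge>1. \<exists>j\<ge>1. pair_value a (X m False i (\<omega> m)) (X m True j (\<omega> m)) = pole_min m (\<omega> m)"
      by (intro AE_finite_allI finite_atLeastAtMost copies_AE pole_min_attained)
    moreover have "AE \<omega> in copies. \<forall>m\<in>{1..k}. \<forall>i\<ge>1. X m c i (\<omega> m) \<in> paraboloid (hess m c)" for c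
      by (intro AE_finite_allI finite_atLeastAtMost copies_AE X_paraboloid)
    note this[of False] this[of True]
    ultimately show "AE \<omega> in copies. \<omega> \<in> {\<omega>\<in>space copies. \<exists>m\<in>{1..k}. pole_min m (\<omega> m) \<le> t - 3 * w} \<longrightarrow>
      \<omega> \<in> {\<omega>\<in>space copies. limit_pattern C \<epsilon> \<omega> \<in> close_pairs a (t - 2 * w)}"
    proof eventually_elim
      case (elim \<omega>)
      show ?case
      proof
        assume "\<omega> \<in> {\<omega>\<in>space copies. \<exists>m\<in>{1..k}. pole_min m (\<omega> m) \<le> t - 3 * w}"
        then obtain m where \<omega>: "\<omega> \<in> space copies" and m: "m \<in> {1..k}" "pole_min m (\<omega> m) \<le> t - 3 * w" by blast
        obtain i j where ij: "i \<ge> 1" "j \<ge> 1"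
          and pv: "pair_value a (X m False i (\<omega> m)) (X m True j (\<omega> m)) \<le> t - 3 * w"
        proof -
          obtain i j where "i \<ge> 1" "j \<ge> 1" "pair_value a (X m False i (\<omega> m)) (X m True j (\<omega> m)) = pole_min m (\<omega> m)"
            using elim(1) m(1) by blast
          then show thesis using m(2) by (intro that[of i j]) simp_all
        qed
        let ?\<xi> = "X m False i (\<omega> m)" and ?\<zeta> = "X m True j (\<omega> m)"
        have "norm ?\<xi> \<le> R0 \<and> norm ?\<zeta> \<le> R0"
          by (rule R0[OF m(1)]) (use elim(2,3) m(1) ij pv w in auto)
        then have "?\<xi> \<in> cball 0 R" "?\<zeta> \<in> cball 0 R" using R(2) by auto
        then have "?\<xi> \<in> (\<Union>c\<in>C. ball c \<epsilon>)" "?\<zeta> \<in> (\<Union>c\<in>C. ball c \<epsilon>)"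
          by (simp_all only: subsetD[OF C(4)])
        then obtain c c' where c: "c \<in> C" "c' \<in> C" "?\<xi> \<in> ball c \<epsilon>" "?\<zeta> \<in> ball c' \<epsilon>"
          by blast
        have "pair_value a c c' \<le> t - 2 * w" using osc[OF c] pv by simp
        then show "\<omega> \<in> {\<omega>\<in>space copies. limit_pattern C \<epsilon> \<omega> \<in> close_pairs a (t - 2 * w)}"
          unfolding mem_Collect_eq limit_close_pairs using \<omega> m(1) ij c by blast
      qed
    qed
  qed
  moreover have "\<forall>\<^sub>F n in sequentially. ?b n \<le> measure M {\<omega>\<in>space M. sample_stat n \<omega> \<le> t}"
    using eventually_ge_at_top[of 1]
      eventually_zoom_rate_less[OF a2, of t] eventually_zoom_rate_less[OF aw, of "t\<^sup>2"]
  proof eventually_elim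
    case (elim n)
    have \<rho>: "?\<rho> n > 0" by (rule zoom_rate_pos)
    have pos: "2 * a - t * ?\<rho> n > 0" using elim a_pos by (simp add: mult.commute)
    show ?case
    proof (rule M.finite_measure_mono)
      show "{\<omega>\<in>space M. sample_stat n \<omega> \<le> t} \<in> sets M"
        using sample_stat_measurable by measurable
      show "{\<omega>\<in>space M. sample_pattern C \<epsilon> n \<omega> \<in> close_pairs a (t - 2 * w)} \<subseteq> {\<omega>\<in>space M. sample_stat n \<omega> \<le> t}"
      proof
        fix \<omega> assume "\<omega> \<in> {\<omega>\<in>space M. sample_pattern C \<epsilon> n \<omega> \<in> close_pairs a (t - 2 * w)}"
        then obtain m c c' i j where \<omega>: "\<omega> \<in> space M" and m: "m \<in> {1..k}"
          and ij: "i \<in> {1..K n \<omega>}" "j \<in> {1..K n \<omega>}"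
          and c: "c \<in> C" "c' \<in> C" "zoomed n m False (Z i \<omega>) \<in> ball c \<epsilon>" "zoomed n m True (Z j \<omega>) \<in> ball c' \<epsilon>"
          and pv: "pair_value a c c' \<le> t - 2 * w"
          unfolding mem_Collect_eq sample_close_pairs by blast
        let ?\<xi> = "zoomed n m False (Z i \<omega>)" and ?\<zeta> = "zoomed n m True (Z j \<omega>)"
        have "pair_value a ?\<xi> ?\<zeta> \<le> t - w" using osc[OF c] pv by simp
        then have "4 * a * (?\<rho> n * pair_value a ?\<xi> ?\<zeta>) \<le> 4 * a * (?\<rho> n * (t - w))"
          using \<rho> a_pos by (intro mult_left_mono) auto
        moreover have "(norm (Z i \<omega> - Z j \<omega>))\<^sup>2 =
            4 * a\<^sup>2 - 4 * a * (?\<rho> n * pair_value a ?\<xi> ?\<zeta>) + (?\<rho> n)\<^sup>2 * (fst ?\<xi> + fst ?\<zeta>)\<^sup>2"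
          using norm_diff_zoomed[OF m, of "Z i \<omega>" "Z j \<omega>" n False] by simp
        moreover have "0 \<le> (?\<rho> n)\<^sup>2 * (fst ?\<xi> + fst ?\<zeta>)\<^sup>2" by simp
        moreover have "?\<rho> n * (?\<rho> n * t\<^sup>2) \<le> ?\<rho> n * (4 * a * w)"
          using elim(3) \<rho> by (intro mult_left_mono) auto
        \<comment> \<open>Splitting \<open>t\<close> into \<open>t - w\<close> and \<open>w\<close>
          reserves the part with \<open>w\<close> to pay for
          \<open>(t * ?\<rho> n)\<^sup>2\<close>.\<close>
        moreover have "(2 * a - t * ?\<rho> n)\<^sup>2 = 4 * a\<^sup>2 - 4 * a * (?\<rho> n * (t - w)) - ?\<rho> n * (4 * a * w) + ?\<rho> n * (?\<rho> n * t\<^sup>2)"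
          by (simp add: power2_eq_square algebra_simps)
        ultimately have "(2 * a - t * ?\<rho> n)\<^sup>2 \<le> (norm (Z i \<omega> - Z j \<omega>))\<^sup>2" by linarith
        then have "2 * a - t * ?\<rho> n \<le> norm (Z i \<omega> - Z j \<omega>)"
          by (rule power2_le_imp_le) simp
        then show "\<omega> \<in> {\<omega>\<in>space M. sample_stat n \<omega> \<le> t}"
          using sample_stat_le_iff[OF elim(1) pos, of \<omega>] \<omega> ij by blast
      qed
    qed
  qed
  ultimately show ?thesis
    using close_pairs_tendsto[OF C(2), of \<epsilon> "t - 2 * w"] by blast
qed

text \<open>Both bounds are available for every \<open>w > 0\<close>, and continuity at
  \<open>t\<close> brings \<open>limit_cdf (t + 3 * w)\<close> and
  \<open>limit_cdf (t - 3 * w)\<close> arbitrarily close to \<open>limit_cdf t\<close>.\<close>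

theorem sample_stat_tendsto:
  assumes cont: "isCont limit_cdf t"
  shows "(\<lambda>n. measure M {\<omega>\<in>space M. sample_stat n \<omega> \<le> t}) \<longlonglongrightarrow> limit_cdf t"
proof (rule order_tendstoI)
  have lim: "((\<lambda>w. limit_cdf (t + c * w)) \<longlongrightarrow> limit_cdf t) (at_right 0)" for c
  proof -
    have "((\<lambda>w. t + c * w) \<longlongrightarrow> t) (at_right 0)" by (auto intro!: tendsto_eq_intros)
    from isCont_tendsto_compose[OF cont this] show ?thesis .
  qed
  have ex: "\<exists>w>0. Q w" if "\<forall>\<^sub>F w in at_right (0::real). Q w" for Q
    using that eventually_at_right_less[of "0::real"]
    by (metis (mono_tags, lifting) eventually_conj eventually_happens' trivial_limit_at_right_real)
  fix y
  {
    assume "limit_cdf t < y"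
    then obtain w where w: "w > 0" "limit_cdf (t + 3 * w) < y"
      using ex[OF order_tendstoD(2)[OF lim[of 3]]] by blast
    obtain b B where b: "b \<longlonglongrightarrow> B" "B \<le> limit_cdf (t + 3 * w)"
      "\<forall>\<^sub>F n in sequentially. measure M {\<omega>\<in>space M. sample_stat n \<omega> \<le> t} \<le> b n"
      using sample_stat_upper[OF w(1)] by blast
    have "\<forall>\<^sub>F n in sequentially. b n < y"
      by (rule order_tendstoD(2)[OF b(1)]) (use b(2) w(2) in simp)
    with b(3) show "\<forall>\<^sub>F n in sequentially. measure M {\<omega>\<in>space M. sample_stat n \<omega> \<le> t} < y"
      by eventually_elim simp
  next
    assume "y < limit_cdf t"
    then obtain w where w: "w > 0" "y < limit_cdf (t - 3 * w)"
      using ex[OF order_tendstoD(1)[OF lim[of "-3"]]] by auto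
    obtain b B where b: "b \<longlonglongrightarrow> B" "B \<ge> limit_cdf (t - 3 * w)"
      "\<forall>\<^sub>F n in sequentially. measure M {\<omega>\<in>space M. sample_stat n \<omega> \<le> t} \<ge> b n"
      using sample_stat_lower[OF w(1)] by blast
    have "\<forall>\<^sub>F n in sequentially. y < b n"
      by (rule order_tendstoD(1)[OF b(1)]) (use b(2) w(2) in simp)
    with b(3) show "\<forall>\<^sub>F n in sequentially. y < measure M {\<omega>\<in>space M. sample_stat n \<omega> \<le> t}"
      by eventually_elim simp
  }
qed

end

section \<open>Identification of the limit law\<close>

lemma prob_all_greater:
  fixes V :: "nat \<Rightarrow> 'q \<Rightarrow> real"
  assumes Q: "prob_space Q" and ind: "prob_space.indep_vars Q (\<lambda>_. borel) V I" and I: "finite I" "I \<noteq> {}"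
  shows "measure Q {\<omega>\<in>space Q. \<forall>m\<in>I. V m \<omega> > s} = (\<Prod>m\<in>I. measure Q {\<omega>\<in>space Q. V m \<omega> > s})"
proof -
  interpret prob_space Q by (rule Q)
  have "{\<omega>\<in>space Q. \<forall>m\<in>I. V m \<omega> > s} = (\<Inter>m\<in>I. V m -` {s<..} \<inter> space Q)"
    using I(2) by auto
  also have "prob \<dots> = (\<Prod>m\<in>I. prob (V m -` {s<..} \<inter> space Q))"
    by (rule indep_varsD_finite[OF ind I(2,1)]) simp
  also have "\<dots> = (\<Prod>m\<in>I. prob {\<omega>\<in>space Q. V m \<omega> > s})"
    by (intro prod.cong refl arg_cong[where f=prob]) auto
  finally show ?thesis .
qed

context diametral_sample begin

text \<open>Independence of the coordinates of \<open>copies\<close> factorizes the tail and leaves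
  an expression that involves only the law of each single minimum.\<close>

lemma limit_cdf_eq:
  "limit_cdf s = 1 - (\<Prod>m\<in>{1..k}. measure P {\<omega>\<in>space P. pole_min m \<omega> > s})"
proof -
  interpret copies: prob_space copies by (rule copies_prob)
  have "limit_cdf s = 1 - copies.prob (space copies - {\<omega>\<in>space copies. \<exists>m\<in>{1..k}. pole_min m (\<omega> m) \<le> s})"
    unfolding limit_cdf_def copies.prob_compl[OF sets_limit_cdf] by simp
  also have "space copies - {\<omega>\<in>space copies. \<exists>m\<in>{1..k}. pole_min m (\<omega> m) \<le> s} =
      {\<omega>\<in>space copies. \<forall>m\<in>{1..k}. pole_min m (\<omega> m) > s}"
    by (auto simp: not_le)
  also have "copies.prob \<dots> = (\<Prod>m\<in>{1..k}. measure P {\<omega>\<in>space P. pole_min m \<omega> > s})"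
  proof (rule copies_product)
    fix m assume "m \<in> {1..k}"
    note pole_min_measurable[OF this, measurable]
    show "{\<omega>\<in>space P. pole_min m \<omega> > s} \<in> sets P" by measurable
  qed
  finally show ?thesis .
qed

text \<open>The tail of the minimum of the independent \<open>V m\<close> is the product of their
  tails, which is the expression in \<open>limit_cdf_eq\<close>. Prescribing \<open>S n\<close> from
  \<open>n = 1\<close> on leaves room for a sample size that is arbitrary at the index 0.\<close>

lemma sample_weak_conv:
  fixes V :: "nat \<Rightarrow> 'q \<Rightarrow> real"
  assumes k: "k \<ge> 1" and Q: "prob_space Q" and ind: "prob_space.indep_vars Q (\<lambda>_. borel) V {1..k}"
    and V: "\<And>m. m \<in> {1..k} \<Longrightarrow> distr Q borel (V m) = distr P borel (pole_min m)"
    and S: "\<And>n. n \<ge> 1 \<Longrightarrow> S n = distr M borel (sample_stat n)"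
  shows "weak_conv_m S (distr Q borel (\<lambda>\<omega>. Min ((\<lambda>m. V m \<omega>) ` {1..k})))"
proof -
  interpret Q: prob_space Q by (rule Q)
  have ne: "{1..k} \<noteq> {}" using k by auto
  have Vm: "V m \<in> borel_measurable Q" if "m \<in> {1..k}" for m
    using ind that by (simp add: Q.indep_vars_def)
  let ?V = "\<lambda>\<omega>. Min ((\<lambda>m. V m \<omega>) ` {1..k})"
  have Min_meas: "?V \<in> borel_measurable Q"
    by (rule borel_measurable_Min) (use Vm in auto)
  have Min_le: "?V \<omega> \<le> s \<longleftrightarrow> (\<exists>m\<in>{1..k}. V m \<omega> \<le> s)" for \<omega> s
    using ne by (subst Min_le_iff) auto
  have "cdf (distr Q borel ?V) s = limit_cdf s" for s
  proof -
    have "cdf (distr Q borel ?V) s = Q.prob {\<omega>\<in>space Q. ?V \<omega> \<le> s}"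
      unfolding cdf_def using Min_meas by (subst measure_distr) (auto simp: vimage_def intro!: arg_cong[where f="Q.prob"])
    also have "\<dots> = 1 - Q.prob (space Q - {\<omega>\<in>space Q. ?V \<omega> \<le> s})"
      using Min_meas by (subst Q.prob_compl) auto
    also have "space Q - {\<omega>\<in>space Q. ?V \<omega> \<le> s} = {\<omega>\<in>space Q. \<forall>m\<in>{1..k}. V m \<omega> > s}"
      unfolding Min_le by (auto simp: not_le)
    also have "Q.prob \<dots> = (\<Prod>m\<in>{1..k}. Q.prob {\<omega>\<in>space Q. V m \<omega> > s})"
      by (rule prob_all_greater[OF Q ind _ ne]) simp
    also have "\<dots> = (\<Prod>m\<in>{1..k}. measure P {\<omega>\<in>space P. pole_min m \<omega> > s})"
    proof (rule prod.cong[OF refl])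
      fix m assume m: "m \<in> {1..k}"
      have "Q.prob {\<omega>\<in>space Q. V m \<omega> > s} = measure (distr Q borel (V m)) {s<..}"
        using Vm[OF m] by (subst measure_distr) (auto simp: vimage_def intro!: arg_cong[where f="Q.prob"])
      also have "\<dots> = measure P {\<omega>\<in>space P. pole_min m \<omega> > s}"
        unfolding V[OF m] using pole_min_measurable[OF m]
        by (subst measure_distr) (auto simp: vimage_def intro!: arg_cong[where f="measure P"])
      finally show "Q.prob {\<omega>\<in>space Q. V m \<omega> > s} = measure P {\<omega>\<in>space P. pole_min m \<omega> > s}" .
    qed
    finally show ?thesis by (simp add: limit_cdf_eq)
  qed
  then have lim: "cdf (distr Q borel ?V) = limit_cdf" by auto
  have cdf: "\<forall>\<^sub>F n in sequentially. measure M {\<omega>\<in>space M. sample_stat n \<omega> \<le> s} = cdf (S n) s" for s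
    using eventually_ge_at_top[of 1]
  proof eventually_elim
    case (elim n)
    show ?case
      unfolding cdf_def S[OF elim] using sample_stat_measurable[of n]
      by (subst measure_distr) (auto simp: vimage_def intro!: arg_cong[where f="measure M"])
  qed
  show ?thesis
    unfolding weak_conv_m_def weak_conv_def lim
  proof (intro allI impI)
    fix s assume "isCont limit_cdf s"
    from Lim_transform_eventually[OF sample_stat_tendsto[OF this] cdf]
    show "(\<lambda>n. cdf (S n) s) \<longlonglongrightarrow> limit_cdf s" .
  qed
qed

end

theorem theorem6:
  fixes a :: real and k :: nat
    and E :: "('n::{finite,linorder}) point set"
    and x y :: "nat \<Rightarrow> 'n point"
    and \<phi> :: "nat \<Rightarrow> 'n point \<Rightarrow> 'n point"
    and f :: "'n point \<Rightarrow> real"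
    and Hl Hr :: "nat \<Rightarrow> 'n sqmat"
    and pl pr :: "nat \<Rightarrow> real"
    and M :: "'w measure" and Z :: "nat \<Rightarrow> 'w \<Rightarrow> 'n point" and N :: "nat \<Rightarrow> 'w \<Rightarrow> nat"
    and P :: "'p measure" and X Y :: "nat \<Rightarrow> nat \<Rightarrow> 'p \<Rightarrow> 'n point"
    and Q :: "'q measure" and V :: "nat \<Rightarrow> 'q \<Rightarrow> real"
  assumes "a > 0" and "k \<ge> 2"
    and "closed E" and "bounded E" and "diameter E = 2 * a"
    and "\<And>m. m \<in> {1..k} \<Longrightarrow> x m \<in> E \<and> y m \<in> E \<and> norm (x m - y m) = 2 * a"
    and "\<And>i j. i \<in> {1..k} \<Longrightarrow> j \<in> {1..k} \<Longrightarrow> i \<noteq> j \<Longrightarrow>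
           (x i, y i) \<noteq> (x j, y j) \<and> (x j, y j) \<noteq> (y i, x i)"
    and "\<And>u v. u \<in> E - (x ` {1..k} \<union> y ` {1..k}) \<Longrightarrow> v \<in> E \<Longrightarrow> norm (u - v) < 2 * a"
    and "\<And>m. m \<in> {1..k} \<Longrightarrow>
           rigid_motion (\<phi> m) \<and> \<phi> m (x m) = (- a, 0) \<and> \<phi> m (y m) = (a, 0)"
    and "f \<in> borel_measurable borel" and "\<And>z. 0 \<le> f z" and "\<And>z. z \<notin> E \<Longrightarrow> f z = 0"
    and "(\<integral>\<^sup>+ z. ennreal (f z) \<partial>lborel) = 1"
    and "\<And>m. m \<in> {1..k} \<Longrightarrow> smooth_pole_caps a (\<phi> m ` E) (Hl m) (Hr m)"
    and "\<And>m. m \<in> {1..k} \<Longrightarrow> \<exists>\<eta>. 0 < \<eta> \<and> \<eta> < 1 \<and> curvature_condition a \<eta> (Hl m) (Hr m)"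
    and "\<And>m. m \<in> {1..k} \<Longrightarrow>
           continuous (at (- a, 0) within \<phi> m ` E) (f \<circ> inv (\<phi> m)) \<and>
           continuous (at (a, 0) within \<phi> m ` E) (f \<circ> inv (\<phi> m))"
    and "\<And>m. m \<in> {1..k} \<Longrightarrow> pl m = (f \<circ> inv (\<phi> m)) (- a, 0) \<and> pl m > 0"
    and "\<And>m. m \<in> {1..k} \<Longrightarrow> pr m = (f \<circ> inv (\<phi> m)) (a, 0) \<and> pr m > 0"
    \<comment> \<open>the random sample and the Poisson sample sizes\<close>
    and "prob_space M"
    and "prob_space.indep_vars M (\<lambda>_. borel) Z {1..}"
    and "\<And>i. i \<ge> 1 \<Longrightarrow> distributed M lborel (Z i) (\<lambda>z. ennreal (f z))"
    and "\<And>n. n \<ge> 1 \<Longrightarrow> N n \<in> measurable M (count_space UNIV) \<and>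
           distr M (count_space UNIV) (N n) = measure_pmf (poisson_pmf (real n))"
    and "\<And>n. n \<ge> 1 \<Longrightarrow>
           prob_space.indep_set M
             (sets (vimage_algebra (space M) (N n) (count_space UNIV)))
             (sets (vimage_algebra (space M) (\<lambda>\<omega>. \<lambda>i\<in>{1..}. Z i \<omega>) (PiM {1..} (\<lambda>_. borel))))"
    \<comment> \<open>the limiting Poisson processes\<close>
    and "prob_space P"
    and "\<And>m. m \<in> {1..k} \<Longrightarrow> poisson_process P (cap_intensity (pl m) (Hl m)) (X m)"
    and "\<And>m. m \<in> {1..k} \<Longrightarrow> poisson_process P (cap_intensity (pr m) (Hr m)) (Y m)"
    and "indep_point_processes P (case_sum X Y) ({1..k} <+> {1..k})"
    \<comment> \<open>the limiting variables of the individual pole pairs\<close>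
    and "prob_space Q"
    and "prob_space.indep_vars Q (\<lambda>_. borel) V {1..k}"
    and "\<And>m. m \<in> {1..k} \<Longrightarrow> distr Q borel (V m) = distr P borel (min_pair_value a (X m) (Y m))"
  shows
    \<comment> \<open>the infima over all pairs are almost surely minima\<close>
    "(\<forall>m\<in>{1..k}. min_pair_value a (X m) (Y m) \<in> borel_measurable P \<and>
        (AE \<omega> in P. \<exists>i\<ge>1. \<exists>j\<ge>1.
           pair_value a (X m i \<omega>) (Y m j \<omega>) = min_pair_value a (X m) (Y m) \<omega> \<and>
           (\<forall>i'\<ge>1. \<forall>j'\<ge>1.
              min_pair_value a (X m) (Y m) \<omega> \<le> pair_value a (X m i' \<omega>) (Y m j' \<omega>)))) \<and>
     weak_conv_m
       (\<lambda>n. distr M borel (\<lambda>\<omega>.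
          real n powr (2 / (real DIM('n point) + 1)) *
            (2 * a - sample_diam (\<lambda>i. Z i \<omega>) (N n \<omega>))))
       (distr Q borel (\<lambda>\<omega>. Min ((\<lambda>m. V m \<omega>) ` {1..k}))) \<and>
     weak_conv_m
       (\<lambda>n. distr M borel (\<lambda>\<omega>.
          real n powr (2 / (real DIM('n point) + 1)) *
            (2 * a - sample_diam (\<lambda>i. Z i \<omega>) n)))
       (distr Q borel (\<lambda>\<omega>. Min ((\<lambda>m. V m \<omega>) ` {1..k})))"
proof -
  \<comment> \<open>The end \<open>True\<close> is the right pole \<open>y m\<close>; composing
    \<open>\<phi> m\<close> with the reflection moves it to the left.\<close>
  define pole where "pole m c = (if c then y m else x m)" for m c
  define chart where "chart m c = (if c then (\<lambda>z. mirror (\<phi> m z)) else \<phi> m)" for m c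
  define hess where "hess m c = (if c then Hr m else Hl m)" for m c
  define p where "p m c = (if c then pr m else pl m)" for m c
  define XX where "XX m c = (if c then Y m else X m)" for m c
  note defs = pole_def chart_def hess_def p_def XX_def
  have rigid: "rigid_motion (\<phi> m)" "\<phi> m (x m) = (- a, 0)" "\<phi> m (y m) = (a, 0)" if "m \<in> {1..k}" for m
    using assms(9)[OF that] by auto
  have in_E: "x m \<in> E" "y m \<in> E" if "m \<in> {1..k}" for m
    using assms(6)[OF that] by auto
  have image_mirror: "(\<lambda>z. mirror (\<phi> m z)) ` E = mirror ` \<phi> m ` E" for m
    by (simp add: image_image)
  have inv_mirror: "inv (\<lambda>z. mirror (\<phi> m z)) = (\<lambda>z. inv (\<phi> m) (mirror z))" if "m \<in> {1..k}" for m
  proof (rule inv_equality)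
    show "inv (\<phi> m) (mirror (mirror (\<phi> m z))) = z" for z
      using rigid_motion_bij[OF rigid(1)[OF that]] by (simp add: bij_is_inj)
    show "mirror (\<phi> m (inv (\<phi> m) (mirror z))) = z" for z
      using rigid_motion_bij[OF rigid(1)[OF that]] by (simp add: bij_is_surj surj_f_inv_f)
  qed
  interpret diametral_set a k E pole chart hess
  proof
    show "a > 0" "closed E" "bounded E" "diameter E = 2 * a" by fact+
    fix m c assume m: "m \<in> {1..k}"
    show "pole m c \<in> E" using in_E[OF m] by (simp add: pole_def)
    show "rigid_motion (chart m c)"
      using rigid(1)[OF m] rigid_motion_mirror[OF rigid(1)[OF m]] by (simp add: chart_def)
    show "chart m c (pole m c) = (- a, 0)"
      using rigid(2,3)[OF m] by (simp add: chart_def pole_def mirror_def)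
    show "chart m (\<not> c) z = mirror (chart m c z)" for z by (simp add: chart_def)
    show "smooth_left_cap a (chart m c ` E) (hess m c)"
      using assms(14)[OF m] smooth_right_cap_mirror[of a "\<phi> m ` E" "Hr m"]
      by (simp add: chart_def hess_def smooth_pole_caps_def image_mirror)
    show "\<exists>\<eta>>0. \<eta> < 1 \<and> (\<forall>c v w. (norm (v - w))\<^sup>2 \<le>
      2 * a * \<eta> * (v \<bullet> (hess m c *v v) + w \<bullet> (hess m (\<not> c) *v w)))"
    proof -
      obtain \<eta> where \<eta>: "0 < \<eta>" "\<eta> < 1" "curvature_condition a \<eta> (Hl m) (Hr m)"
        using assms(15)[OF m] by blast
      \<comment> \<open>The inequality is symmetric under exchanging the vectors together with the
        Hessians, so one \<open>\<eta>\<close> serves both values of \<open>c\<close>.\<close>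
      have "(norm (v - w))\<^sup>2 \<le> 2 * a * \<eta> * (v \<bullet> (hess m c *v v) + w \<bullet> (hess m (\<not> c) *v w))" for c v w
        using curvature_condition_imp[OF \<eta>(3), of v w] curvature_condition_imp[OF \<eta>(3), of w v]
        by (simp add: hess_def norm_minus_commute add.commute)
      then show ?thesis using \<eta> by blast
    qed
  next
    fix u v assume u: "u \<in> E" "\<And>m c. m \<in> {1..k} \<Longrightarrow> u \<noteq> pole m c" "v \<in> E"
    have "u \<noteq> x m" "u \<noteq> y m" if "m \<in> {1..k}" for m
      using u(2)[OF that, of False] u(2)[OF that, of True] by (simp_all add: pole_def)
    then have "u \<notin> x ` {1..k} \<union> y ` {1..k}" by blast
    then show "norm (u - v) < 2 * a" using assms(8)[of u v] u by blast
  next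
    fix m m' c c' assume "m \<in> {1..k}" "m' \<in> {1..k}" "m \<noteq> m'"
    from assms(7)[OF this] show "pole m c \<noteq> pole m' c' \<or> pole m (\<not> c) \<noteq> pole m' (\<not> c')"
      by (cases c; cases c') (auto simp: pole_def)
  qed
  have pp: "poisson_process P (cap_intensity (p m c) (hess m c)) (XX m c)" if "m \<in> {1..k}" for m c
    using assms(25,26)[OF that] by (simp add: p_def hess_def XX_def)
  have p_pos: "p m c > 0" if "m \<in> {1..k}" for m c
    using assms(17,18)[OF that] by (simp add: p_def)
  interpret P: prob_space P by fact
  interpret pole_processes a k E pole chart hess p P XX
  proof
    fix m assume m: "m \<in> {1..k}"
    show "XX m c i \<in> borel_measurable P" if "i \<ge> 1" for c i
      using poisson_process_measurable[OF assms(24) pp[OF m] that, of c]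
      by (simp add: measurable_cong_sets[OF refl sets_cap_intensity])
    show "AE \<omega> in P. \<forall>i\<ge>1. XX m c i \<omega> \<in> paraboloid (hess m c)" for c
      using poisson_process_null[OF assms(24) pp[OF m], of "- paraboloid (hess m c)" c]
      by (simp add: sets_cap_intensity emeasure_cap_intensity)
    show "AE \<omega> in P. finite {i\<in>{1..}. XX m c i \<omega> \<in> cball 0 R}" for c R
      using emeasure_cap_intensity_bounded[of "cball 0 R"]
      by (intro poisson_process_locally_finite[OF assms(24) pp[OF m]]) (auto simp: sets_cap_intensity)
    fix B :: "bool \<Rightarrow> 'n point set" assume B: "\<And>c. B c \<in> sets borel" "\<And>c. bounded (B c)"
    have single: "measure P {\<omega>\<in>space P. \<forall>i\<ge>1. XX m c i \<omega> \<notin> B c} =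
        exp (- (p m c * measure lborel (B c \<inter> paraboloid (hess m c))))" for c
    proof -
      have "measure P {\<omega>\<in>space P. \<forall>i\<ge>1. XX m c i \<omega> \<notin> B c} =
          exp (- measure (cap_intensity (p m c) (hess m c)) (B c))"
        by (rule poisson_process_avoid[OF assms(24) pp[OF m]])
          (use B emeasure_cap_intensity_bounded[OF B] in \<open>auto simp: sets_cap_intensity\<close>)
      then show ?thesis using p_pos[OF m, of c] by (simp add: measure_cap_intensity B)
    qed
    \<comment> \<open>\<open>Inl m\<close> and \<open>Inr m\<close> index the processes at the left
      and at the right pole of diameter \<open>m\<close>.\<close>
    let ?J = "{Inl m, Inr m} :: (nat + nat) set"
    let ?B = "case_sum (\<lambda>_. B False) (\<lambda>_. B True)"
    have "measure P {\<omega>\<in>space P. \<forall>j\<in>?J. \<forall>i\<ge>1. case_sum X Y j i \<omega> \<notin> ?B j} =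
        (\<Prod>j\<in>?J. measure P {\<omega>\<in>space P. \<forall>i\<ge>1. case_sum X Y j i \<omega> \<notin> ?B j})"
      by (rule indep_processes_avoid[OF assms(24,27)]) (use m B in auto)
    then show "measure P {\<omega>\<in>space P. \<forall>c. \<forall>i\<ge>1. XX m c i \<omega> \<notin> B c} =
      exp (- (\<Sum>c\<in>UNIV. p m c * measure lborel (B c \<inter> paraboloid (hess m c))))"
      using single[of False] single[of True]
      by (simp add: XX_def all_bool_eq UNIV_bool exp_add[symmetric] conj_commute add.commute)
  qed
  have pole_min: "pole_min m = min_pair_value a (X m) (Y m)" for m
    by (simp add: pole_min_def XX_def)
  have f_cont: "continuous (at (- a, 0) within chart m c ` E) (f \<circ> inv (chart m c))"
    and f_pole: "p m c = (f \<circ> inv (chart m c)) (- a, 0)" if m: "m \<in> {1..k}" for m c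
  proof -
    \<comment> \<open>In the mirrored chart the density is
      \<open>(f \<circ> inv (\<phi> m)) \<circ> mirror\<close>; its continuity at the left pole is
      the assumed continuity at the right pole.\<close>
    have "continuous (at (- a, 0) within mirror ` \<phi> m ` E) ((f \<circ> inv (\<phi> m)) \<circ> mirror)"
    proof (rule continuous_within_compose)
      show "continuous (at (- a, 0) within mirror ` \<phi> m ` E) mirror"
        using orthogonal_transformation_continuous_on[OF orthogonal_transformation_mirror, of UNIV]
        by (auto simp: continuous_on_eq_continuous_at intro: continuous_at_imp_continuous_at_within)
      show "continuous (at (mirror (- a, 0)) within mirror ` mirror ` \<phi> m ` E) (f \<circ> inv (\<phi> m))"
        using assms(16)[OF m] by (simp add: image_image) (simp add: mirror_def image_image[symmetric])
    qed
    then show "continuous (at (- a, 0) within chart m c ` E) (f \<circ> inv (chart m c))"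
      using assms(16)[OF m] inv_mirror[OF m] by (simp add: chart_def image_mirror comp_def)
    show "p m c = (f \<circ> inv (chart m c)) (- a, 0)"
      using assms(17,18)[OF m] inv_mirror[OF m] by (simp add: p_def chart_def mirror_def)
  qed
  interpret M: prob_space M by fact
  interpret fixed: diametral_sample a k E pole chart hess p P XX f M Z "\<lambda>n _. n"
  proof unfold_locales
    fix A :: "nat \<Rightarrow> 'n point set" and l
    assume A: "\<And>n. A n \<in> sets borel"
      and "(\<lambda>n. real n * measure (density lborel (\<lambda>z. ennreal (f z))) (A n)) \<longlonglongrightarrow> l"
    then have "(\<lambda>n. (1 - measure (density lborel (\<lambda>z. ennreal (f z))) (A n)) ^ n) \<longlonglongrightarrow> exp (- l)"
      by (intro power_tendsto_exp_neg) auto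
    then show "(\<lambda>n. M.prob {\<omega>\<in>space M. \<forall>i\<in>{1..n}. Z i \<omega> \<notin> A n}) \<longlonglongrightarrow> exp (- l)"
      by (simp only: M.prob_sample_avoids[OF assms(20,21) A])
  qed (use assms(10-13,21) f_cont f_pole in auto)
  \<comment> \<open>The assumptions on the Poisson sizes start at \<open>n = 1\<close>;
    \<open>max 1 n\<close> supplies a measurable size at the index 0 too, which does not affect
    limits.\<close>
  interpret poisson: diametral_sample a k E pole chart hess p P XX f M Z "\<lambda>n. N (max 1 n)"
  proof unfold_locales
    show "N (max 1 n) \<in> measurable M (count_space UNIV)" for n
      using assms(22)[of "max 1 n"] by simp
    fix A :: "nat \<Rightarrow> 'n point set" and l
    assume A: "\<And>n. A n \<in> sets borel"
      and l: "(\<lambda>n. real n * measure (density lborel (\<lambda>z. ennreal (f z))) (A n)) \<longlonglongrightarrow> l"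
    have "(\<lambda>n. exp (- (real n * measure (density lborel (\<lambda>z. ennreal (f z))) (A n)))) \<longlonglongrightarrow> exp (- l)"
      by (intro tendsto_intros l)
    moreover have "\<forall>\<^sub>F n in sequentially. exp (- (real n * measure (density lborel (\<lambda>z. ennreal (f z))) (A n)))
        = M.prob {\<omega>\<in>space M. \<forall>i\<in>{1..N (max 1 n) \<omega>}. Z i \<omega> \<notin> A n}"
      using eventually_ge_at_top[of 1]
    proof eventually_elim
      case (elim n)
      then have "max 1 n = n" by simp
      then show ?case
        using M.prob_poisson_sample_avoids[OF assms(20,21) A elim, of "N n"] assms(22,23)[OF elim] by simp
    qed
    ultimately show "(\<lambda>n. M.prob {\<omega>\<in>space M. \<forall>i\<in>{1..N (max 1 n) \<omega>}. Z i \<omega> \<notin> A n}) \<longlonglongrightarrow> exp (- l)"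
      by (rule Lim_transform_eventually)
  qed (use assms(10-13,21) f_cont f_pole in auto)
  have k1: "k \<ge> 1" using assms(2) by simp
  have V: "distr Q borel (V m) = distr P borel (pole_min m)" if "m \<in> {1..k}" for m
    using assms(30)[OF that] by (simp add: pole_min)
  have minimum: "min_pair_value a (X m) (Y m) \<in> borel_measurable P \<and>
        (AE \<omega> in P. \<exists>i\<ge>1. \<exists>j\<ge>1.
           pair_value a (X m i \<omega>) (Y m j \<omega>) = min_pair_value a (X m) (Y m) \<omega> \<and>
           (\<forall>i'\<ge>1. \<forall>j'\<ge>1.
              min_pair_value a (X m) (Y m) \<omega> \<le> pair_value a (X m i' \<omega>) (Y m j' \<omega>)))"
    if m: "m \<in> {1..k}" for m
  proof
    show "min_pair_value a (X m) (Y m) \<in> borel_measurable P"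
      using pole_min_measurable[OF m] by (simp add: pole_min)
    show "AE \<omega> in P. \<exists>i\<ge>1. \<exists>j\<ge>1.
           pair_value a (X m i \<omega>) (Y m j \<omega>) = min_pair_value a (X m) (Y m) \<omega> \<and>
           (\<forall>i'\<ge>1. \<forall>j'\<ge>1.
              min_pair_value a (X m) (Y m) \<omega> \<le> pair_value a (X m i' \<omega>) (Y m j' \<omega>))"
      using pole_min_attained[OF m] pole_min_le[OF m]
      unfolding pole_min XX_def if_True if_False by eventually_elim blast
  qed
  have "weak_conv_m
       (\<lambda>n. distr M borel (\<lambda>\<omega>. real n powr (2 / (real DIM('n point) + 1)) *
            (2 * a - sample_diam (\<lambda>i. Z i \<omega>) (N n \<omega>))))
       (distr Q borel (\<lambda>\<omega>. Min ((\<lambda>m. V m \<omega>) ` {1..k})))"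
  proof (rule poisson.sample_weak_conv[OF k1 assms(28,29) V])
    fix n :: nat assume "n \<ge> 1"
    then have "max 1 n = n" by simp
    then show "distr M borel (\<lambda>\<omega>. real n powr (2 / (real DIM('n point) + 1)) *
            (2 * a - sample_diam (\<lambda>i. Z i \<omega>) (N n \<omega>))) = distr M borel (poisson.sample_stat n)"
      unfolding poisson.sample_stat_def[abs_def] by (simp only:)
  qed
  moreover have "weak_conv_m
       (\<lambda>n. distr M borel (\<lambda>\<omega>. real n powr (2 / (real DIM('n point) + 1)) *
            (2 * a - sample_diam (\<lambda>i. Z i \<omega>) n)))
       (distr Q borel (\<lambda>\<omega>. Min ((\<lambda>m. V m \<omega>) ` {1..k})))"
    by (rule fixed.sample_weak_conv[OF k1 assms(28,29) V]) (simp_all only: fixed.sample_stat_def[abs_def])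
  ultimately show ?thesis using minimum by blast
qed

end
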